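(* Consider Local Exact-Diffusion (LED), and suppose the network, noise and smoothness assumptions stated in the context hold. Then, for sufficiently small constant stepsize $\alpha$ and for $\beta=1/\tau$, it holds that $$\frac1R\sum_{r=0}^{R-1}\mathcal E_r\;\le\; O\left(\frac{f(\bar x^0)-f^\star}{\alpha\tau R}+\frac{\alpha^2\tau^2L^2\varsigma_0^2}{(1-\lambda)^2R}\right)+O\left(\frac{\alpha L\sigma^2}{N}+\frac{\alpha^2\tau L^2\sigma^2}{1-\lambda}\right),$$ where the first $O(\cdot)$ is the deterministic part, the second $O(\cdot)$ is the stochastic part, and $$\mathcal E_r=\mathbb E\|\nabla f(\bar x^r)\|^2+\frac1\tau\sum_{t=0}^{\tau-1}\mathbb E\Big\|\frac1N\sum_{i=1}^N\nabla f_i(\phi_{i,t}^r)\Big\|^2,\qquad \varsigma_0^2=\frac1N\sum_{i=1}^N\|\nabla f_i(\bar x^0)-\nabla f(\bar x^0)\|^2 .$$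
   Context: Setting. There are $N$ nodes connected by an undirected network; $\mathcal N_i$ is the set of neighbors of node $i$, including $i$. Node $i$ has $f_i:\mathbb R^m\to\mathbb R$, $f_i(x)=\mathbb E[F_i(x;\xi_i)]$, and $f=\frac1N\sum_{i=1}^N f_i$. LED. Parameters: an integer $\tau\ge1$ (number of local steps), stepsizes $\alpha,\beta>0$, and an $N\times N$ weight matrix $W=[w_{ij}]$ with $w_{ij}\ge 0$ and $w_{ij}=0$ for $j\notin\mathcal N_i$. Given $x_i^0\in\mathbb R^m$, set $y_i^0=x_i^0-\sum_{j\in\mathcal N_i}w_{ij}x_j^0$ for all $i$ (or $y_i^0=0$ for all $i$). For $r=0,1,2,\dots$, each node $i$ sets $\phi_{i,0}^r=x_i^r$ and performs $$\phi_{i,t+1}^r=\phi_{i,t}^r-\alpha\nabla F_i(\phi_{i,t}^r;\xi_{i,t}^r)-\beta y_i^r\quad(t=0,\dots,\tau-1),$$ $$x_i^{r+1}=\sum_{j\in\mathcal N_i} w_{ij}\phi_{j,\tau}^r,\qquad y_i^{r+1}=y_i^r+\phi_{i,\tau}^r-x_i^{r+1}.$$ Write $\bar x^r=\frac1N\sum_{i=1}^N x_i^r$. Network assumption. $W$ is symmetric, doubly stochastic, primitive and positive definite. The mixing rate is $\lambda=\|W-\frac1N\mathbf 1\mathbf 1^T\|<1$ (spectral norm), i.e. the second largest eigenvalue of $W$. Noise assumption. For some $\sigma^2\ge0$ and all $i,r,t$, conditionally on all iterates generated so far, $\nabla F_i(\phi_{i,t}^r;\xi_{i,t}^r)$ has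 mean $\nabla f_i(\phi_{i,t}^r)$ and $\mathbb E\|\nabla F_i(\phi_{i,t}^r;\xi_{i,t}^r)-\nabla f_i(\phi_{i,t}^r)\|^2\le\sigma^2$; moreover the random data $\xi_{i,t}^r$ are independent of each other for all $i$ and $t$. Smoothness assumption. Each $f_i$ satisfies $\|\nabla f_i(y)-\nabla f_i(z)\|\le L\|y-z\|$ for all $y,z\in\mathbb R^m$, for some $L>0$; and $f$ is bounded below, $f(x)\ge f^\star>-\infty$ for every $x$, where $f^\star$ is the optimal value of $f$.
   Formalization: All nodes are assumed to start from the same point (x_i^0 = x_j^0 for all i, j); for arbitrary starting points the bound fails, since it has no term for the initial consensus error. *)

theory Defs
  imports "HOL-Probability.Probability" "Jordan_Normal_Form.Matrix"
begin

(* Node indices are natural numbers below N, so that N can be quantified inside a formula.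
   The decision space R^m is a type of class euclidean_space (real ^ 'm, for instance). *)

definition neighborhoods :: "nat \<Rightarrow> (nat \<Rightarrow> nat set) \<Rightarrow> bool" where
  "neighborhoods N nbr \<longleftrightarrow>
     (\<forall>i<N. nbr i \<subseteq> {..<N} \<and> i \<in> nbr i \<and> (\<forall>j \<in> nbr i. i \<in> nbr j))"

definition doubly_stochastic :: "nat \<Rightarrow> real mat \<Rightarrow> bool" where
  "doubly_stochastic N W \<longleftrightarrow>
     (\<forall>i<N. \<forall>j<N. 0 \<le> W $$ (i, j)) \<and>
     (\<forall>i<N. (\<Sum>j<N. W $$ (i, j)) = 1) \<and>
     (\<forall>j<N. (\<Sum>i<N. W $$ (i, j)) = 1)"

definition primitive_mat :: "nat \<Rightarrow> real mat \<Rightarrow> bool" where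
  "primitive_mat N W \<longleftrightarrow> (\<exists>k>0. \<forall>i<N. \<forall>j<N. 0 < (W ^\<^sub>m k) $$ (i, j))"

definition positive_definite :: "nat \<Rightarrow> real mat \<Rightarrow> bool" where
  "positive_definite N W \<longleftrightarrow>
     (\<forall>v \<in> carrier_vec N. v \<noteq> 0\<^sub>v N \<longrightarrow> 0 < scalar_prod v (W *\<^sub>v v))"

definition vec_norm2 :: "real vec \<Rightarrow> real" where
  "vec_norm2 v = sqrt (scalar_prod v v)"

definition spectral_norm :: "real mat \<Rightarrow> real" where
  "spectral_norm A =
     (SUP v \<in> {v \<in> carrier_vec (dim_col A). vec_norm2 v \<le> 1}. vec_norm2 (A *\<^sub>v v))"

definition mixing_rate :: "nat \<Rightarrow> real mat \<Rightarrow> real" where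
  "mixing_rate N W = spectral_norm (W - mat N N (\<lambda>_. 1 / real N))"

definition network_assumption :: "nat \<Rightarrow> (nat \<Rightarrow> nat set) \<Rightarrow> real mat \<Rightarrow> bool" where
  "network_assumption N nbr W \<longleftrightarrow>
     1 \<le> N \<and> neighborhoods N nbr \<and> W \<in> carrier_mat N N \<and>
     (\<forall>i<N. \<forall>j<N. j \<notin> nbr i \<longrightarrow> W $$ (i, j) = 0) \<and>
     transpose_mat W = W \<and> doubly_stochastic N W \<and> primitive_mat N W \<and>
     positive_definite N W \<and> mixing_rate N W < 1"

definition grad :: "('a::euclidean_space \<Rightarrow> real) \<Rightarrow> 'a \<Rightarrow> 'a" where
  "grad f x = (THE D. GDERIV f x :> D)"

definition avg :: "nat \<Rightarrow> (nat \<Rightarrow> 'a::euclidean_space) \<Rightarrow> 'a" where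
  "avg N u = (1 / real N) *\<^sub>R (\<Sum>i<N. u i)"

definition mean_cost :: "nat \<Rightarrow> (nat \<Rightarrow> 'a::euclidean_space \<Rightarrow> real) \<Rightarrow> 'a \<Rightarrow> real" where
  "mean_cost N f x = (1 / real N) * (\<Sum>i<N. f i x)"

(* D i is the law of the generic datum of node i, so the integral is the expectation of F i x.
   Joint measurability of the gradient follows from the other conditions (the partial derivatives
   are limits of difference quotients of a Caratheodory function); it is listed because library
   conditional expectations of non-measurable functions have a dummy value. *)
definition stochastic_costs ::
  "nat \<Rightarrow> (nat \<Rightarrow> 's measure) \<Rightarrow> (nat \<Rightarrow> 'a::euclidean_space \<Rightarrow> 's \<Rightarrow> real) \<Rightarrow>
   (nat \<Rightarrow> 'a \<Rightarrow> real) \<Rightarrow> bool" where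
  "stochastic_costs N D F f \<longleftrightarrow>
     (\<forall>i<N. prob_space (D i) \<and>
       (\<forall>x. integrable (D i) (F i x) \<and> f i x = (\<integral>s. F i x s \<partial>D i)) \<and>
       (\<forall>s \<in> space (D i). \<forall>x. (\<lambda>z. F i z s) differentiable (at x)) \<and>
       (\<lambda>(x, s). grad (\<lambda>z. F i z s) x) \<in> borel \<Otimes>\<^sub>M D i \<rightarrow>\<^sub>M borel)"

definition smoothness_assumption ::
  "nat \<Rightarrow> real \<Rightarrow> (nat \<Rightarrow> 'a::euclidean_space \<Rightarrow> real) \<Rightarrow> bool" where
  "smoothness_assumption N L f \<longleftrightarrow>
     L > 0 \<and>
     (\<forall>i<N. (\<forall>x. f i differentiable (at x)) \<and>
       (\<forall>y z. norm (grad (f i) y - grad (f i) z) \<le> L * norm (y - z))) \<and>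
     bdd_below (range (mean_cost N f))"

definition opt_value :: "nat \<Rightarrow> (nat \<Rightarrow> 'a::euclidean_space \<Rightarrow> real) \<Rightarrow> real" where
  "opt_value N f = (INF x. mean_cost N f x)"

(* Index order: node i, round r, local step t; \<omega> is the sample point. *)
definition LED_run ::
  "nat \<Rightarrow> (nat \<Rightarrow> nat set) \<Rightarrow> real mat \<Rightarrow> nat \<Rightarrow> real \<Rightarrow> real \<Rightarrow> 'w set \<Rightarrow>
   (nat \<Rightarrow> 'a::euclidean_space \<Rightarrow> 's \<Rightarrow> real) \<Rightarrow> (nat \<Rightarrow> nat \<Rightarrow> nat \<Rightarrow> 'w \<Rightarrow> 's) \<Rightarrow>
   (nat \<Rightarrow> 'a) \<Rightarrow> (nat \<Rightarrow> nat \<Rightarrow> 'w \<Rightarrow> 'a) \<Rightarrow> (nat \<Rightarrow> nat \<Rightarrow> 'w \<Rightarrow> 'a) \<Rightarrow>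
   (nat \<Rightarrow> nat \<Rightarrow> nat \<Rightarrow> 'w \<Rightarrow> 'a) \<Rightarrow> bool" where
  "LED_run N nbr W \<tau> \<alpha> \<beta> \<Omega> F \<xi> x0 x y \<phi> \<longleftrightarrow>
     (\<forall>i<N. \<forall>\<omega>\<in>\<Omega>. x i 0 \<omega> = x0 i) \<and>
     ((\<forall>i<N. \<forall>\<omega>\<in>\<Omega>. y i 0 \<omega> = x0 i - (\<Sum>j\<in>nbr i. W $$ (i, j) *\<^sub>R x0 j)) \<or>
      (\<forall>i<N. \<forall>\<omega>\<in>\<Omega>. y i 0 \<omega> = 0)) \<and>
     (\<forall>r. \<forall>i<N. \<forall>\<omega>\<in>\<Omega>.
        \<phi> i r 0 \<omega> = x i r \<omega> \<and>
        (\<forall>t<\<tau>. \<phi> i r (Suc t) \<omega> =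
           \<phi> i r t \<omega> - \<alpha> *\<^sub>R grad (\<lambda>z. F i z (\<xi> i r t \<omega>)) (\<phi> i r t \<omega>) - \<beta> *\<^sub>R y i r \<omega>) \<and>
        x i (Suc r) \<omega> = (\<Sum>j\<in>nbr i. W $$ (i, j) *\<^sub>R \<phi> j r \<tau> \<omega>) \<and>
        y i (Suc r) \<omega> = y i r \<omega> + \<phi> i r \<tau> \<omega> - x i (Suc r) \<omega>)"

(* All iterates up to local step t of round r. The x-iterates are the \<phi>-iterates with s = 0,
   and the y-iterates are functions of the others. *)
definition past ::
  "'w measure \<Rightarrow> nat \<Rightarrow> nat \<Rightarrow> (nat \<Rightarrow> nat \<Rightarrow> nat \<Rightarrow> 'w \<Rightarrow> 'a::euclidean_space) \<Rightarrow>
   nat \<Rightarrow> nat \<Rightarrow> 'w measure" where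
  "past M N \<tau> \<phi> r t =
     sigma (space M)
       {\<phi> j q s -` A \<inter> space M | j q s A.
          j < N \<and> (q < r \<and> s \<le> \<tau> \<or> q = r \<and> s \<le> t) \<and> A \<in> sets borel}"

(* The vector-valued conditional mean is stated coordinatewise, and the conditional second moment
   in the extended nonnegative reals, so that no integrability has to be presupposed. *)
definition noise_assumption ::
  "'w measure \<Rightarrow> nat \<Rightarrow> nat \<Rightarrow> (nat \<Rightarrow> 's measure) \<Rightarrow>
   (nat \<Rightarrow> 'a::euclidean_space \<Rightarrow> 's \<Rightarrow> real) \<Rightarrow> (nat \<Rightarrow> 'a \<Rightarrow> real) \<Rightarrow>
   (nat \<Rightarrow> nat \<Rightarrow> nat \<Rightarrow> 'w \<Rightarrow> 's) \<Rightarrow> (nat \<Rightarrow> nat \<Rightarrow> nat \<Rightarrow> 'w \<Rightarrow> 'a) \<Rightarrow> real \<Rightarrow> bool" where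
  "noise_assumption M N \<tau> D F f \<xi> \<phi> \<sigma> \<longleftrightarrow>
     0 \<le> \<sigma> \<and>
     prob_space.indep_vars M (\<lambda>(i, r, t). D i) (\<lambda>(i, r, t). \<xi> i r t)
       ({..<N} \<times> UNIV \<times> {..<\<tau>}) \<and>
     (\<forall>i<N. \<forall>r. \<forall>t<\<tau>.
        (\<forall>b\<in>Basis. AE \<omega> in M.
           real_cond_exp M (past M N \<tau> \<phi> r t)
             (\<lambda>\<omega>. inner (grad (\<lambda>z. F i z (\<xi> i r t \<omega>)) (\<phi> i r t \<omega>)) b) \<omega>
           = inner (grad (f i) (\<phi> i r t \<omega>)) b) \<and>
        (AE \<omega> in M.
           nn_cond_exp M (past M N \<tau> \<phi> r t)
             (\<lambda>\<omega>. ennreal ((norm (grad (\<lambda>z. F i z (\<xi> i r t \<omega>)) (\<phi> i r t \<omega>)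
                                   - grad (f i) (\<phi> i r t \<omega>)))\<^sup>2)) \<omega>
           \<le> ennreal (\<sigma>\<^sup>2)))"

definition round_error ::
  "'w measure \<Rightarrow> nat \<Rightarrow> nat \<Rightarrow> (nat \<Rightarrow> 'a::euclidean_space \<Rightarrow> real) \<Rightarrow>
   (nat \<Rightarrow> nat \<Rightarrow> 'w \<Rightarrow> 'a) \<Rightarrow> (nat \<Rightarrow> nat \<Rightarrow> nat \<Rightarrow> 'w \<Rightarrow> 'a) \<Rightarrow> nat \<Rightarrow> real" where
  "round_error M N \<tau> f x \<phi> r =
     (\<integral>\<omega>. (norm (grad (mean_cost N f) (avg N (\<lambda>i. x i r \<omega>))))\<^sup>2 \<partial>M) +
     (1 / real \<tau>) *
       (\<Sum>t<\<tau>. \<integral>\<omega>. (norm (avg N (\<lambda>i. grad (f i) (\<phi> i r t \<omega>))))\<^sup>2 \<partial>M)"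

definition heterogeneity ::
  "nat \<Rightarrow> (nat \<Rightarrow> 'a::euclidean_space \<Rightarrow> real) \<Rightarrow> 'a \<Rightarrow> real" where
  "heterogeneity N f z =
     (1 / real N) * (\<Sum>i<N. (norm (grad (f i) z - grad (mean_cost N f) z))\<^sup>2)"

end

(* Write J for the averaging matrix, T = W - J, A = I - T, H_i(z) = grad f_i(z) - grad f(z). In the
   deviation X = x - xbar and the recentred dual variable Z = y + alpha tau H(xbar) = A U, a round acts as
     X' = T (X - A U - alpha q),   U' = T U + X - alpha q + alpha tau A^{-1} (H(xbar') - H(xbar)),
   where q collects the gradient drift of the local steps and the noise. Since 0 <= T <= lambda, the form
   V = |X|^2 + <U, T A U> is contracted by lambda when q = 0 and xbar' = xbar; the noise enters V with
   weight alpha^2 and is orthogonal to the linear part, which yields a dependence on 1/(1 - lambda) only.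
   V does not dominate |Z|^2 when T is nearly singular, but Z' = A U' is controlled by V one round later.
   The client drift is bounded by |X|^2, |Z|^2, the gradient norm and the noise. The descent inequality
   for f(xbar), together with the summed recursions for V, |Z|^2 and the drift, closes for
   alpha tau L <= (1 - lambda)^2 / 200. *)
theory Submission
  imports Defs "Jordan_Normal_Form.Determinant"
begin

text \<open>On an eigenspace of \<open>T\<close> with eigenvalue s the noise-free map in (X, U) is
  planar with trace 2 s and determinant s, so for 0 < s < 1 its eigenvalues are a complex pair of
  modulus sqrt s. V restricts to x^2 + s (1 - s) u^2, the Euclidean form adapted to that pair, and
  is therefore multiplied by exactly s. No eigenbasis is built: the moments <u, T^k u> and
  Cauchy-Schwarz for semidefinite forms replace it. The other obstacle is the noise. Its conditional
  mean is given relative to the past iterates, while the gain 1/N needs the noises of different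
  nodes at one step to be orthogonal. So the conditional statement is used once, to show that the
  gradient error, integrated over the law of the datum, vanishes at almost every current iterate;
  independence of the data then gives orthogonality to everything built from the other data. The
  factor (1 - lambda)^2 below the heterogeneity arises in two halves: V starts at most at |Z|^2 / (1
  - lambda) when the initial points are consensual, and summing a sequence that contracts at a rate
  of order 1 - lambda costs the second factor.\<close>

no_notation scalar_prod (infix \<open>\<bullet>\<close> 70)

section \<open>A contracting quadratic form\<close>

definition ip :: "nat \<Rightarrow> (nat \<Rightarrow> 'a::euclidean_space) \<Rightarrow> (nat \<Rightarrow> 'a) \<Rightarrow> real" where
  "ip N u v = (\<Sum>i<N. u i \<bullet> v i)"

lemma ip_commute: "ip N u v = ip N v u"
  by (simp add: ip_def inner_commute)

lemma ip_lin:
  "ip N (\<lambda>i. u i + v i) w = ip N u w + ip N v w"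
  "ip N w (\<lambda>i. u i + v i) = ip N w u + ip N w v"
  "ip N (\<lambda>i. u i - v i) w = ip N u w - ip N v w"
  "ip N w (\<lambda>i. u i - v i) = ip N w u - ip N w v"
  "ip N (\<lambda>i. a *\<^sub>R u i) w = a * ip N u w"
  "ip N w (\<lambda>i. a *\<^sub>R u i) = a * ip N w u"
  by (simp_all add: ip_def inner_add_left inner_add_right inner_diff_left inner_diff_right
      sum.distrib sum_subtractf sum_distrib_left)

lemma ip_self: "ip N u u = (\<Sum>i<N. (norm (u i))\<^sup>2)"
  by (simp add: ip_def power2_norm_eq_inner)

lemma ip_self_nonneg [simp]: "0 \<le> ip N u u"
  by (simp add: ip_self sum_nonneg)

lemma ip_cong: "(\<And>i. i < N \<Longrightarrow> u i = u' i) \<Longrightarrow> (\<And>i. i < N \<Longrightarrow> v i = v' i) \<Longrightarrow> ip N u v = ip N u' v'"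
  by (simp add: ip_def)

lemma ip_self_eq_0: "ip N u u = 0 \<longleftrightarrow> (\<forall>i<N. u i = 0)"
  by (auto simp: ip_self sum_nonneg_eq_0_iff)

text \<open>Evaluate at the minimiser s = b / d. For d = 0 the expression is affine in s, and s = (a
  + 1) / (2 b) would give it the value -1 unless b = 0.\<close>

lemma quadratic_nonneg_imp_discriminant:
  fixes a b d :: real
  assumes d: "0 \<le> d" and nonneg: "\<And>s. 0 \<le> a - 2 * s * b + s\<^sup>2 * d"
  shows "b\<^sup>2 \<le> a * d"
proof (cases "d = 0")
  case True
  have "b = 0"
  proof (rule ccontr)
    assume "b \<noteq> 0"
    then show False using nonneg[of "(a + 1) / (2 * b)"] True by (simp add: field_simps)
  qed
  then show ?thesis using True by simp
next
  case False
  with d have "d > 0" by simp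
  then show ?thesis using nonneg[of "b / d"]
    by (simp add: power2_eq_square field_simps)
qed

section \<open>Self-adjoint semidefinite operators on tuples of vectors\<close>

locale psd_op =
  fixes N :: nat and B :: "(nat \<Rightarrow> 'a::euclidean_space) \<Rightarrow> nat \<Rightarrow> 'a" and c :: real
  assumes op_add: "B (\<lambda>i. u i + v i) = (\<lambda>i. B u i + B v i)"
    and op_scale: "B (\<lambda>i. a *\<^sub>R u i) = (\<lambda>i. a *\<^sub>R B u i)"
    and selfadj: "ip N (B u) v = ip N u (B v)"
    and op_nonneg: "0 \<le> ip N u (B u)"
    and op_le: "ip N u (B u) \<le> c * ip N u u"
    and c_nonneg: "0 \<le> c"
begin

lemma op_diff: "B (\<lambda>i. u i - v i) = (\<lambda>i. B u i - B v i)"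
  using op_add[of u "\<lambda>i. (-1) *\<^sub>R v i"] unfolding op_scale by simp

lemma op_swap: "ip N u (B v) = ip N v (B u)"
  by (metis selfadj ip_commute)

lemma cauchy_schwarz: "(ip N u (B v))\<^sup>2 \<le> ip N u (B u) * ip N v (B v)"
proof (rule quadratic_nonneg_imp_discriminant[OF op_nonneg])
  fix s :: real
  have "0 \<le> ip N (\<lambda>i. u i - s *\<^sub>R v i) (B (\<lambda>i. u i - s *\<^sub>R v i))" by (rule op_nonneg)
  also have "\<dots> = ip N u (B u) - 2 * s * ip N u (B v) + s\<^sup>2 * ip N v (B v)"
    by (simp add: op_diff op_scale ip_lin op_swap[of v u] power2_eq_square algebra_simps)
  finally show "0 \<le> ip N u (B u) - 2 * s * ip N u (B v) + s\<^sup>2 * ip N v (B v)" .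
qed

text \<open>Spectrally this is s^2 <= c s on [0, c]. Instead of a spectrum, the proof uses
  Cauchy-Schwarz for the form of \<open>B\<close> at \<open>u\<close> and \<open>B u\<close>, bounds
  the factor <B u, B (B u)> by \<open>op_le\<close>, and divides by |B u|^2.\<close>

lemma op_square_le: "ip N (B u) (B u) \<le> c * ip N u (B u)"
proof (cases "ip N (B u) (B u) = 0")
  case True
  then show ?thesis using c_nonneg op_nonneg by simp
next
  case False
  then have pos: "ip N (B u) (B u) > 0" using ip_self_nonneg[of N "B u"] by linarith
  have "(ip N u (B (B u)))\<^sup>2 \<le> ip N u (B u) * ip N (B u) (B (B u))" by (rule cauchy_schwarz)
  also have "\<dots> \<le> ip N u (B u) * (c * ip N (B u) (B u))"
    by (intro mult_left_mono op_le op_nonneg)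
  finally have "ip N (B u) (B u) * ip N (B u) (B u) \<le> (c * ip N u (B u)) * ip N (B u) (B u)"
    by (simp add: selfadj[symmetric] power2_eq_square algebra_simps)
  then show ?thesis using pos by simp
qed

lemma op_norm_le: "ip N (B u) (B u) \<le> c\<^sup>2 * ip N u u"
  using op_square_le[of u] mult_left_mono[OF op_le c_nonneg, of u]
  by (simp add: power2_eq_square algebra_simps)

end

section \<open>Contraction of the primal-dual energy\<close>

locale mixing_op = psd_op N T lam
  for N :: nat and T :: "(nat \<Rightarrow> 'a::euclidean_space) \<Rightarrow> nat \<Rightarrow> 'a" and lam :: real +
  assumes lam_less: "lam < 1"
begin

definition A :: "(nat \<Rightarrow> 'a) \<Rightarrow> nat \<Rightarrow> 'a" where
  "A u = (\<lambda>i. u i - T u i)"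

lemma ip_T_le: "ip N u (T u) \<le> ip N u u"
  using op_le[of u] mult_right_mono[of lam 1 "ip N u u"] lam_less by simp

lemma T_square_le: "ip N (T u) (T u) \<le> ip N u (T u)"
  using op_square_le[of u] mult_right_mono[of lam 1 "ip N u (T u)"] lam_less op_nonneg by simp

lemma A_psd: "psd_op N A 1"
  by unfold_locales
    (auto simp: A_def op_add op_scale ip_lin selfadj fun_eq_iff algebra_simps ip_T_le op_nonneg)

text \<open>Spectrally 0 <= s (1 - s) <= 1. This makes the dual part of the energy below a
  semidefinite form that dominates |T A u|^2.\<close>

lemma TA_psd: "psd_op N (\<lambda>u. T (A u)) 1"
proof -
  have *: "ip N u (T (T u)) \<le> ip N u (T u)" for u using T_square_le[of u] by (simp add: selfadj)
  have **: "ip N u (T u) \<le> ip N u u + ip N u (T (T u))" for u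
    using ip_T_le[of u] ip_self_nonneg[of N "T u"] unfolding selfadj by linarith
  show ?thesis
    by unfold_locales
      (auto simp: A_def op_add op_diff op_scale ip_lin selfadj fun_eq_iff algebra_simps * **)
qed

lemma A_lower: "(1 - lam) * ip N u u \<le> ip N u (A u)"
  using op_le[of u] by (simp add: A_def ip_lin algebra_simps)

text \<open>Expanding the square of A u - (1 - lam) u reduces the bound to \<open>A_lower\<close>.
  It supplies both the injectivity of \<open>A\<close> and the price of inverting it.\<close>

lemma A_inverse_bound: "(1 - lam)\<^sup>2 * ip N u u \<le> ip N (A u) (A u)"
proof -
  have "0 \<le> ip N (\<lambda>i. A u i - (1 - lam) *\<^sub>R u i) (\<lambda>i. A u i - (1 - lam) *\<^sub>R u i)" by simp
  also have "\<dots> = ip N (A u) (A u) - 2 * (1 - lam) * ip N u (A u) + (1 - lam)\<^sup>2 * ip N u u"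
    by (simp only: ip_lin) (simp add: ip_commute[of N "A u" u] power2_eq_square algebra_simps)
  also have "\<dots> \<le> ip N (A u) (A u) - (1 - lam)\<^sup>2 * ip N u u"
    using mult_left_mono[OF A_lower[of u], of "2 * (1 - lam)"] lam_less
    by (simp add: power2_eq_square algebra_simps)
  finally show ?thesis by simp
qed

lemma A_inj:
  assumes "\<And>i. i < N \<Longrightarrow> A u i = A v i" "i < N"
  shows "u i = v i"
proof -
  let ?d = "\<lambda>i. u i - v i"
  have "A ?d i = 0" if "i < N" for i using assms(1)[OF that] by (simp add: A_def op_diff algebra_simps)
  then have "ip N (A ?d) (A ?d) = 0" by (simp add: ip_self_eq_0)
  then have "(1 - lam)\<^sup>2 * ip N ?d ?d \<le> 0" using A_inverse_bound[of ?d] by simp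
  then have "ip N ?d ?d \<le> 0" using lam_less by (simp add: mult_le_0_iff)
  then have "ip N ?d ?d = 0" using ip_self_nonneg[of N ?d] by linarith
  then show ?thesis using assms(2) by (simp add: ip_self_eq_0)
qed

text \<open>Tuples are total functions on the naturals, and the axioms do not say directly that
  \<open>T\<close> ignores entries from N on. Boundedness settles it: a tuple that vanishes below N
  has norm 0, hence so has its image.\<close>

lemma T_cong:
  assumes "\<And>i. i < N \<Longrightarrow> u i = v i" "i < N"
  shows "T u i = T v i"
proof -
  let ?d = "\<lambda>i. u i - v i"
  have "ip N ?d ?d = 0" using assms(1) by (simp add: ip_self_eq_0)
  then have "ip N (T ?d) (T ?d) \<le> 0" using op_norm_le[of ?d] by simp
  then have "ip N (T ?d) (T ?d) = 0" using ip_self_nonneg[of N "T ?d"] by linarith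
  then show ?thesis using assms(2) by (simp add: ip_self_eq_0 op_diff)
qed

text \<open>On an eigenvector of \<open>T\<close> the averaged dynamics \<open>x \<mapsto> T (x - A u)\<close>, \<open>u \<mapsto> T u + x\<close> is a
  planar map; this is the quadratic form that it contracts by exactly the eigenvalue.\<close>

definition energy :: "(nat \<Rightarrow> 'a) \<Rightarrow> (nat \<Rightarrow> 'a) \<Rightarrow> real" where
  "energy x u = ip N x x + ip N u (T u) - ip N (T u) (T u)"

definition polar :: "(nat \<Rightarrow> 'a) \<Rightarrow> (nat \<Rightarrow> 'a) \<Rightarrow> (nat \<Rightarrow> 'a) \<Rightarrow> (nat \<Rightarrow> 'a) \<Rightarrow> real" where
  "polar x u x' u' = ip N x x' + ip N u (T u') - ip N (T u) (T u')"

lemma energy_ge: "ip N x x \<le> energy x u"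
  using T_square_le[of u] by (simp add: energy_def)

lemma energy_nonneg: "0 \<le> energy x u"
  using energy_ge[of x u] ip_self_nonneg[of N x] by linarith

lemma energy_cong:
  assumes "\<And>i. i < N \<Longrightarrow> x i = x' i" "\<And>i. i < N \<Longrightarrow> u i = u' i"
  shows "energy x u = energy x' u'"
proof -
  have "T u i = T u' i" if "i < N" for i using T_cong[OF assms(2) that] .
  then show ?thesis using assms by (simp add: energy_def ip_def)
qed

lemma energy_add:
  "energy (\<lambda>i. x i + k *\<^sub>R x' i) (\<lambda>i. u i + k *\<^sub>R u' i) =
     energy x u + 2 * k * polar x u x' u' + k\<^sup>2 * energy x' u'"
  by (simp add: energy_def polar_def op_add op_scale ip_lin op_swap[of u' u]
      ip_commute[of N x' x] ip_commute[of N "T u'" "T u"] power2_eq_square algebra_simps)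

text \<open>This is nonnegativity of the energy at (x - x' / \<theta>, u - u' / \<theta>),
  multiplied by \<theta>.\<close>

lemma energy_young:
  assumes "0 < \<theta>"
  shows "energy (\<lambda>i. x i + x' i) (\<lambda>i. u i + u' i) \<le>
    (1 + \<theta>) * energy x u + (1 + 1 / \<theta>) * energy x' u'"
proof -
  have 1: "energy (\<lambda>i. x i + x' i) (\<lambda>i. u i + u' i) = energy x u + 2 * polar x u x' u' + energy x' u'"
    using energy_add[of x 1 x' u u'] by simp
  have scale: "\<theta> * (energy x u - 2 / \<theta> * polar x u x' u' + (1/\<theta>)\<^sup>2 * energy x' u') =
      \<theta> * energy x u - 2 * polar x u x' u' + 1 / \<theta> * energy x' u'"
    using assms by (simp add: field_simps power2_eq_square)
  have "0 \<le> energy (\<lambda>i. x i + (- (1/\<theta>)) *\<^sub>R x' i) (\<lambda>i. u i + (- (1/\<theta>)) *\<^sub>R u' i)"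
    by (rule energy_nonneg)
  then have "0 \<le> \<theta> * (energy x u - 2 / \<theta> * polar x u x' u' + (1/\<theta>)\<^sup>2 * energy x' u')"
    unfolding energy_add using assms by simp
  then have "0 \<le> \<theta> * energy x u - 2 * polar x u x' u' + 1 / \<theta> * energy x' u'"
    unfolding scale .
  then show ?thesis unfolding 1 by (simp add: algebra_simps)
qed

text \<open>For an eigenvalue s the left side is s x^2 + s^2 (1 - s) u^2: the weight s (1 - s) on
  the dual part is the one for which the cross terms cancel. What remains is a moment inequality in
  \<open>u\<close>.\<close>

lemma energy_contraction:
  "energy (T (\<lambda>i. x i - A u i)) (\<lambda>i. T u i + x i) \<le> lam * energy x u"
proof -
  have flip: "ip N u x = ip N x u" "ip N u (T x) = ip N x (T u)"
    "ip N u (T (T x)) = ip N x (T (T u))" "ip N u (T (T (T x))) = ip N x (T (T (T u)))"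
    "ip N u (T (T (T (T x)))) = ip N x (T (T (T (T u))))"
    by (simp_all only: ip_commute[of N u x] op_swap[of u x] op_swap[of u "T x"] op_swap[of u "T (T x)"]
        op_swap[of u "T (T (T x))"] selfadj)
  define m1 m2 m3 where "m1 = ip N u (T u)" and "m2 = ip N u (T (T u))" and "m3 = ip N u (T (T (T u)))"
  have eq: "energy (T (\<lambda>i. x i - A u i)) (\<lambda>i. T u i + x i) = ip N x (T x) + (m2 - m3)"
    unfolding energy_def A_def m2_def m3_def
    by (simp add: op_diff op_add ip_lin selfadj flip)
  have m2': "m2 = ip N (T u) (T u)" and m3': "m3 = ip N (T u) (T (T u))"
    by (simp_all add: m2_def m3_def selfadj)
  have m1: "0 \<le> m1" unfolding m1_def by (rule op_nonneg)
  have m2: "0 \<le> m2" "m2 \<le> lam * m1" unfolding m2' using op_square_le[of u] by (simp_all add: m1_def)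
  have m3: "0 \<le> m3" unfolding m3' by (rule op_nonneg)
  have cs: "m2\<^sup>2 \<le> m1 * m3" using cauchy_schwarz[of u "T u"] by (simp add: m1_def m2_def m3' )
  \<comment> \<open>This says <u, T A (lam I - T) u> >= 0. Since m2^2 <= m1 m3, it follows from (lam
    m1 - m2) (m1 - m2) >= 0 after division by m1.\<close>
  have "m2 - m3 \<le> lam * (m1 - m2)"
  proof (cases "m1 = 0")
    case True
    then show ?thesis using m2 m3 by simp
  next
    case False
    with m1 have m1': "m1 > 0" by simp
    have "0 \<le> (lam * m1 - m2) * (m1 - m2)"
      using m2 m1 mult_right_mono[of lam 1 m1] lam_less by (intro mult_nonneg_nonneg) auto
    also have "\<dots> \<le> m1 * (lam * m1 - (1 + lam) * m2 + m3)"
      using cs by (simp add: algebra_simps power2_eq_square)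
    finally have "0 \<le> lam * m1 - (1 + lam) * m2 + m3" using m1' by (simp add: zero_le_mult_iff)
    then show ?thesis by (simp add: algebra_simps)
  qed
  moreover have "ip N x (T x) \<le> lam * ip N x x" by (rule op_le)
  moreover have "lam * energy x u = lam * ip N x x + lam * (m1 - m2)"
    by (simp add: energy_def m2' m1_def algebra_simps)
  ultimately show ?thesis unfolding eq by linarith
qed


text \<open>A round moves the pair (X, U) in the direction (T n, n), and in that direction every
  term with \<open>u\<close> cancels. To first order the noise meets only the deviation
  \<open>x\<close>.\<close>

lemma polar_averaged_noise:
  "polar (T (\<lambda>i. x i - A u i)) (\<lambda>i. T u i + x i) (T n) n = ip N (T x) n"
  by (simp add: polar_def A_def op_diff op_add ip_lin selfadj)

lemma energy_averaged_noise: "energy (T n) n = ip N n (T n)"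
  by (simp add: energy_def)

text \<open>Spectrally (1 - lam) s (1 - s) <= (1 - s)^2. For a purely dual perturbation known
  through A u this costs one factor 1 / (1 - lam), where bounding |u|^2 by
  \<open>A_inverse_bound\<close> would cost two.\<close>

lemma energy_dual_only:
  "(1 - lam) * energy (\<lambda>i. 0) u \<le> ip N (A u) (A u)"
proof -
  have A_le: "ip N (A u) (A u) \<le> ip N u (A u)" using psd_op.op_square_le[OF A_psd, of u] by simp
  have "(ip N u (T (A u)))\<^sup>2 \<le> ip N u (T u) * ip N (A u) (T (A u))" by (rule cauchy_schwarz)
  have e: "energy (\<lambda>i. 0) u = ip N (A u) (T u)"
    by (simp add: energy_def A_def ip_lin) (simp add: ip_def)
  have "0 \<le> ip N (\<lambda>i. A u i - (1 - lam) *\<^sub>R T u i) (\<lambda>i. A u i - (1 - lam) *\<^sub>R T u i)" by simp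
  then have 1: "2 * (1 - lam) * ip N (A u) (T u) \<le> ip N (A u) (A u) + (1 - lam)\<^sup>2 * ip N (T u) (T u)"
    by (simp add: ip_lin ip_commute[of N "T u" "A u"] power2_eq_square algebra_simps del: ip_self_nonneg)
  have "lam\<^sup>2 \<le> 1" using lam_less c_nonneg by (simp add: power_le_one)
  then have "ip N (T u) (T u) \<le> ip N u u"
    using op_norm_le[of u] mult_right_mono[of "lam\<^sup>2" 1 "ip N u u"] by simp
  then have "(1 - lam)\<^sup>2 * ip N (T u) (T u) \<le> (1 - lam)\<^sup>2 * ip N u u" by (intro mult_left_mono) auto
  with A_inverse_bound[of u] 1 have "2 * (1 - lam) * ip N (A u) (T u) \<le> 2 * ip N (A u) (A u)" by linarith
  then show ?thesis unfolding e mult.assoc by linarith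
qed

text \<open>The noise \<open>n\<close> stays with the contracting part: its cross term remains
  linear, ready to vanish in expectation, and its square avoids the factor 1 / (1 - lam). Young's
  inequality with parameter (1 - lam) / 2 separates only the drift \<open>p\<close> and the shift
  \<open>w\<close>, at the price 1 + 2 / (1 - lam) <= 3 / (1 - lam).\<close>

lemma energy_step:
  fixes a k :: real and p n :: "nat \<Rightarrow> 'a"
  defines "q \<equiv> (\<lambda>i. p i + n i)"
  shows "energy (T (\<lambda>i. x i - A u i - a *\<^sub>R q i)) (\<lambda>i. T u i + x i - a *\<^sub>R q i + k *\<^sub>R w i) \<le>
    (1 + (1 - lam) / 2) * (lam * energy x u - 2 * a * ip N (T x) n + a\<^sup>2 * ip N n n) +
    3 / (1 - lam) * (2 * a\<^sup>2 * ip N p p + 2 * k\<^sup>2 * ip N (A w) (A w) / (1 - lam))"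
proof -
  define e where "e = 1 - lam"
  have e: "0 < e" "e \<le> 1" using lam_less c_nonneg by (auto simp: e_def)
  define x1 where "x1 = (\<lambda>i. T (\<lambda>i. x i - A u i) i + (-a) *\<^sub>R T n i)"
  define u1 where "u1 = (\<lambda>i. T u i + x i + (-a) *\<^sub>R n i)"
  define x2 where "x2 = (\<lambda>i. (-a) *\<^sub>R T p i + k *\<^sub>R 0)"
  define u2 where "u2 = (\<lambda>i. (-a) *\<^sub>R p i + k *\<^sub>R w i)"
  have "energy (T (\<lambda>i. x i - A u i - a *\<^sub>R q i)) (\<lambda>i. T u i + x i - a *\<^sub>R q i + k *\<^sub>R w i)
      = energy (\<lambda>i. x1 i + x2 i) (\<lambda>i. u1 i + u2 i)"
    by (simp add: x1_def x2_def u1_def u2_def q_def op_diff op_scale op_add algebra_simps)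
  also have "\<dots> \<le> (1 + e / 2) * energy x1 u1 + (1 + 1 / (e / 2)) * energy x2 u2"
    using e by (intro energy_young) simp
  also have "\<dots> \<le> (1 + e / 2) * (lam * energy x u - 2 * a * ip N (T x) n + a\<^sup>2 * ip N n n)
      + 3 / e * (2 * a\<^sup>2 * ip N p p + 2 * k\<^sup>2 * ip N (A w) (A w) / e)"
  proof (intro add_mono mult_mono)
    show "energy x1 u1 \<le> lam * energy x u - 2 * a * ip N (T x) n + a\<^sup>2 * ip N n n"
      unfolding x1_def u1_def energy_add polar_averaged_noise energy_averaged_noise
      using energy_contraction[of x u] mult_left_mono[OF ip_T_le[of n], of "a\<^sup>2"] by simp
    have "energy x2 u2 \<le> 2 * energy (\<lambda>i. (-a) *\<^sub>R T p i) (\<lambda>i. (-a) *\<^sub>R p i)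
        + 2 * energy (\<lambda>i. k *\<^sub>R 0) (\<lambda>i. k *\<^sub>R w i)"
      unfolding x2_def u2_def
      using energy_young[of 1 "\<lambda>i. (-a) *\<^sub>R T p i" "\<lambda>i. k *\<^sub>R 0" "\<lambda>i. (-a) *\<^sub>R p i" "\<lambda>i. k *\<^sub>R w i"]
      by simp
    also have "energy (\<lambda>i. (-a) *\<^sub>R T p i) (\<lambda>i. (-a) *\<^sub>R p i) = a\<^sup>2 * energy (T p) p"
      unfolding energy_def by (simp only: op_scale ip_lin) (simp add: power2_eq_square algebra_simps)
    also have "energy (\<lambda>i. k *\<^sub>R 0) (\<lambda>i. k *\<^sub>R w i) = k\<^sup>2 * energy (\<lambda>i. 0) w"
      unfolding energy_def by (simp only: op_scale ip_lin) (simp add: power2_eq_square algebra_simps)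
    also have "energy (T p) p \<le> ip N p p"
      unfolding energy_averaged_noise by (rule ip_T_le)
    also have "energy (\<lambda>i. 0) w \<le> ip N (A w) (A w) / e"
      using energy_dual_only[of w] e by (simp add: e_def field_simps)
    finally show "energy x2 u2 \<le> 2 * a\<^sup>2 * ip N p p + 2 * k\<^sup>2 * ip N (A w) (A w) / e"
      by (simp add: mult_left_mono)
    show "1 + 1 / (e / 2) \<le> 3 / e" using e by (simp add: field_simps)
  qed (use e in \<open>auto simp: energy_nonneg\<close>)
  finally show ?thesis by (simp add: e_def)
qed

lemma ip_sum2_le: "ip N (\<lambda>i. v i + w i) (\<lambda>i. v i + w i) \<le> 2 * ip N v v + 2 * ip N w w"
proof -
  have "0 \<le> ip N (\<lambda>i. v i - w i) (\<lambda>i. v i - w i)" by simp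
  then show ?thesis by (simp add: ip_lin ip_commute[of N w v] del: ip_self_nonneg)
qed

text \<open>The new dual variable A u' contains the old \<open>u\<close> only as T A u, and |T A
  u|^2 <= <u, T A u> is part of the energy. The extra \<open>T\<close> gained in one round is what
  makes the comparison possible.\<close>

lemma dual_step:
  fixes a k :: real and p n u x w :: "nat \<Rightarrow> 'a"
  defines "q \<equiv> (\<lambda>i. p i + n i)"
  defines "u' \<equiv> (\<lambda>i. T u i + x i - a *\<^sub>R q i + k *\<^sub>R w i)"
  shows "ip N (A u') (A u') \<le>
    8 * energy x u + 8 * a\<^sup>2 * ip N p p + 8 * a\<^sup>2 * ip N n n + 4 * k\<^sup>2 * ip N (A w) (A w)"
proof -
  interpret A: psd_op N A 1 by (rule A_psd)
  interpret TA: psd_op N "\<lambda>u. T (A u)" 1 by (rule TA_psd)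
  have AT: "A (T u) = T (A u)" by (simp add: A_def op_diff)
  have "A u' = (\<lambda>i. (T (A u) i + A x i) + ((-a) *\<^sub>R A q i + k *\<^sub>R A w i))"
    unfolding u'_def by (simp add: A.op_diff A.op_scale A.op_add AT algebra_simps)
  then have "ip N (A u') (A u') \<le> 2 * (2 * ip N (T (A u)) (T (A u)) + 2 * ip N (A x) (A x)) +
     2 * (2 * ip N (\<lambda>i. (-a) *\<^sub>R A q i) (\<lambda>i. (-a) *\<^sub>R A q i) + 2 * ip N (\<lambda>i. k *\<^sub>R A w i) (\<lambda>i. k *\<^sub>R A w i))"
    using ip_sum2_le[of "\<lambda>i. T (A u) i + A x i" "\<lambda>i. (-a) *\<^sub>R A q i + k *\<^sub>R A w i"]
      ip_sum2_le[of "T (A u)" "A x"] ip_sum2_le[of "\<lambda>i. (-a) *\<^sub>R A q i" "\<lambda>i. k *\<^sub>R A w i"]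
    by simp
  also have "\<dots> = 4 * (ip N (T (A u)) (T (A u)) + ip N (A x) (A x)) + 4 * a\<^sup>2 * ip N (A q) (A q)
      + 4 * k\<^sup>2 * ip N (A w) (A w)"
    unfolding ip_lin by (simp add: power2_eq_square)
  also have "ip N (T (A u)) (T (A u)) + ip N (A x) (A x) \<le> 2 * energy x u"
  proof -
    have "energy x u = ip N x x + ip N u (T (A u))"
      by (simp add: energy_def A_def op_diff ip_lin selfadj)
    moreover have "ip N (T (A u)) (T (A u)) \<le> ip N u (T (A u))" using TA.op_square_le[of u] by simp
    moreover have "ip N (A x) (A x) \<le> ip N x x" using A.op_norm_le[of x] by simp
    ultimately show ?thesis using TA.op_nonneg[of u] ip_self_nonneg[of N x] by linarith
  qed
  also have "ip N (A q) (A q) \<le> 2 * ip N p p + 2 * ip N n n"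
    using A.op_norm_le[of q] ip_sum2_le[of p n] unfolding q_def by simp
  finally show ?thesis by (simp add: mult_left_mono) (simp add: algebra_simps)
qed

end

section \<open>The mixing matrix\<close>

lemma norm_sum_square_le:
  fixes v :: "'i \<Rightarrow> 'a::real_normed_vector"
  shows "(norm (sum v I))\<^sup>2 \<le> real (card I) * (\<Sum>i\<in>I. (norm (v i))\<^sup>2)"
proof -
  have "(norm (sum v I))\<^sup>2 \<le> (\<Sum>i\<in>I. norm (v i))\<^sup>2"
    by (intro power_mono norm_sum) auto
  also have "\<dots> \<le> (\<Sum>i\<in>I. (norm (v i))\<^sup>2) * real (card I)"
    by (rule sum_squared_le_sum_of_squares)
  finally show ?thesis by (simp add: mult.commute)
qed

lemma norm_add_square_le:
  fixes a b :: "'a::real_normed_vector"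
  shows "(norm (a + b))\<^sup>2 \<le> 2 * ((norm a)\<^sup>2 + (norm b)\<^sup>2)"
  using norm_sum_square_le[of "\<lambda>i. [a, b] ! i" "{..<2}"] by (simp add: numeral_eq_Suc)

lemma norm_add5_square_le:
  fixes a b c d e :: "'a::real_normed_vector"
  shows "(norm (a + b + c + d + e))\<^sup>2 \<le>
    5 * ((norm a)\<^sup>2 + (norm b)\<^sup>2 + (norm c)\<^sup>2 + (norm d)\<^sup>2 + (norm e)\<^sup>2)"
  using norm_sum_square_le[of "\<lambda>i. [a, b, c, d, e] ! i" "{..<5}"] by (simp add: numeral_eq_Suc add.assoc)

lemma avg_lin:
  "avg N (\<lambda>i. u i + v i) = avg N u + avg N v"
  "avg N (\<lambda>i. u i - v i) = avg N u - avg N v"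
  "avg N (\<lambda>i. a *\<^sub>R u i) = a *\<^sub>R avg N u"
  by (simp_all add: avg_def sum.distrib sum_subtractf scaleR_right_distrib scaleR_right_diff_distrib
      scaleR_sum_right mult.commute)

lemma avg_sum: "avg N (\<lambda>i. \<Sum>t\<in>I. u i t) = (\<Sum>t\<in>I. avg N (\<lambda>i. u i t))"
  by (simp add: avg_def scaleR_sum_right sum.swap[of _ I])

lemma avg_const: "1 \<le> N \<Longrightarrow> avg N (\<lambda>i. c) = c"
  by (simp add: avg_def sum_constant_scaleR)

lemma avg_cong: "(\<And>i. i < N \<Longrightarrow> u i = v i) \<Longrightarrow> avg N u = avg N v"
  by (simp add: avg_def)

lemma norm_avg_square_le:
  assumes "1 \<le> N"
  shows "(norm (avg N u))\<^sup>2 \<le> (1 / real N) * ip N u u"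
proof -
  have "(norm (avg N u))\<^sup>2 = (1 / real N)\<^sup>2 * (norm (\<Sum>i<N. u i))\<^sup>2"
    by (simp add: avg_def power_mult_distrib power_divide)
  also have "\<dots> \<le> (1 / real N)\<^sup>2 * (real N * ip N u u)"
    using norm_sum_square_le[of u "{..<N}"] by (intro mult_left_mono) (auto simp: ip_self)
  finally show ?thesis using assms by (simp add: power2_eq_square)
qed

definition dev :: "nat \<Rightarrow> (nat \<Rightarrow> 'a::euclidean_space) \<Rightarrow> nat \<Rightarrow> 'a" where
  "dev N u = (\<lambda>i. u i - avg N u)"

lemma avg_dev: "1 \<le> N \<Longrightarrow> avg N (dev N u) = 0"
  by (simp add: dev_def avg_lin avg_const)

lemma dev_lin:
  "dev N (\<lambda>i. u i + v i) = (\<lambda>i. dev N u i + dev N v i)"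
  "dev N (\<lambda>i. u i - v i) = (\<lambda>i. dev N u i - dev N v i)"
  "dev N (\<lambda>i. a *\<^sub>R u i) = (\<lambda>i. a *\<^sub>R dev N u i)"
  by (simp_all add: dev_def avg_lin algebra_simps)

lemma ip_const:
  assumes "1 \<le> N"
  shows "ip N (\<lambda>i. c) u = real N * (c \<bullet> avg N u)"
  using assms by (simp add: ip_def avg_def inner_sum_right)

lemma ip_dev_le:
  assumes "1 \<le> N"
  shows "ip N (dev N u) (dev N u) \<le> ip N u u"
proof -
  have "ip N (dev N u) (dev N u) = ip N u u - real N * (avg N u \<bullet> avg N u)"
    unfolding dev_def ip_lin ip_commute[of N u "\<lambda>i. avg N u"] ip_const[OF assms] avg_lin avg_const[OF assms]
    by simp
  then show ?thesis by simp
qed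

text \<open>Along the segment, F minus its quadratic upper model has derivative <G (z + t d) - G z,
  d> - L t |d|^2, which Cauchy-Schwarz and the Lipschitz bound make nonpositive.\<close>

lemma descent_lemma:
  fixes F :: "'a::euclidean_space \<Rightarrow> real"
  assumes grad: "\<And>z. GDERIV F z :> G z"
    and lip: "\<And>y z. norm (G y - G z) \<le> L * norm (y - z)"
  shows "F (z + d) \<le> F z + G z \<bullet> d + L / 2 * (norm d)\<^sup>2"
proof -
  define k where "k t = F (z + t *\<^sub>R d) - t * (G z \<bullet> d) - L / 2 * t\<^sup>2 * (norm d)\<^sup>2" for t :: real
  have "k 1 \<le> k 0"
  proof (rule DERIV_nonpos_imp_nonincreasing[where f = k and a = 0 and b = 1])
    fix t :: real assume t: "0 \<le> t" "t \<le> 1"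
    have "(F has_derivative (\<lambda>h. G (z + t *\<^sub>R d) \<bullet> h)) (at (z + t *\<^sub>R d))"
      using grad[of "z + t *\<^sub>R d"] by (simp add: gderiv_def inner_commute)
    moreover have "((\<lambda>t. z + t *\<^sub>R d) has_derivative (\<lambda>s. s *\<^sub>R d)) (at t)"
      by (auto intro!: derivative_eq_intros)
    ultimately have "((\<lambda>t. F (z + t *\<^sub>R d)) has_derivative (\<lambda>s. G (z + t *\<^sub>R d) \<bullet> (s *\<^sub>R d))) (at t)"
      using has_derivative_compose by fastforce
    then have "((\<lambda>t. F (z + t *\<^sub>R d)) has_real_derivative (G (z + t *\<^sub>R d) \<bullet> d)) (at t)"
      by (simp add: has_field_derivative_def mult_commute_abs)
    then have "(k has_real_derivative (G (z + t *\<^sub>R d) \<bullet> d - G z \<bullet> d - L * t * (norm d)\<^sup>2)) (at t)"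
      unfolding k_def by (auto intro!: derivative_eq_intros)
    moreover have "(G (z + t *\<^sub>R d) - G z) \<bullet> d \<le> L * t * (norm d)\<^sup>2"
    proof -
      have "(G (z + t *\<^sub>R d) - G z) \<bullet> d \<le> norm (G (z + t *\<^sub>R d) - G z) * norm d"
        by (rule norm_cauchy_schwarz)
      also have "\<dots> \<le> (L * norm (z + t *\<^sub>R d - z)) * norm d" by (intro mult_right_mono lip) auto
      finally show ?thesis using t by (simp add: power2_eq_square algebra_simps)
    qed
    ultimately show "\<exists>y. (k has_real_derivative y) (at t) \<and> y \<le> 0"
      by (intro exI[of _ "G (z + t *\<^sub>R d) \<bullet> d - G z \<bullet> d - L * t * (norm d)\<^sup>2"])
        (auto simp: inner_diff_left)
  qed simp
  then show ?thesis by (simp add: k_def)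
qed

section \<open>From the weight matrix to the operator \<open>T\<close> and the inverse of
  \<open>A\<close>\<close>

locale network =
  fixes N :: nat and nbr :: "nat \<Rightarrow> nat set" and W :: "real mat" and lam :: real
  assumes net: "network_assumption N nbr W" and mix: "mixing_rate N W = lam"
begin

lemma N_pos: "1 \<le> N" using net by (simp add: network_assumption_def)

lemma W_carrier: "W \<in> carrier_mat N N" using net by (simp add: network_assumption_def)

lemma W_sym: "i < N \<Longrightarrow> j < N \<Longrightarrow> W $$ (i, j) = W $$ (j, i)"
  using net W_carrier index_transpose_mat(1)[of i W j] by (auto simp: network_assumption_def)

lemma W_row_sum: "i < N \<Longrightarrow> (\<Sum>j<N. W $$ (i, j)) = 1"
  using net by (simp add: network_assumption_def doubly_stochastic_def)

lemma W_col_sum: "j < N \<Longrightarrow> (\<Sum>i<N. W $$ (i, j)) = 1"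
  using net by (simp add: network_assumption_def doubly_stochastic_def)

lemma sum_nbr:
  fixes v :: "nat \<Rightarrow> 'a::real_vector"
  assumes i: "i < N"
  shows "(\<Sum>j\<in>nbr i. W $$ (i, j) *\<^sub>R v j) = (\<Sum>j<N. W $$ (i, j) *\<^sub>R v j)"
proof (rule sum.mono_neutral_left)
  show "nbr i \<subseteq> {..<N}" using net i by (auto simp: network_assumption_def neighborhoods_def)
  show "\<forall>j\<in>{..<N} - nbr i. W $$ (i, j) *\<^sub>R v j = 0"
    using net i by (auto simp: network_assumption_def)
qed simp

definition T :: "(nat \<Rightarrow> 'a::euclidean_space) \<Rightarrow> nat \<Rightarrow> 'a" where
  "T u = (\<lambda>i. \<Sum>j<N. (W $$ (i, j) - 1 / real N) *\<^sub>R u j)"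

lemma T_eq: "T u i = (\<Sum>j<N. W $$ (i, j) *\<^sub>R u j) - avg N u"
  by (simp add: T_def avg_def scaleR_diff_left sum_subtractf scaleR_sum_right)

lemma T_add: "T (\<lambda>i. u i + v i) = (\<lambda>i. T u i + T v i)"
  by (simp add: T_def scaleR_right_distrib sum.distrib)

lemma T_scale: "T (\<lambda>i. a *\<^sub>R u i) = (\<lambda>i. a *\<^sub>R T u i)"
  by (simp add: T_def scaleR_sum_right mult.commute)

lemma T_selfadj: "ip N (T u) v = ip N u (T v)"
proof -
  have "ip N (T u) v = (\<Sum>i<N. \<Sum>j<N. (W $$ (i, j) - 1 / real N) * (u j \<bullet> v i))"
    by (simp add: ip_def T_def inner_sum_left)
  also have "\<dots> = (\<Sum>j<N. \<Sum>i<N. (W $$ (j, i) - 1 / real N) * (u j \<bullet> v i))"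
    by (subst sum.swap) (auto intro!: sum.cong simp: W_sym)
  also have "\<dots> = ip N u (T v)"
    by (simp add: ip_def T_def inner_sum_right)
  finally show ?thesis .
qed

lemma T_const: "i < N \<Longrightarrow> T (\<lambda>j. c) i = 0"
  by (simp add: T_eq avg_const[OF N_pos] scaleR_sum_left[symmetric] W_row_sum)

lemma T_diff: "T (\<lambda>i. u i - v i) = (\<lambda>i. T u i - T v i)"
  by (simp add: T_def scaleR_right_diff_distrib sum_subtractf)

lemma T_dev: "i < N \<Longrightarrow> T (dev N u) i = T u i"
  by (simp add: dev_def T_diff T_const)

lemma ip_W_nonneg: "0 \<le> (\<Sum>i<N. u i * (\<Sum>j<N. W $$ (i, j) * u j))" for u :: "nat \<Rightarrow> real"
proof -
  let ?v = "vec N u"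
  have "scalar_prod ?v (W *\<^sub>v ?v) = (\<Sum>i<N. u i * (\<Sum>j<N. W $$ (i, j) * u j))"
    using W_carrier by (simp add: scalar_prod_def lessThan_atLeast0 cong: sum.cong_simp)
  moreover have "0 \<le> scalar_prod ?v (W *\<^sub>v ?v)"
  proof (cases "?v = 0\<^sub>v N")
    case True
    then show ?thesis using W_carrier by simp
  next
    case False
    then show ?thesis using net by (simp add: network_assumption_def positive_definite_def less_imp_le)
  qed
  ultimately show ?thesis by simp
qed

text \<open>\<open>W\<close> and \<open>T\<close> agree on deviations, and \<open>T\<close>
  annihilates constants; so <u, T u> is the quadratic form of \<open>W\<close> at
  \<open>dev N u\<close>.\<close>

lemma T_real_nonneg: "0 \<le> ip N u (T u)" for u :: "nat \<Rightarrow> real"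
proof -
  have "0 \<le> ip N (dev N u) (\<lambda>i. \<Sum>j<N. W $$ (i, j) *\<^sub>R dev N u j)"
    using ip_W_nonneg[of "dev N u"] by (simp add: ip_def)
  also have "\<dots> = ip N (dev N u) (T (dev N u))"
    by (intro ip_cong) (simp_all add: T_eq avg_dev[OF N_pos])
  also have "\<dots> = ip N u (T u)"
  proof -
    have "ip N (dev N u) (T (dev N u)) = ip N (dev N u) (T u)"
      by (intro ip_cong) (simp_all add: T_dev)
    also have "\<dots> = ip N (T (dev N u)) u" by (rule T_selfadj[symmetric])
    also have "\<dots> = ip N (T u) u" by (intro ip_cong) (simp_all add: T_dev)
    finally show ?thesis by (simp add: ip_commute)
  qed
  finally show ?thesis .
qed

lemma vec_norm2_sum: "v \<in> carrier_vec n \<Longrightarrow> vec_norm2 v = sqrt (\<Sum>i<n. (v $ i)\<^sup>2)"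
  by (simp add: vec_norm2_def scalar_prod_def lessThan_atLeast0 power2_eq_square)

text \<open>A supremum of reals dominates its members once the set is known to be bounded above; the
  crude row-sum constant \<open>K\<close> is there to show this.\<close>

lemma spectral_norm_upper:
  fixes A :: "real mat"
  assumes A: "A \<in> carrier_mat n n" and v: "v \<in> carrier_vec n" "vec_norm2 v \<le> 1"
  shows "vec_norm2 (A *\<^sub>v v) \<le> spectral_norm A"
proof -
  define K where "K = sqrt (\<Sum>i<n. (\<Sum>j<n. \<bar>A $$ (i, j)\<bar>)\<^sup>2)"
  have "vec_norm2 (A *\<^sub>v z) \<le> K" if z: "z \<in> carrier_vec n" "vec_norm2 z \<le> 1" for z
  proof -
    have z1: "\<bar>z $ j\<bar> \<le> 1" if "j < n" for j
    proof -
      have "(z $ j)\<^sup>2 \<le> (\<Sum>i<n. (z $ i)\<^sup>2)"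
        using that by (intro member_le_sum) auto
      also have "\<dots> \<le> 1" using z by (simp add: vec_norm2_sum)
      finally show ?thesis by (simp add: abs_square_le_1)
    qed
    have "\<bar>(A *\<^sub>v z) $ i\<bar> \<le> (\<Sum>j<n. \<bar>A $$ (i, j)\<bar>)" if "i < n" for i
    proof -
      have "(A *\<^sub>v z) $ i = (\<Sum>j<n. A $$ (i, j) * z $ j)"
        using A z that by (simp add: scalar_prod_def lessThan_atLeast0)
      also have "\<bar>\<dots>\<bar> \<le> (\<Sum>j<n. \<bar>A $$ (i, j) * z $ j\<bar>)" by (rule sum_abs)
      also have "\<dots> \<le> (\<Sum>j<n. \<bar>A $$ (i, j)\<bar>)"
        using z1 by (intro sum_mono) (auto simp: abs_mult mult_left_le)
      finally show ?thesis .
    qed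
    then have "(\<Sum>i<n. ((A *\<^sub>v z) $ i)\<^sup>2) \<le> (\<Sum>i<n. (\<Sum>j<n. \<bar>A $$ (i, j)\<bar>)\<^sup>2)"
      by (intro sum_mono abs_le_square_iff[THEN iffD1]) (auto simp: sum_nonneg)
    moreover have "A *\<^sub>v z \<in> carrier_vec n" using A z(1) by (rule mult_mat_vec_carrier)
    ultimately show ?thesis by (simp add: vec_norm2_sum K_def)
  qed
  then have "bdd_above ((\<lambda>v. vec_norm2 (A *\<^sub>v v)) ` {v \<in> carrier_vec (dim_col A). vec_norm2 v \<le> 1})"
    using A by (intro bdd_aboveI[of _ K]) auto
  then show ?thesis unfolding spectral_norm_def using A v by (intro cSUP_upper) auto
qed

lemma lam_nonneg: "0 \<le> lam"
proof -
  let ?A = "W - mat N N (\<lambda>_. 1 / real N)"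
  have A: "?A \<in> carrier_mat N N" by (rule minus_carrier_mat) simp
  have "vec_norm2 (?A *\<^sub>v 0\<^sub>v N) \<le> lam"
    using spectral_norm_upper[OF A, of "0\<^sub>v N"] mix
    by (simp add: mixing_rate_def vec_norm2_sum[of "0\<^sub>v N" N])
  moreover have "0 \<le> vec_norm2 (?A *\<^sub>v 0\<^sub>v N)"
    using mult_mat_vec_carrier[OF A, of "0\<^sub>v N"] by (subst vec_norm2_sum[of _ N]) (auto simp: sum_nonneg)
  ultimately show ?thesis by linarith
qed

lemma lam_less_1: "lam < 1"
  using net mix by (simp add: network_assumption_def)

lemma T_real_contraction: "ip N (T u) (T u) \<le> lam\<^sup>2 * ip N u u" for u :: "nat \<Rightarrow> real"
proof (cases "ip N u u = 0")
  case True
  then have "u i = 0" if "i < N" for i using that by (simp add: ip_self_eq_0)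
  then have "T u i = 0" for i by (simp add: T_def)
  then show ?thesis using True by (simp add: ip_def)
next
  case False
  define s where "s = sqrt (ip N u u)"
  have s: "s > 0" "s\<^sup>2 = ip N u u" using False by (simp_all add: s_def less_le)
  let ?A = "W - mat N N (\<lambda>_. 1 / real N)"
  have A: "?A \<in> carrier_mat N N" by (rule minus_carrier_mat) simp
  let ?v = "vec N (\<lambda>i. u i / s)"
  have "vec_norm2 ?v \<le> 1"
    using s by (simp add: vec_norm2_sum[of _ N] power_divide sum_divide_distrib[symmetric] ip_self)
  then have "vec_norm2 (?A *\<^sub>v ?v) \<le> lam"
    using spectral_norm_upper[OF A, of ?v] mix by (simp add: mixing_rate_def)
  moreover have "vec_norm2 (?A *\<^sub>v ?v) = sqrt (\<Sum>i<N. (T u i / s)\<^sup>2)"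
  proof -
    have "(?A *\<^sub>v ?v) $ i = T u i / s" if "i < N" for i
      using W_carrier that
      by (simp add: scalar_prod_def T_def lessThan_atLeast0 sum_divide_distrib cong: sum.cong_simp)
    then show ?thesis using mult_mat_vec_carrier[OF A, of ?v] by (subst vec_norm2_sum[of _ N]) auto
  qed
  ultimately have "(\<Sum>i<N. (T u i / s)\<^sup>2) \<le> lam\<^sup>2"
    by (simp add: sqrt_le_D)
  then have "ip N (T u) (T u) / s\<^sup>2 \<le> lam\<^sup>2"
    by (simp add: ip_self power_divide sum_divide_distrib)
  then have "ip N (T u) (T u) \<le> lam\<^sup>2 * s\<^sup>2" using s(1) by (simp add: pos_divide_le_eq)
  then show ?thesis using s(2) by simp
qed

text \<open>\<open>T\<close> acts on every coordinate separately, so the quadratic bounds proved for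
  real tuples pass to vector-valued ones by summing over the basis.\<close>

lemma ip_basis: "ip N u v = (\<Sum>b\<in>Basis. ip N (\<lambda>i. u i \<bullet> b) (\<lambda>i. v i \<bullet> b))"
proof -
  have "ip N u v = (\<Sum>i<N. \<Sum>b\<in>Basis. (u i \<bullet> b) * (v i \<bullet> b))"
    unfolding ip_def by (intro sum.cong refl euclidean_inner)
  then show ?thesis by (simp add: ip_def sum.swap[of _ Basis])
qed

lemma T_inner: "T u i \<bullet> b = T (\<lambda>j. u j \<bullet> b) i"
  by (simp add: T_def inner_sum_left)

lemma T_real_le: "ip N u (T u) \<le> lam * ip N u u" for u :: "nat \<Rightarrow> real"
proof -
  have "(ip N u (T u))\<^sup>2 \<le> ip N u u * ip N (T u) (T u)"
    using Cauchy_Schwarz_ineq_sum[of u "T u" "{..<N}"] by (simp add: ip_def power2_eq_square)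
  also have "\<dots> \<le> ip N u u * (lam\<^sup>2 * ip N u u)"
    by (intro mult_left_mono T_real_contraction) simp
  also have "\<dots> = (lam * ip N u u)\<^sup>2" by (simp add: power2_eq_square)
  finally show ?thesis by (rule power2_le_imp_le) (simp add: lam_nonneg)
qed

sublocale mixing_op N T lam
proof unfold_locales
  fix u :: "nat \<Rightarrow> 'a"
  show "0 \<le> ip N u (T u)"
    unfolding ip_basis[of u] T_inner by (intro sum_nonneg T_real_nonneg)
  show "ip N u (T u) \<le> lam * ip N u u"
    unfolding ip_basis[of u] T_inner sum_distrib_left by (intro sum_mono T_real_le)
qed (rule T_add T_scale T_selfadj lam_nonneg lam_less_1)+


text \<open>The inverse is wanted as a matrix of coefficients: applied to random tuples it is then a
  finite linear combination, which preserves square integrability. The determinant is nonzero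
  because \<open>A_inj\<close>, used on real tuples, excludes a kernel.\<close>

lemma A_right_inverse:
  "\<exists>B::real mat. \<forall>z :: nat \<Rightarrow> 'a::euclidean_space. \<forall>i<N. A (\<lambda>k. \<Sum>j<N. B $$ (k, j) *\<^sub>R z j) i = z i"
proof -
  let ?A = "mat N N (\<lambda>(i, j). (if i = j then 1 else 0) - (W $$ (i, j) - 1 / real N))"
  have A: "?A \<in> carrier_mat N N" by simp
  have delta: "(\<Sum>j<N. (if i = j then 1 else 0) *\<^sub>R u j) = u i" if "i < N"
    for i and u :: "nat \<Rightarrow> 'b::real_vector"
    using that by (simp add: if_distrib[of "\<lambda>c. c *\<^sub>R _"] cong: if_cong)
  have "det ?A \<noteq> 0"
  proof
    assume "det ?A = 0"
    then obtain v where v: "v \<in> carrier_vec N" "v \<noteq> 0\<^sub>v N" "?A *\<^sub>v v = 0\<^sub>v N"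
      using det_0_iff_vec_prod_zero[OF A] by auto
    have "A (\<lambda>i. v $ i) i = A (\<lambda>i. 0) i" if i: "i < N" for i
    proof -
      have "(?A *\<^sub>v v) $ i = (\<Sum>j<N. ((if i = j then 1 else 0) - (W $$ (i, j) - 1 / real N)) *\<^sub>R (v $ j))"
        using v(1) i by (simp add: scalar_prod_def lessThan_atLeast0)
      also have "\<dots> = A (\<lambda>i. v $ i) i"
        by (simp only: scaleR_diff_left sum_subtractf delta[OF i] A_def T_def)
      finally show ?thesis using v(3) i by (simp add: A_def T_def)
    qed
    then have "v $ i = 0" if "i < N" for i using A_inj[of "\<lambda>i. v $ i" "\<lambda>i. 0" i] that by simp
    then have "v = 0\<^sub>v N" using v(1) by (intro eq_vecI) auto
    with v(2) show False by simp
  qed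
  then have "?A \<in> Units (ring_mat TYPE(real) N ())" by (rule det_non_zero_imp_unit[OF A])
  then obtain B where B: "B \<in> carrier_mat N N" "?A * B = 1\<^sub>m N"
    unfolding Units_def ring_mat_def by auto
  have "A (\<lambda>k. \<Sum>j<N. B $$ (k, j) *\<^sub>R z j) i = z i" if i: "i < N" for z :: "nat \<Rightarrow> 'a" and i
  proof -
    have AB: "(\<Sum>k<N. ((if i = k then 1 else 0) - (W $$ (i, k) - 1 / real N)) * B $$ (k, j)) = (if i = j then 1 else 0)"
      if j: "j < N" for j
    proof -
      have "(?A * B) $$ (i, j) = (\<Sum>k<N. ((if i = k then 1 else 0) - (W $$ (i, k) - 1 / real N)) * B $$ (k, j))"
        using B(1) i j by (simp add: scalar_prod_def lessThan_atLeast0)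
      then show ?thesis using B(2) i j by simp
    qed
    have "A (\<lambda>k. \<Sum>j<N. B $$ (k, j) *\<^sub>R z j) i =
      (\<Sum>k<N. ((if i = k then 1 else 0) - (W $$ (i, k) - 1 / real N)) *\<^sub>R (\<Sum>j<N. B $$ (k, j) *\<^sub>R z j))"
      by (simp only: scaleR_diff_left sum_subtractf delta[OF i] A_def T_def)
    also have "\<dots> = (\<Sum>j<N. (\<Sum>k<N. ((if i = k then 1 else 0) - (W $$ (i, k) - 1 / real N)) * B $$ (k, j)) *\<^sub>R z j)"
      by (simp only: scaleR_sum_right scaleR_sum_left scaleR_scaleR) (rule sum.swap)
    also have "\<dots> = (\<Sum>j<N. (if i = j then 1 else 0) *\<^sub>R z j)"
      by (intro sum.cong refl) (simp only: AB lessThan_iff)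
    also have "\<dots> = z i" by (rule delta[OF i])
    finally show ?thesis .
  qed
  then show ?thesis by blast
qed

text \<open>The type argument records the space of the tuples over which the choice quantifies,
  since the type of the matrix does not show it.\<close>

definition inv_mat :: "'a::euclidean_space itself \<Rightarrow> real mat" where
  "inv_mat _ = (SOME B. \<forall>z :: nat \<Rightarrow> 'a. \<forall>i<N. A (\<lambda>k. \<Sum>j<N. B $$ (k, j) *\<^sub>R z j) i = z i)"

text \<open>A right inverse of \<open>A\<close>, at indices below N. Applied to the recentred dual
  variable it yields the tuple U with Z = A U.\<close>

definition S :: "(nat \<Rightarrow> 'a::euclidean_space) \<Rightarrow> nat \<Rightarrow> 'a" where
  "S z = (\<lambda>k. \<Sum>j<N. inv_mat TYPE('a) $$ (k, j) *\<^sub>R z j)"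

lemma A_S: "i < N \<Longrightarrow> A (S z) i = z i"
  using someI_ex[OF A_right_inverse] unfolding S_def inv_mat_def by blast

end

section \<open>One round of LED\<close>

definition hetero :: "nat \<Rightarrow> (nat \<Rightarrow> 'a::euclidean_space \<Rightarrow> 'a) \<Rightarrow> 'a \<Rightarrow> nat \<Rightarrow> 'a" where
  "hetero N h z = dev N (\<lambda>i. h i z)"

definition mean_grad :: "nat \<Rightarrow> (nat \<Rightarrow> 'a::euclidean_space \<Rightarrow> 'a) \<Rightarrow> 'a \<Rightarrow> 'a" where
  "mean_grad N h z = avg N (\<lambda>i. h i z)"

text \<open>The dual iterate is recentred at its value \<open>- c *\<^sub>R hetero N h z\<close> at a consensual fixed point.\<close>

definition dual :: "nat \<Rightarrow> (nat \<Rightarrow> 'a::euclidean_space \<Rightarrow> 'a) \<Rightarrow> real \<Rightarrow> (nat \<Rightarrow> 'a) \<Rightarrow> (nat \<Rightarrow> 'a) \<Rightarrow> nat \<Rightarrow> 'a" where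
  "dual N h c x y = (\<lambda>i. y i + c *\<^sub>R hetero N h (avg N x) i)"

definition drift :: "nat \<Rightarrow> nat \<Rightarrow> (nat \<Rightarrow> 'a::euclidean_space) \<Rightarrow> (nat \<Rightarrow> nat \<Rightarrow> 'a) \<Rightarrow> real" where
  "drift N \<tau> x \<phi> = (\<Sum>t<\<tau>. \<Sum>i<N. (norm (\<phi> i t - avg N x))\<^sup>2)"

definition noise :: "(nat \<Rightarrow> 'a::euclidean_space \<Rightarrow> 'a) \<Rightarrow> (nat \<Rightarrow> nat \<Rightarrow> 'a) \<Rightarrow> (nat \<Rightarrow> nat \<Rightarrow> 'a) \<Rightarrow> nat \<Rightarrow> nat \<Rightarrow> 'a" where
  "noise h \<phi> g i t = g i t - h i (\<phi> i t)"

text \<open>One round along a single sample path, free of probability: \<open>g\<close> holds the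
  sampled gradients, \<open>h\<close> the exact ones, and primes mark the state after the round. The
  zero mean of \<open>y\<close> is an invariant, recovered for the new state in
  \<open>avg_y'\<close>.\<close>

locale led_round = network N nbr W lam
  for N nbr W lam +
  fixes \<tau> :: nat and \<alpha> L :: real and h :: "nat \<Rightarrow> 'a::euclidean_space \<Rightarrow> 'a"
    and x y x' y' :: "nat \<Rightarrow> 'a" and \<phi> g :: "nat \<Rightarrow> nat \<Rightarrow> 'a"
  assumes tau_pos: "1 \<le> \<tau>" and alpha_pos: "0 < \<alpha>" and L_pos: "0 < L"
    and lip: "i < N \<Longrightarrow> norm (h i a - h i b) \<le> L * norm (a - b)"
    and step_0: "i < N \<Longrightarrow> \<phi> i 0 = x i"
    and step_Suc: "i < N \<Longrightarrow> t < \<tau> \<Longrightarrow> \<phi> i (Suc t) = \<phi> i t - \<alpha> *\<^sub>R g i t - (1 / real \<tau>) *\<^sub>R y i"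
    and x'_eq: "i < N \<Longrightarrow> x' i = (\<Sum>j<N. W $$ (i, j) *\<^sub>R \<phi> j \<tau>)"
    and y'_eq: "i < N \<Longrightarrow> y' i = y i + \<phi> i \<tau> - x' i"
    and avg_y: "avg N y = 0"
    and step_small: "\<alpha> * real \<tau> * L \<le> 1 / 4"
begin

abbreviation "xb \<equiv> avg N x"
abbreviation "xb' \<equiv> avg N x'"
abbreviation "X \<equiv> dev N x"
abbreviation "Z \<equiv> dual N h (\<alpha> * real \<tau>) x y"
abbreviation "e \<equiv> noise h \<phi> g"
abbreviation "n \<equiv> \<lambda>i. \<Sum>t<\<tau>. e i t"
abbreviation "\<Delta> \<equiv> \<lambda>i. hetero N h xb' i - hetero N h xb i"

definition p :: "nat \<Rightarrow> 'a" where
  "p i = (\<Sum>t<\<tau>. h i (\<phi> i t) - h i xb)"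

text \<open>The choice \<beta> = 1 / \<tau> spreads the dual correction evenly over the local steps,
  so that a full round subtracts \<open>y i\<close> exactly once.\<close>

lemma phi_eq:
  assumes "i < N" "t \<le> \<tau>"
  shows "\<phi> i t = x i - \<alpha> *\<^sub>R (\<Sum>s<t. g i s) - (real t / real \<tau>) *\<^sub>R y i"
  using assms(2)
proof (induction t)
  case 0
  then show ?case using step_0[OF assms(1)] by simp
next
  case (Suc t)
  then show ?case using step_Suc[OF assms(1), of t]
    by (simp add: scaleR_right_distrib scaleR_left_distrib add_divide_distrib)
qed

lemma hetero_y: "y i = Z i - (\<alpha> * real \<tau>) *\<^sub>R (h i xb - mean_grad N h xb)"
  by (simp add: dual_def hetero_def mean_grad_def dev_def)

lemma g_sum_eq: "(\<Sum>t<\<tau>. g i t) = p i + n i + real \<tau> *\<^sub>R h i xb"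
  by (simp add: p_def noise_def sum_subtractf sum_constant_scaleR)

text \<open>Recentring the dual variable cancels the differences between the local gradients at the
  mean point and their average. The last bracket is common to all nodes and disappears on passing to
  deviations.\<close>

lemma phi_last:
  assumes "i < N"
  shows "\<phi> i \<tau> = X i - Z i - \<alpha> *\<^sub>R (p i + n i) + (xb - (\<alpha> * real \<tau>) *\<^sub>R mean_grad N h xb)"
proof -
  have "\<phi> i \<tau> = x i - \<alpha> *\<^sub>R (p i + n i + real \<tau> *\<^sub>R h i xb) - y i"
    using phi_eq[OF assms order_refl] tau_pos g_sum_eq by simp
  then show ?thesis unfolding hetero_y[of i] by (simp add: dev_def algebra_simps)
qed

lemma avg_Z: "avg N Z = 0"
  by (simp add: dual_def avg_lin hetero_def avg_dev[OF N_pos] avg_y)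

lemma dev_phi_last:
  assumes "i < N"
  shows "dev N (\<lambda>i. \<phi> i \<tau>) i = X i - Z i - \<alpha> *\<^sub>R (dev N p i + dev N n i)"
proof -
  let ?c = "xb - (\<alpha> * real \<tau>) *\<^sub>R mean_grad N h xb"
  have "avg N (\<lambda>i. \<phi> i \<tau>) = avg N (\<lambda>i. X i - Z i - \<alpha> *\<^sub>R (p i + n i) + ?c)"
    by (intro avg_cong) (rule phi_last)
  also have "\<dots> = - \<alpha> *\<^sub>R (avg N p + avg N n) + ?c"
    by (simp only: avg_lin avg_dev[OF N_pos] avg_Z avg_const[OF N_pos]) simp
  finally show ?thesis
    unfolding dev_def[of N "\<lambda>i. \<phi> i \<tau>"] phi_last[OF assms]
    by (simp add: dev_def[of N p] dev_def[of N n] algebra_simps)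
qed

lemma avg_W: "avg N (\<lambda>i. \<Sum>j<N. W $$ (i, j) *\<^sub>R u j) = avg N u" for u :: "nat \<Rightarrow> 'a"
proof -
  have "(\<Sum>i<N. \<Sum>j<N. W $$ (i, j) *\<^sub>R u j) = (\<Sum>j<N. (\<Sum>i<N. W $$ (i, j)) *\<^sub>R u j)"
    unfolding scaleR_sum_left by (rule sum.swap)
  also have "\<dots> = (\<Sum>j<N. u j)" by (intro sum.cong refl) (simp add: W_col_sum)
  finally show ?thesis by (simp add: avg_def)
qed

lemma avg_x': "xb' = avg N (\<lambda>i. \<phi> i \<tau>)"
  using avg_W[of "\<lambda>j. \<phi> j \<tau>"] avg_cong[of N x', OF x'_eq] by simp

lemma avg_y': "avg N y' = 0"
  using avg_cong[of N y', OF y'_eq] by (simp add: avg_lin avg_y avg_x')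

lemma xb'_eq: "xb' = xb - \<alpha> *\<^sub>R (\<Sum>t<\<tau>. avg N (\<lambda>i. g i t))"
proof -
  have "xb' = avg N (\<lambda>i. x i - \<alpha> *\<^sub>R (\<Sum>t<\<tau>. g i t) - y i)"
    unfolding avg_x' using phi_eq[OF _ order_refl] tau_pos by (intro avg_cong) simp
  then show ?thesis by (simp add: avg_lin avg_y avg_sum)
qed

lemma X'_eq:
  assumes "i < N"
  shows "dev N x' i = T (\<lambda>i. X i - Z i - \<alpha> *\<^sub>R (dev N p i + dev N n i)) i"
proof -
  have "dev N x' i = T (\<lambda>i. \<phi> i \<tau>) i"
    using x'_eq[OF assms] by (simp add: dev_def T_eq avg_x')
  also have "\<dots> = T (dev N (\<lambda>i. \<phi> i \<tau>)) i" by (simp add: T_dev assms)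
  also have "\<dots> = T (\<lambda>i. X i - Z i - \<alpha> *\<^sub>R (dev N p i + dev N n i)) i"
    by (intro T_cong dev_phi_last assms)
  finally show ?thesis .
qed

lemma Z'_eq:
  assumes i: "i < N"
  defines "u' \<equiv> \<lambda>i. T (S Z) i + X i - \<alpha> *\<^sub>R (dev N p i + dev N n i) + (\<alpha> * real \<tau>) *\<^sub>R S \<Delta> i"
  shows "dual N h (\<alpha> * real \<tau>) x' y' i = A u' i"
proof -
  let ?v = "\<lambda>i. X i - Z i - \<alpha> *\<^sub>R (dev N p i + dev N n i)"
  have T1: "T (A (S Z)) i = T Z i" by (intro T_cong A_S i)
  have "dual N h (\<alpha> * real \<tau>) x' y' i = Z i + (dev N (\<lambda>i. \<phi> i \<tau>) i - dev N x' i) + (\<alpha> * real \<tau>) *\<^sub>R \<Delta> i"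
    by (simp add: dual_def y'_eq[OF i] dev_def avg_x' algebra_simps)
  also have "\<dots> = Z i + (?v i - T ?v i) + (\<alpha> * real \<tau>) *\<^sub>R \<Delta> i"
    by (simp only: dev_phi_last[OF i] X'_eq[OF i])
  also have "\<dots> = T Z i + A X i - \<alpha> *\<^sub>R A (\<lambda>i. dev N p i + dev N n i) i + (\<alpha> * real \<tau>) *\<^sub>R \<Delta> i"
    unfolding A_def T_diff T_scale by (simp add: algebra_simps)
  also have "\<dots> = T Z i + A X i - \<alpha> *\<^sub>R A (\<lambda>i. dev N p i + dev N n i) i + (\<alpha> * real \<tau>) *\<^sub>R A (S \<Delta>) i"
    by (simp only: A_S[OF i])
  also have "\<dots> = A u' i"
    using T1 unfolding u'_def A_def T_diff T_scale T_add by (simp add: algebra_simps)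
  finally show ?thesis .
qed

text \<open>\<open>Z'_eq\<close> gives the recursion after application of \<open>A\<close>;
  injectivity of \<open>A\<close> removes it, so the chosen preimage \<open>S\<close> of the new
  dual variable must follow the recursion for U.\<close>

lemma S_Z'_eq:
  assumes i: "i < N"
  shows "S (dual N h (\<alpha> * real \<tau>) x' y') i =
    T (S Z) i + X i - \<alpha> *\<^sub>R (dev N p i + dev N n i) + (\<alpha> * real \<tau>) *\<^sub>R S \<Delta> i"
proof (rule A_inj[where u = "S (dual N h (\<alpha> * real \<tau>) x' y')" and i = i
      and v = "\<lambda>i. T (S Z) i + X i - \<alpha> *\<^sub>R (dev N p i + dev N n i) + (\<alpha> * real \<tau>) *\<^sub>R S \<Delta> i"])
  fix j assume j: "j < N"
  show "A (S (dual N h (\<alpha> * real \<tau>) x' y')) j =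
    A (\<lambda>i. T (S Z) i + X i - \<alpha> *\<^sub>R (dev N p i + dev N n i) + (\<alpha> * real \<tau>) *\<^sub>R S \<Delta> i) j"
    unfolding A_S[OF j] by (rule Z'_eq[OF j])
qed (rule i)

lemma p_le: "ip N p p \<le> real \<tau> * L\<^sup>2 * drift N \<tau> x \<phi>"
proof -
  have "(norm (p i))\<^sup>2 \<le> real \<tau> * (\<Sum>t<\<tau>. L\<^sup>2 * (norm (\<phi> i t - xb))\<^sup>2)" if "i < N" for i
  proof -
    have "(norm (p i))\<^sup>2 \<le> real (card {..<\<tau>}) * (\<Sum>t<\<tau>. (norm (h i (\<phi> i t) - h i xb))\<^sup>2)"
      unfolding p_def by (rule norm_sum_square_le)
    also have "\<dots> \<le> real (card {..<\<tau>}) * (\<Sum>t<\<tau>. (L * norm (\<phi> i t - xb))\<^sup>2)"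
      by (intro mult_left_mono sum_mono power_mono lip that) auto
    finally show ?thesis by (simp add: power_mult_distrib)
  qed
  then have "ip N p p \<le> (\<Sum>i<N. real \<tau> * (\<Sum>t<\<tau>. L\<^sup>2 * (norm (\<phi> i t - xb))\<^sup>2))"
    unfolding ip_self by (intro sum_mono) simp
  also have "\<dots> = real \<tau> * L\<^sup>2 * drift N \<tau> x \<phi>"
    by (simp add: drift_def sum_distrib_left mult.assoc sum.swap[of _ "{..<N}"])
  finally show ?thesis .
qed

lemma Delta_le: "ip N \<Delta> \<Delta> \<le> real N * L\<^sup>2 * (norm (xb' - xb))\<^sup>2"
proof -
  have "\<Delta> = dev N (\<lambda>i. h i xb' - h i xb)"
    by (simp add: hetero_def dev_lin)
  then have "ip N \<Delta> \<Delta> \<le> ip N (\<lambda>i. h i xb' - h i xb) (\<lambda>i. h i xb' - h i xb)"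
    using ip_dev_le[OF N_pos] by simp
  also have "\<dots> \<le> (\<Sum>i<N. (L * norm (xb' - xb))\<^sup>2)"
    unfolding ip_self by (intro sum_mono power_mono lip) auto
  finally show ?thesis by (simp add: power_mult_distrib)
qed

lemma ip_S_Delta: "ip N (A (S \<Delta>)) (A (S \<Delta>)) = ip N \<Delta> \<Delta>"
  by (intro ip_cong A_S)

lemma ip_TX_dev: "ip N (T X) (dev N n) = ip N X (T n)"
proof -
  have "ip N (T X) (dev N n) = ip N X (T (dev N n))" by (rule T_selfadj)
  also have "\<dots> = ip N X (T n)" by (intro ip_cong) (simp_all add: T_dev)
  finally show ?thesis .
qed

lemma energy_round:
  "energy (dev N x') (S (dual N h (\<alpha> * real \<tau>) x' y')) \<le>
    (1 + (1 - lam) / 2) * (lam * energy X (S Z) - 2 * \<alpha> * ip N X (T n) + \<alpha>\<^sup>2 * ip N n n) +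
    3 / (1 - lam) * (2 * \<alpha>\<^sup>2 * (real \<tau> * L\<^sup>2 * drift N \<tau> x \<phi>) +
      2 * (\<alpha> * real \<tau>)\<^sup>2 * (real N * L\<^sup>2 * (norm (xb' - xb))\<^sup>2) / (1 - lam))"
proof -
  let ?q = "\<lambda>i. dev N p i + dev N n i"
  have "energy (dev N x') (S (dual N h (\<alpha> * real \<tau>) x' y')) =
    energy (T (\<lambda>i. X i - A (S Z) i - \<alpha> *\<^sub>R ?q i)) (\<lambda>i. T (S Z) i + X i - \<alpha> *\<^sub>R ?q i + (\<alpha> * real \<tau>) *\<^sub>R S \<Delta> i)"
  proof (rule energy_cong)
    fix i assume i: "i < N"
    show "dev N x' i = T (\<lambda>i. X i - A (S Z) i - \<alpha> *\<^sub>R ?q i) i"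
      unfolding X'_eq[OF i] by (intro T_cong i) (simp add: A_S)
  qed (rule S_Z'_eq)
  also have "\<dots> \<le> (1 + (1 - lam) / 2) * (lam * energy X (S Z) - 2 * \<alpha> * ip N (T X) (dev N n) + \<alpha>\<^sup>2 * ip N (dev N n) (dev N n)) +
    3 / (1 - lam) * (2 * \<alpha>\<^sup>2 * ip N (dev N p) (dev N p) + 2 * (\<alpha> * real \<tau>)\<^sup>2 * ip N (A (S \<Delta>)) (A (S \<Delta>)) / (1 - lam))"
    by (rule energy_step)
  also have "\<dots> \<le> (1 + (1 - lam) / 2) * (lam * energy X (S Z) - 2 * \<alpha> * ip N X (T n) + \<alpha>\<^sup>2 * ip N n n) +
    3 / (1 - lam) * (2 * \<alpha>\<^sup>2 * (real \<tau> * L\<^sup>2 * drift N \<tau> x \<phi>) +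
      2 * (\<alpha> * real \<tau>)\<^sup>2 * (real N * L\<^sup>2 * (norm (xb' - xb))\<^sup>2) / (1 - lam))"
    unfolding ip_S_Delta ip_TX_dev using lam_less_1
    by (intro add_mono mult_left_mono divide_right_mono order_refl ip_dev_le[OF N_pos] diff_mono Delta_le
        order_trans[OF ip_dev_le[OF N_pos] p_le]) auto
  finally show ?thesis .
qed

lemma dual_round:
  "ip N (dual N h (\<alpha> * real \<tau>) x' y') (dual N h (\<alpha> * real \<tau>) x' y') \<le>
    8 * energy X (S Z) + 8 * \<alpha>\<^sup>2 * (real \<tau> * L\<^sup>2 * drift N \<tau> x \<phi>) + 8 * \<alpha>\<^sup>2 * ip N n n +
    4 * (\<alpha> * real \<tau>)\<^sup>2 * (real N * L\<^sup>2 * (norm (xb' - xb))\<^sup>2)"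
proof -
  let ?u' = "\<lambda>i. T (S Z) i + X i - \<alpha> *\<^sub>R (dev N p i + dev N n i) + (\<alpha> * real \<tau>) *\<^sub>R S \<Delta> i"
  have "ip N (dual N h (\<alpha> * real \<tau>) x' y') (dual N h (\<alpha> * real \<tau>) x' y') = ip N (A ?u') (A ?u')"
    by (intro ip_cong Z'_eq)
  also have "\<dots> \<le> 8 * energy X (S Z) + 8 * \<alpha>\<^sup>2 * ip N (dev N p) (dev N p) + 8 * \<alpha>\<^sup>2 * ip N (dev N n) (dev N n) +
    4 * (\<alpha> * real \<tau>)\<^sup>2 * ip N (A (S \<Delta>)) (A (S \<Delta>))"
    by (rule dual_step)
  also have "\<dots> \<le> 8 * energy X (S Z) + 8 * \<alpha>\<^sup>2 * (real \<tau> * L\<^sup>2 * drift N \<tau> x \<phi>) + 8 * \<alpha>\<^sup>2 * ip N n n +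
    4 * (\<alpha> * real \<tau>)\<^sup>2 * (real N * L\<^sup>2 * (norm (xb' - xb))\<^sup>2)"
    unfolding ip_S_Delta
    by (intro add_mono mult_left_mono order_refl ip_dev_le[OF N_pos] Delta_le
        order_trans[OF ip_dev_le[OF N_pos] p_le]) auto
  finally show ?thesis .
qed

text \<open>The cancellation of heterogeneity already holds inside the round: after t local steps
  the fraction t / \<tau> of the dual correction offsets exactly t local gradients. The client drift
  therefore sees only the mean gradient.\<close>

lemma phi_dev:
  assumes i: "i < N" and t: "t \<le> \<tau>"
  shows "\<phi> i t - xb = X i + (- (real t / real \<tau>)) *\<^sub>R Z i + (- \<alpha>) *\<^sub>R (\<Sum>s<t. h i (\<phi> i s) - h i xb)
    + (- (\<alpha> * real t)) *\<^sub>R mean_grad N h xb + (- \<alpha>) *\<^sub>R (\<Sum>s<t. e i s)"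
proof -
  have gs: "(\<Sum>s<t. g i s) = (\<Sum>s<t. e i s) + (\<Sum>s<t. h i (\<phi> i s) - h i xb) + real t *\<^sub>R h i xb"
    by (simp add: noise_def sum_subtractf sum_constant_scaleR)
  have yy: "(real t / real \<tau>) *\<^sub>R y i = (real t / real \<tau>) *\<^sub>R Z i - (\<alpha> * real t) *\<^sub>R (h i xb - mean_grad N h xb)"
    unfolding hetero_y[of i] scaleR_right_diff_distrib scaleR_scaleR using tau_pos by (simp add: mult.commute)
  show ?thesis
    unfolding phi_eq[OF i t] gs yy by (simp add: dev_def algebra_simps)
qed

lemma drift_le:
  "drift N \<tau> x \<phi> \<le> 10 * real \<tau> * (ip N X X + ip N Z Z + (\<alpha> * real \<tau>)\<^sup>2 * (real N * (norm (mean_grad N h xb))\<^sup>2))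
    + 10 * \<alpha>\<^sup>2 * (\<Sum>t<\<tau>. \<Sum>i<N. (norm (\<Sum>s<t. e i s))\<^sup>2)"
proof -
  let ?\<Xi> = "drift N \<tau> x \<phi>"
  define Q where "Q i = (\<Sum>s<\<tau>. (norm (\<phi> i s - xb))\<^sup>2)" for i
  have Q: "(\<Sum>i<N. Q i) = ?\<Xi>" by (simp add: Q_def drift_def sum.swap[of _ "{..<N}"])
  have *: "(norm (\<phi> i t - xb))\<^sup>2 \<le> 5 * ((norm (X i))\<^sup>2 + (norm (Z i))\<^sup>2 + \<alpha>\<^sup>2 * (real \<tau> * L\<^sup>2 * Q i)
     + (\<alpha> * real \<tau>)\<^sup>2 * (norm (mean_grad N h xb))\<^sup>2 + \<alpha>\<^sup>2 * (norm (\<Sum>s<t. e i s))\<^sup>2)"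
    if i: "i < N" and t: "t < \<tau>" for i t
  proof -
    have 1: "(norm ((- (real t / real \<tau>)) *\<^sub>R Z i))\<^sup>2 \<le> (norm (Z i))\<^sup>2"
    proof -
      have "(real t / real \<tau>)\<^sup>2 \<le> 1" using t by (simp add: power_le_one)
      then show ?thesis
        using mult_right_mono[of "(real t / real \<tau>)\<^sup>2" 1 "(norm (Z i))\<^sup>2"]
        by (simp add: power_mult_distrib power_divide)
    qed
    have 2: "(norm ((- \<alpha>) *\<^sub>R (\<Sum>s<t. h i (\<phi> i s) - h i xb)))\<^sup>2 \<le> \<alpha>\<^sup>2 * (real \<tau> * L\<^sup>2 * Q i)"
    proof -
      have "(norm (\<Sum>s<t. h i (\<phi> i s) - h i xb))\<^sup>2 \<le> real (card {..<t}) * (\<Sum>s<t. (norm (h i (\<phi> i s) - h i xb))\<^sup>2)"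
        by (rule norm_sum_square_le)
      also have "\<dots> \<le> real \<tau> * (\<Sum>s<\<tau>. (norm (h i (\<phi> i s) - h i xb))\<^sup>2)"
        using t by (intro mult_mono sum_mono2) (auto intro: sum_nonneg)
      also have "\<dots> \<le> real \<tau> * (\<Sum>s<\<tau>. (L * norm (\<phi> i s - xb))\<^sup>2)"
        by (intro mult_left_mono sum_mono power_mono lip i) auto
      also have "\<dots> = real \<tau> * L\<^sup>2 * Q i" by (simp add: Q_def power_mult_distrib sum_distrib_left mult.assoc)
      finally show ?thesis by (simp add: power_mult_distrib mult_left_mono)
    qed
    have 3: "(norm ((- (\<alpha> * real t)) *\<^sub>R mean_grad N h xb))\<^sup>2 \<le> (\<alpha> * real \<tau>)\<^sup>2 * (norm (mean_grad N h xb))\<^sup>2"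
    proof -
      have "(\<alpha> * real t)\<^sup>2 \<le> (\<alpha> * real \<tau>)\<^sup>2" using t alpha_pos by (intro power_mono mult_left_mono) auto
      then show ?thesis by (simp add: power_mult_distrib mult_right_mono)
    qed
    have "(norm (\<phi> i t - xb))\<^sup>2 \<le> 5 * ((norm (X i))\<^sup>2 + (norm ((- (real t / real \<tau>)) *\<^sub>R Z i))\<^sup>2
       + (norm ((- \<alpha>) *\<^sub>R (\<Sum>s<t. h i (\<phi> i s) - h i xb)))\<^sup>2
       + (norm ((- (\<alpha> * real t)) *\<^sub>R mean_grad N h xb))\<^sup>2 + (norm ((- \<alpha>) *\<^sub>R (\<Sum>s<t. e i s)))\<^sup>2)"
      unfolding phi_dev[OF i less_imp_le[OF t]] by (rule norm_add5_square_le)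
    also have "(norm ((- \<alpha>) *\<^sub>R (\<Sum>s<t. e i s)))\<^sup>2 = \<alpha>\<^sup>2 * (norm (\<Sum>s<t. e i s))\<^sup>2"
      by (simp add: power_mult_distrib)
    finally show ?thesis using 1 2 3 by argo
  qed
  have "?\<Xi> \<le> (\<Sum>t<\<tau>. \<Sum>i<N. 5 * ((norm (X i))\<^sup>2 + (norm (Z i))\<^sup>2 + \<alpha>\<^sup>2 * (real \<tau> * L\<^sup>2 * Q i)
     + (\<alpha> * real \<tau>)\<^sup>2 * (norm (mean_grad N h xb))\<^sup>2 + \<alpha>\<^sup>2 * (norm (\<Sum>s<t. e i s))\<^sup>2))"
    unfolding drift_def by (intro sum_mono *) auto
  also have "\<dots> = 5 * real \<tau> * (ip N X X + ip N Z Z + (\<alpha> * real \<tau>)\<^sup>2 * (real N * (norm (mean_grad N h xb))\<^sup>2))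
    + 5 * (\<alpha> * real \<tau> * L)\<^sup>2 * ?\<Xi> + 5 * \<alpha>\<^sup>2 * (\<Sum>t<\<tau>. \<Sum>i<N. (norm (\<Sum>s<t. e i s))\<^sup>2)"
    unfolding Q[symmetric] ip_self
    by (simp add: sum.distrib sum_distrib_left[symmetric] sum_distrib_right[symmetric]
        power2_eq_square algebra_simps)
  \<comment> \<open>The gradient differences reproduce the drift itself, with factor at most 5/16
    because \<alpha> \<tau> L <= 1/4. Absorbing half of the drift on the left doubles the remaining
    constants from 5 to 10.\<close>
  also have "5 * (\<alpha> * real \<tau> * L)\<^sup>2 * ?\<Xi> \<le> 1 / 2 * ?\<Xi>"
  proof (rule mult_right_mono)
    have "(\<alpha> * real \<tau> * L)\<^sup>2 \<le> (1 / 4)\<^sup>2"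
      using step_small alpha_pos L_pos by (intro power_mono) auto
    then show "5 * (\<alpha> * real \<tau> * L)\<^sup>2 \<le> 1 / 2" by (simp add: power2_eq_square)
  qed (simp add: drift_def sum_nonneg)
  finally show ?thesis by (simp add: algebra_simps)
qed

abbreviation "gb \<equiv> \<lambda>t. avg N (\<lambda>i. h i (\<phi> i t))"

lemma avg_g: "avg N (\<lambda>i. g i t) = gb t + avg N (\<lambda>i. e i t)"
  by (simp add: noise_def avg_lin)

lemma xb_move: "xb' - xb = (- \<alpha>) *\<^sub>R ((\<Sum>t<\<tau>. gb t) + avg N n)"
  by (simp add: xb'_eq avg_g sum.distrib avg_sum)

lemma move_le: "(norm (xb' - xb))\<^sup>2 \<le> 2 * \<alpha>\<^sup>2 * (real \<tau> * (\<Sum>t<\<tau>. (norm (gb t))\<^sup>2) + (norm (avg N n))\<^sup>2)"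
proof -
  have "(norm (xb' - xb))\<^sup>2 = \<alpha>\<^sup>2 * (norm ((\<Sum>t<\<tau>. gb t) + avg N n))\<^sup>2"
    unfolding xb_move by (simp add: power_mult_distrib)
  also have "\<dots> \<le> \<alpha>\<^sup>2 * (2 * ((norm (\<Sum>t<\<tau>. gb t))\<^sup>2 + (norm (avg N n))\<^sup>2))"
    by (intro mult_left_mono norm_add_square_le) simp
  also have "\<dots> \<le> \<alpha>\<^sup>2 * (2 * (real \<tau> * (\<Sum>t<\<tau>. (norm (gb t))\<^sup>2) + (norm (avg N n))\<^sup>2))"
    using norm_sum_square_le[of gb "{..<\<tau>}"] by (intro mult_left_mono add_mono) auto
  finally show ?thesis by (simp add: algebra_simps)
qed

text \<open>Polarisation of the products <G, gb t> leaves both |G|^2 and |gb t|^2 with a negative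
  sign, which are the two ingredients of the round error; the mismatch |gb t - G|^2 is charged to
  the drift.\<close>

lemma descent_round:
  assumes grad: "\<And>z. GDERIV F z :> mean_grad N h z"
  shows "F xb' \<le> F xb - \<alpha> * real \<tau> / 2 * (norm (mean_grad N h xb))\<^sup>2 - \<alpha> / 4 * (\<Sum>t<\<tau>. (norm (gb t))\<^sup>2)
    + \<alpha> * L\<^sup>2 / (2 * real N) * drift N \<tau> x \<phi> + L * \<alpha>\<^sup>2 * (norm (avg N n))\<^sup>2
    - \<alpha> * (mean_grad N h xb \<bullet> avg N n)"
proof -
  let ?G = "mean_grad N h xb"
  let ?P = "\<Sum>t<\<tau>. (norm (gb t))\<^sup>2"
  have avg_lip: "(norm (avg N (\<lambda>i. h i (a i) - h i (b i))))\<^sup>2 \<le> L\<^sup>2 / real N * (\<Sum>i<N. (norm (a i - b i))\<^sup>2)" for a b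
  proof -
    have "(norm (avg N (\<lambda>i. h i (a i) - h i (b i))))\<^sup>2 \<le> 1 / real N * (\<Sum>i<N. (norm (h i (a i) - h i (b i)))\<^sup>2)"
      using norm_avg_square_le[OF N_pos, of "\<lambda>i. h i (a i) - h i (b i)"] by (simp add: ip_self)
    also have "\<dots> \<le> 1 / real N * (\<Sum>i<N. (L * norm (a i - b i))\<^sup>2)"
      by (intro mult_left_mono sum_mono power_mono lip) auto
    finally show ?thesis by (simp add: power_mult_distrib sum_distrib_left)
  qed
  have G_lip: "norm (mean_grad N h a - mean_grad N h b) \<le> L * norm (a - b)" for a b
  proof -
    have "(norm (mean_grad N h a - mean_grad N h b))\<^sup>2 \<le> (L * norm (a - b))\<^sup>2"
      using avg_lip[of "\<lambda>_. a" "\<lambda>_. b"] N_pos by (simp add: mean_grad_def avg_lin power_mult_distrib)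
    then show ?thesis by (rule power2_le_imp_le) (use L_pos in auto)
  qed
  have "F xb' \<le> F xb + ?G \<bullet> (xb' - xb) + L / 2 * (norm (xb' - xb))\<^sup>2"
    using descent_lemma[OF grad G_lip, of xb "xb' - xb"] by simp
  also have "L / 2 * (norm (xb' - xb))\<^sup>2 \<le> L / 2 * (2 * \<alpha>\<^sup>2 * (real \<tau> * ?P + (norm (avg N n))\<^sup>2))"
    using L_pos by (intro mult_left_mono move_le) auto
  also have "L / 2 * (2 * \<alpha>\<^sup>2 * (real \<tau> * ?P + (norm (avg N n))\<^sup>2))
      = \<alpha> * (\<alpha> * real \<tau> * L) * ?P + L * \<alpha>\<^sup>2 * (norm (avg N n))\<^sup>2"
    by (simp add: power2_eq_square algebra_simps)
  \<comment> \<open>The second-order term uses up half of the coefficient \<alpha> / 2 that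
    polarisation provides for \<open>?P\<close>, leaving \<alpha> / 4.\<close>
  also have "\<alpha> * (\<alpha> * real \<tau> * L) * ?P \<le> \<alpha> * (1 / 4) * ?P"
    using alpha_pos step_small by (intro mult_right_mono mult_left_mono) (auto simp: sum_nonneg)
  also have "?G \<bullet> (xb' - xb) = - \<alpha> * (\<Sum>t<\<tau>. ?G \<bullet> gb t) - \<alpha> * (?G \<bullet> avg N n)"
    unfolding xb_move by (simp add: inner_add_right inner_sum_right algebra_simps)
  also have "- \<alpha> * (\<Sum>t<\<tau>. ?G \<bullet> gb t) \<le> - (\<alpha> * real \<tau> / 2 * (norm ?G)\<^sup>2) - \<alpha> / 2 * ?P + \<alpha> * L\<^sup>2 / (2 * real N) * drift N \<tau> x \<phi>"
  proof -
    have "?G \<bullet> gb t = ((norm ?G)\<^sup>2 + (norm (gb t))\<^sup>2 - (norm (gb t - ?G))\<^sup>2) / 2" for t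
      by (simp add: power2_norm_eq_inner inner_diff_left inner_diff_right inner_commute)
    then have "(\<Sum>t<\<tau>. ?G \<bullet> gb t) = (\<Sum>t<\<tau>. ((norm ?G)\<^sup>2 + (norm (gb t))\<^sup>2 - (norm (gb t - ?G))\<^sup>2) / 2)"
      by (simp only:)
    also have "\<dots> = (real \<tau> * (norm ?G)\<^sup>2 + ?P - (\<Sum>t<\<tau>. (norm (gb t - ?G))\<^sup>2)) / 2"
      by (simp add: sum.distrib sum_subtractf sum_divide_distrib[symmetric])
    finally have "(\<Sum>t<\<tau>. ?G \<bullet> gb t) = (real \<tau> * (norm ?G)\<^sup>2 + ?P - (\<Sum>t<\<tau>. (norm (gb t - ?G))\<^sup>2)) / 2" .
    moreover have "(\<Sum>t<\<tau>. (norm (gb t - ?G))\<^sup>2) \<le> L\<^sup>2 / real N * drift N \<tau> x \<phi>"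
    proof -
      have "(norm (gb t - ?G))\<^sup>2 \<le> L\<^sup>2 / real N * (\<Sum>i<N. (norm (\<phi> i t - xb))\<^sup>2)" for t
        using avg_lip[of "\<lambda>i. \<phi> i t" "\<lambda>_. xb"] by (simp add: mean_grad_def avg_lin)
      then show ?thesis unfolding drift_def sum_distrib_left by (intro sum_mono)
    qed
    ultimately have "(real \<tau> * (norm ?G)\<^sup>2 + ?P - L\<^sup>2 / real N * drift N \<tau> x \<phi>) / 2 \<le> (\<Sum>t<\<tau>. ?G \<bullet> gb t)"
      by simp
    from mult_left_mono[OF this, of \<alpha>] show ?thesis using alpha_pos by (simp add: field_simps)
  qed
  finally show ?thesis by (simp add: algebra_simps)
qed

end

section \<open>The scalar recursions\<close>

text \<open>Telescoping. The case k = 0 later serves the descent inequality, which has no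
  contraction.\<close>

lemma summed_recursion:
  fixes v b :: "nat \<Rightarrow> real"
  assumes "\<And>r. v (Suc r) \<le> (1 - k) * v r + b r" and "\<And>r. 0 \<le> v r"
  shows "k * (\<Sum>r<R. v r) \<le> v 0 + (\<Sum>r<R. b r)"
proof -
  have "v R + k * (\<Sum>r<R. v r) \<le> v 0 + (\<Sum>r<R. b r)"
  proof (induction R)
    case (Suc R)
    then show ?case using assms(1)[of R] by (simp add: algebra_simps)
  qed simp
  then show ?thesis using assms(2)[of R] by linarith
qed

text \<open>The bound on \<open>z\<close> arrives one index late, so the first term is paid
  separately. Nonnegativity of \<open>b\<close> lets its sum run one term further than the shift
  produces.\<close>

lemma sum_lessThan_shift_le:
  fixes z b :: "nat \<Rightarrow> real"
  assumes "\<And>r. z (Suc r) \<le> b r" and "\<And>r. 0 \<le> b r" and "0 \<le> z 0"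
  shows "(\<Sum>r<R. z r) \<le> z 0 + (\<Sum>r<R. b r)"
proof -
  have shift: "(\<Sum>r<Suc m. z r) \<le> z 0 + (\<Sum>r<m. b r)" for m
    using assms(1) by (simp add: sum.lessThan_Suc_shift sum_mono del: sum.lessThan_Suc)
  show ?thesis
  proof (cases R)
    case (Suc m)
    then show ?thesis using shift[of m] assms(2)[of m] by simp
  qed (use assms(3) in simp)
qed

text \<open>In the application c = \<alpha> \<tau> and e = 1 - lam; v is the energy, z the squared
  dual variable, x the drift, d the squared movement of the mean times L^2, G and P the two gradient
  terms, F the optimality gap; s and sN are the noise levels without and with the factor
  1/N.\<close>

lemma summed_bound:
  fixes v z x G P d F :: "nat \<Rightarrow> real" and c e L s sN :: real
  assumes c: "0 < c" and e: "0 < e" "e \<le> 1" and L: "0 < L" and small: "c * L \<le> e\<^sup>2 / 200"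
    and s: "0 \<le> s" "0 \<le> sN"
    and nonneg: "\<And>r. 0 \<le> v r" "\<And>r. 0 \<le> z r" "\<And>r. 0 \<le> x r" "\<And>r. 0 \<le> G r" "\<And>r. 0 \<le> P r"
      "\<And>r. 0 \<le> d r" "\<And>r. 0 \<le> F r"
    and v_step: "\<And>r. v (Suc r) \<le> (1 - e / 2) * v r + (3 / e * (2 * c\<^sup>2 * L\<^sup>2 * x r + 2 * c\<^sup>2 * d r / e) + 3 / 2 * s)"
    and z_step: "\<And>r. z (Suc r) \<le> 8 * v r + 8 * c\<^sup>2 * L\<^sup>2 * x r + 8 * s + 4 * c\<^sup>2 * d r"
    and x_le: "\<And>r. x r \<le> 10 * (v r + z r + c\<^sup>2 * G r + s)"
    and d_le: "\<And>r. d r \<le> L\<^sup>2 * (2 * c\<^sup>2 * P r + 2 * s)"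
    and F_step: "\<And>r. F (Suc r) \<le> F r - c / 2 * G r - c / 4 * P r + c * L\<^sup>2 / 2 * x r + L * sN"
    and v_0: "v 0 \<le> z 0 / e"
  shows "(\<Sum>r<R. G r + P r) \<le> 1520 * (F 0 / c + L\<^sup>2 * z 0 / e\<^sup>2) + 8 * (real R * (L * sN) / c)
      + 3000 * (real R * L\<^sup>2 * s / e)"
proof -
  define SV SZ SX SG SP SD where "SV = L\<^sup>2 * (\<Sum>r<R. v r)" and "SZ = L\<^sup>2 * (\<Sum>r<R. z r)"
    and "SX = L\<^sup>2 * (\<Sum>r<R. x r)" and "SG = (\<Sum>r<R. G r)" and "SP = (\<Sum>r<R. P r)" and "SD = (\<Sum>r<R. d r)"
  define k where "k = (c * L)\<^sup>2"
  define ze we where "ze = L\<^sup>2 * z 0 / e\<^sup>2" and "we = real R * L\<^sup>2 * s / e"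
  have S_nonneg: "0 \<le> SV" "0 \<le> SZ" "0 \<le> SX" "0 \<le> SG" "0 \<le> SP" "0 \<le> SD"
    using nonneg by (simp_all add: SV_def SZ_def SX_def SG_def SP_def SD_def sum_nonneg)
  have e_pows: "e\<^sup>2 \<le> 1" "e ^ 4 \<le> e\<^sup>2" "e ^ 4 \<le> e ^ 3"
    using e by (auto simp: power_le_one intro!: power_decreasing)
  have k0: "0 \<le> k" by (simp add: k_def)
  \<comment> \<open>Smallness of the stepsize enters here: k, k / e^2 and k / e^3 all become at most
    1/40000, which makes the mutual feedback of the sums negligible.\<close>
  have k: "k \<le> e ^ 4 / 40000"
  proof -
    have "k \<le> (e\<^sup>2 / 200)\<^sup>2" unfolding k_def using small c L by (intro power_mono) auto
    then show ?thesis by (simp add: power_divide)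
  qed
  have k1: "k \<le> 1 / 40000" "k / e\<^sup>2 \<le> 1 / 40000" "k / e ^ 3 \<le> 1 / 40000"
    using k e e_pows by (simp_all add: pos_divide_le_eq)
  have w: "real R * L\<^sup>2 * s \<le> we" "0 \<le> we"
    using e s by (simp_all add: we_def pos_le_divide_eq mult_left_le)
  have z0: "L\<^sup>2 * z 0 \<le> ze"
    using e e_pows nonneg(2)[of 0] by (simp add: ze_def pos_le_divide_eq mult_left_le)
  have SDk: "SD \<le> 2 * k * SP + 2 * (real R * L\<^sup>2 * s)"
  proof -
    have "SD \<le> (\<Sum>r<R. L\<^sup>2 * (2 * c\<^sup>2 * P r + 2 * s))" unfolding SD_def by (intro sum_mono d_le)
    then show ?thesis
      by (simp add: SP_def k_def sum.distrib sum_distrib_left[symmetric] sum_distrib_right[symmetric]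
          sum_divide_distrib[symmetric]
          power_mult_distrib power2_eq_square power4_eq_xxxx algebra_simps)
  qed
  have SX1: "SX \<le> 10 * (SV + SZ + k * SG + real R * L\<^sup>2 * s)"
  proof -
    have "SX \<le> L\<^sup>2 * (\<Sum>r<R. 10 * (v r + z r + c\<^sup>2 * G r + s))"
      unfolding SX_def by (intro mult_left_mono sum_mono x_le) simp
    then show ?thesis
      by (simp add: SV_def SZ_def SG_def k_def sum.distrib sum_distrib_left[symmetric] sum_distrib_right[symmetric]
          sum_divide_distrib[symmetric]
          power_mult_distrib power2_eq_square power4_eq_xxxx algebra_simps)
  qed
  have SZ1: "SZ \<le> L\<^sup>2 * z 0 + (8 * SV + 8 * k * SX + 8 * (real R * L\<^sup>2 * s) + 4 * k * SD)"
  proof -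
    have "(\<Sum>r<R. z r) \<le> z 0 + (\<Sum>r<R. 8 * v r + 8 * c\<^sup>2 * L\<^sup>2 * x r + 8 * s + 4 * c\<^sup>2 * d r)"
      using sum_lessThan_shift_le[of z, OF z_step _ nonneg(2)] nonneg s by simp
    from mult_left_mono[OF this, of "L\<^sup>2"] show ?thesis
      by (simp add: SZ_def SV_def SX_def SD_def k_def sum.distrib sum_distrib_left[symmetric] sum_distrib_right[symmetric]
          sum_divide_distrib[symmetric]
          power_mult_distrib power2_eq_square power4_eq_xxxx algebra_simps)
  qed
  \<comment> \<open>The contraction rate is e / 2, so summation costs a factor 2 / e. Together with
    v 0 <= z 0 / e this puts e^2 below the heterogeneity and e below the noise.\<close>
  have SV1: "SV \<le> 2 * ze + 12 * (k / e\<^sup>2) * SX + 12 * (k / e ^ 3) * SD + 3 * we"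
  proof -
    have "e / 2 * (\<Sum>r<R. v r) \<le> v 0 + (\<Sum>r<R. 3 / e * (2 * c\<^sup>2 * L\<^sup>2 * x r + 2 * c\<^sup>2 * d r / e) + 3 / 2 * s)"
      by (rule summed_recursion[of v, OF v_step nonneg(1)])
    also have "v 0 \<le> z 0 / e" by (rule v_0)
    finally have "(2 * L\<^sup>2 / e) * (e / 2 * (\<Sum>r<R. v r)) \<le> (2 * L\<^sup>2 / e) * (z 0 / e +
       (\<Sum>r<R. 3 / e * (2 * c\<^sup>2 * L\<^sup>2 * x r + 2 * c\<^sup>2 * d r / e) + 3 / 2 * s))"
      using e by (intro mult_left_mono) auto
    moreover have "(2 * L\<^sup>2 / e) * (e / 2 * (\<Sum>r<R. v r)) = SV" using e by (simp add: SV_def)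
    moreover have "(\<Sum>r<R. 3 / e * (2 * c\<^sup>2 * L\<^sup>2 * x r + 2 * c\<^sup>2 * d r / e) + 3 / 2 * s) =
        3 / e * (2 * c\<^sup>2 * SX + 2 * c\<^sup>2 * SD / e) + 3 / 2 * real R * s"
      by (simp add: SX_def SD_def sum.distrib sum_distrib_left[symmetric] sum_distrib_right[symmetric]
          sum_divide_distrib[symmetric] algebra_simps)
    moreover have "(2 * L\<^sup>2 / e) * (z 0 / e + (3 / e * (2 * c\<^sup>2 * SX + 2 * c\<^sup>2 * SD / e) + 3 / 2 * real R * s)) =
        2 * ze + 12 * (k / e\<^sup>2) * SX + 12 * (k / e ^ 3) * SD + 3 * we"
      using e by (simp add: ze_def we_def k_def field_simps power2_eq_square power3_eq_cube)
    ultimately show ?thesis by simp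
  qed
  have F1: "SG + SP \<le> 4 * (F 0 / c) + 2 * SX + 4 * (real R * (L * sN) / c)"
  proof -
    have "0 * (\<Sum>r<R. F r) \<le> F 0 + (\<Sum>r<R. - c / 2 * G r - c / 4 * P r + c * L\<^sup>2 / 2 * x r + L * sN)"
      by (rule summed_recursion) (use F_step nonneg in \<open>auto simp: algebra_simps\<close>)
    then have *: "0 \<le> F 0 - c / 2 * SG - c / 4 * SP + c / 2 * SX + real R * (L * sN)"
      by (simp add: SG_def SP_def SX_def sum.distrib sum_subtractf sum_negf
          sum_distrib_left[symmetric] sum_distrib_right[symmetric]
          sum_divide_distrib[symmetric] algebra_simps)
    moreover have "c / 4 * SG \<le> c / 2 * SG" using c S_nonneg by (intro mult_right_mono) auto
    ultimately have "c / 4 * (SG + SP) \<le> F 0 + c / 2 * SX + real R * (L * sN)" by (simp add: algebra_simps)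
    then show ?thesis using c by (simp add: field_simps)
  qed
  have k_le: "k * SP \<le> 1 / 40000 * SP" "k * SG \<le> 1 / 40000 * SG" "k * SX \<le> 1 / 40000 * SX" "k * SD \<le> 1 / 40000 * SD"
    "k / e\<^sup>2 * SX \<le> 1 / 40000 * SX" "k / e ^ 3 * SD \<le> 1 / 40000 * SD"
    using k1 S_nonneg by (intro mult_right_mono; simp)+
  have "0 \<le> real R * (L * sN) / c" using L s c by simp
  moreover have "F 0 / c \<ge> 0" using nonneg(7) c by simp
  moreover have "0 \<le> ze" using nonneg(2)[of 0] by (simp add: ze_def)
  \<comment> \<open>Apart from terms carrying the factor 1/40000, SX <= 10 (9 SV + ze + 9 we) and SV
    <= 2 ze + 3 we, hence SX <= 190 ze + 360 we, which \<open>F1\<close> doubles. The constants 1520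
    = 4 * 380 and 3000 > 4 * 720 leave ample room for the absorption.\<close>
  ultimately have "SG + SP \<le> 1520 * (F 0 / c + ze) + 8 * (real R * (L * sN) / c) + 3000 * we"
    using k_le SV1 SZ1 SX1 SDk F1 w z0 S_nonneg by argo
  then show ?thesis by (simp add: SG_def SP_def ze_def we_def sum.distrib)
qed

section \<open>Orthogonality of the gradient noise\<close>

lemma GDERIV_unique:
  assumes "GDERIV f z :> D" "GDERIV f z :> E"
  shows "D = E"
proof -
  have "(\<lambda>k. k \<bullet> D) = (\<lambda>k. k \<bullet> E)"
    using has_derivative_unique[of f "\<lambda>k. k \<bullet> D" z "\<lambda>k. k \<bullet> E"] assms by (simp add: gderiv_def)
  then have "(D - E) \<bullet> (D - E) = 0" by (metis inner_diff_right right_minus_eq)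
  then show ?thesis by simp
qed

lemma grad_eqI: "GDERIV f z :> D \<Longrightarrow> grad f z = D"
  unfolding grad_def by (rule the_equality) (auto intro: GDERIV_unique)

lemma differentiable_imp_GDERIV_grad:
  fixes f :: "'a::euclidean_space \<Rightarrow> real"
  assumes "f differentiable (at z)"
  shows "GDERIV f z :> grad f z"
proof -
  obtain f' where f': "(f has_derivative f') (at z)" using assms by (auto simp: differentiable_def)
  define D where "D = (\<Sum>b\<in>Basis. f' b *\<^sub>R b)"
  have lin: "linear f'" using f' by (rule has_derivative_linear)
  have "f' = (\<lambda>k. k \<bullet> D)"
  proof
    fix k
    have "f' k = f' (\<Sum>b\<in>Basis. (k \<bullet> b) *\<^sub>R b)" by (simp add: euclidean_representation)
    also have "\<dots> = (\<Sum>b\<in>Basis. (k \<bullet> b) * f' b)" by (simp add: linear_sum[OF lin] linear_scale[OF lin])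
    also have "\<dots> = k \<bullet> D" by (simp add: D_def inner_sum_right mult.commute)
    finally show "f' k = k \<bullet> D" .
  qed
  then have "GDERIV f z :> D" using f' by (simp add: gderiv_def)
  then show ?thesis using grad_eqI by metis
qed

lemma GDERIV_mean_cost:
  assumes "\<And>i. i < N \<Longrightarrow> GDERIV (f i) z :> h i z"
  shows "GDERIV (mean_cost N f) z :> mean_grad N h z"
proof -
  have "((\<lambda>z. (1 / real N) * (\<Sum>i<N. f i z)) has_derivative (\<lambda>k. (1 / real N) * (\<Sum>i<N. k \<bullet> h i z))) (at z)"
    using assms by (intro derivative_intros has_derivative_sum) (auto simp: gderiv_def)
  then show ?thesis unfolding gderiv_def mean_cost_def mean_grad_def avg_def
    by (simp add: inner_sum_right sum_distrib_left)
qed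

section \<open>Square integrable random vectors\<close>

definition sq_integrable :: "'w measure \<Rightarrow> ('w \<Rightarrow> 'a::euclidean_space) \<Rightarrow> bool" where
  "sq_integrable M X \<longleftrightarrow> X \<in> borel_measurable M \<and> integrable M (\<lambda>\<omega>. (norm (X \<omega>))\<^sup>2)"

lemma sq_integrable_measurable: "sq_integrable M X \<Longrightarrow> X \<in> borel_measurable M"
  by (simp add: sq_integrable_def)

lemma sq_integrable_norm2: "sq_integrable M X \<Longrightarrow> integrable M (\<lambda>\<omega>. (norm (X \<omega>))\<^sup>2)"
  by (simp add: sq_integrable_def)

lemma sq_integrable_bound:
  assumes "X \<in> borel_measurable M" "integrable M f" "\<And>\<omega>. \<omega> \<in> space M \<Longrightarrow> (norm (X \<omega>))\<^sup>2 \<le> f \<omega>"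
  shows "sq_integrable M X"
  unfolding sq_integrable_def
proof
  have [measurable]: "X \<in> borel_measurable M" by fact
  show "integrable M (\<lambda>\<omega>. (norm (X \<omega>))\<^sup>2)"
    by (rule Bochner_Integration.integrable_bound[OF assms(2)])
      (use assms(3) in \<open>auto intro!: AE_I2 order_trans[OF _ abs_ge_self]\<close>)
qed (fact assms(1))

lemma sq_integrable_scale:
  assumes "sq_integrable M X"
  shows "sq_integrable M (\<lambda>\<omega>. a *\<^sub>R X \<omega>)"
  using assms by (auto simp: sq_integrable_def power_mult_distrib)

lemma sq_integrable_add:
  assumes "sq_integrable M X" "sq_integrable M Y"
  shows "sq_integrable M (\<lambda>\<omega>. X \<omega> + Y \<omega>)"
proof (rule sq_integrable_bound)
  show "integrable M (\<lambda>\<omega>. 2 * ((norm (X \<omega>))\<^sup>2 + (norm (Y \<omega>))\<^sup>2))"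
    using assms by (simp add: sq_integrable_norm2)
qed (use assms in \<open>auto simp: sq_integrable_def intro: norm_add_square_le[simplified]\<close>)

lemma sq_integrable_diff:
  assumes "sq_integrable M X" "sq_integrable M Y"
  shows "sq_integrable M (\<lambda>\<omega>. X \<omega> - Y \<omega>)"
  using sq_integrable_add[OF assms(1) sq_integrable_scale[OF assms(2), of "-1"]] by simp

lemma sq_integrable_zero: "sq_integrable M (\<lambda>\<omega>. 0)"
  by (simp add: sq_integrable_def)

lemma sq_integrable_sum:
  assumes "\<And>i. i \<in> I \<Longrightarrow> sq_integrable M (X i)"
  shows "sq_integrable M (\<lambda>\<omega>. \<Sum>i\<in>I. X i \<omega>)"
  using assms
  by (induction I rule: infinite_finite_induct) (auto intro: sq_integrable_add sq_integrable_zero)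

lemma sq_integrable_avg:
  assumes "\<And>i. i < N \<Longrightarrow> sq_integrable M (X i)"
  shows "sq_integrable M (\<lambda>\<omega>. avg N (\<lambda>i. X i \<omega>))"
  unfolding avg_def by (intro sq_integrable_scale sq_integrable_sum assms) simp

lemma sq_integrable_cong:
  assumes "\<And>\<omega>. \<omega> \<in> space M \<Longrightarrow> X \<omega> = Y \<omega>"
  shows "sq_integrable M X \<longleftrightarrow> sq_integrable M Y"
proof -
  have "X \<in> borel_measurable M \<longleftrightarrow> Y \<in> borel_measurable M"
    using assms by (rule measurable_cong)
  moreover have "integrable M (\<lambda>\<omega>. (norm (X \<omega>))\<^sup>2) \<longleftrightarrow> integrable M (\<lambda>\<omega>. (norm (Y \<omega>))\<^sup>2)"
    using assms by (intro Bochner_Integration.integrable_cong) auto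
  ultimately show ?thesis by (simp add: sq_integrable_def)
qed

lemma sq_integrable_inner:
  assumes "sq_integrable M X" "sq_integrable M Y"
  shows "integrable M (\<lambda>\<omega>. X \<omega> \<bullet> Y \<omega>)"
proof (rule Bochner_Integration.integrable_bound)
  show "integrable M (\<lambda>\<omega>. (norm (X \<omega>))\<^sup>2 + (norm (Y \<omega>))\<^sup>2)"
    using assms by (simp add: sq_integrable_norm2)
  show "(\<lambda>\<omega>. X \<omega> \<bullet> Y \<omega>) \<in> borel_measurable M"
    using assms by (auto simp: sq_integrable_def)
  show "AE \<omega> in M. norm (X \<omega> \<bullet> Y \<omega>) \<le> norm ((norm (X \<omega>))\<^sup>2 + (norm (Y \<omega>))\<^sup>2)"
  proof (rule AE_I2)
    fix \<omega>
    have "\<bar>X \<omega> \<bullet> Y \<omega>\<bar> \<le> norm (X \<omega>) * norm (Y \<omega>)" by (rule Cauchy_Schwarz_ineq2)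
    also have "\<dots> \<le> (norm (X \<omega>))\<^sup>2 + (norm (Y \<omega>))\<^sup>2"
      using sum_squares_bound[of "norm (X \<omega>)" "norm (Y \<omega>)"]
        mult_nonneg_nonneg[OF norm_ge_zero[of "X \<omega>"] norm_ge_zero[of "Y \<omega>"]] by linarith
    finally show "norm (X \<omega> \<bullet> Y \<omega>) \<le> norm ((norm (X \<omega>))\<^sup>2 + (norm (Y \<omega>))\<^sup>2)" by simp
  qed
qed

lemma (in prob_space) sq_integrable_const: "sq_integrable M (\<lambda>\<omega>. c)"
  by (simp add: sq_integrable_def)

lemma (in prob_space) sq_integrable_imp_integrable:
  assumes "sq_integrable M X"
  shows "integrable M (\<lambda>\<omega>. X \<omega> \<bullet> b)"
  using sq_integrable_inner[OF assms sq_integrable_const] .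

lemma (in prob_space) sq_integrable_lipschitz:
  assumes "sq_integrable M X" and lip: "\<And>a b. norm (k a - k b) \<le> L * norm (a - b)"
    and [measurable]: "k \<in> borel_measurable borel"
  shows "sq_integrable M (\<lambda>\<omega>. k (X \<omega>))"
proof (rule sq_integrable_bound)
  have [measurable]: "X \<in> borel_measurable M" using assms(1) by (rule sq_integrable_measurable)
  show "(\<lambda>\<omega>. k (X \<omega>)) \<in> borel_measurable M" by measurable
  show "integrable M (\<lambda>\<omega>. 2 * (L\<^sup>2 * (norm (X \<omega>))\<^sup>2 + (norm (k 0))\<^sup>2))"
    using assms(1) by (simp add: sq_integrable_norm2)
  fix \<omega>
  have "(norm (k (X \<omega>) - k 0 + k 0))\<^sup>2 \<le> 2 * ((norm (k (X \<omega>) - k 0))\<^sup>2 + (norm (k 0))\<^sup>2)"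
    by (rule norm_add_square_le)
  also have "(norm (k (X \<omega>) - k 0))\<^sup>2 \<le> (L * norm (X \<omega> - 0))\<^sup>2" by (intro power_mono lip) simp
  finally show "(norm (k (X \<omega>)))\<^sup>2 \<le> 2 * (L\<^sup>2 * (norm (X \<omega>))\<^sup>2 + (norm (k 0))\<^sup>2)"
    by (simp add: power_mult_distrib)
qed

section \<open>Integrating out an independent datum\<close>

lemma (in prob_space) independent_product_law:
  assumes G: "subalgebra M G" and Z[measurable]: "Z \<in> M \<rightarrow>\<^sub>M D"
    and indep: "\<And>A B. A \<in> sets G \<Longrightarrow> B \<in> sets D \<Longrightarrow>
      prob (A \<inter> (Z -` B \<inter> space M)) = prob A * prob (Z -` B \<inter> space M)"
  shows "distr M G (\<lambda>\<omega>. \<omega>) \<Otimes>\<^sub>M distr M D Z = distr M (G \<Otimes>\<^sub>M D) (\<lambda>\<omega>. (\<omega>, Z \<omega>))"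
proof -
  have id[measurable]: "(\<lambda>\<omega>. \<omega>) \<in> M \<rightarrow>\<^sub>M G" using G by (auto simp: subalgebra_def measurable_def)
  interpret P1: prob_space "distr M G (\<lambda>\<omega>. \<omega>)" by (rule prob_space_distr) measurable
  interpret P2: prob_space "distr M D Z" by (rule prob_space_distr) measurable
  show ?thesis
  proof (rule pair_measure_eqI)
    fix A B assume "A \<in> sets (distr M G (\<lambda>\<omega>. \<omega>))" "B \<in> sets (distr M D Z)"
    then have A: "A \<in> sets G" and B: "B \<in> sets D" by simp_all
    have AM: "A \<subseteq> space M" using sets.sets_into_space[OF A] G by (simp add: subalgebra_def)
    have "emeasure (distr M (G \<Otimes>\<^sub>M D) (\<lambda>\<omega>. (\<omega>, Z \<omega>))) (A \<times> B) = prob ((\<lambda>\<omega>. (\<omega>, Z \<omega>)) -` (A \<times> B) \<inter> space M)"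
      using A B by (subst emeasure_distr) (auto simp: emeasure_eq_measure)
    also have "(\<lambda>\<omega>. (\<omega>, Z \<omega>)) -` (A \<times> B) \<inter> space M = A \<inter> (Z -` B \<inter> space M)" by auto
    also have "(\<lambda>\<omega>. \<omega>) -` A \<inter> space M = A" using AM by auto
    ultimately show "emeasure (distr M G (\<lambda>\<omega>. \<omega>)) A * emeasure (distr M D Z) B =
        emeasure (distr M (G \<Otimes>\<^sub>M D) (\<lambda>\<omega>. (\<omega>, Z \<omega>))) (A \<times> B)"
      using A B indep[OF A B] AM
      by (simp add: emeasure_distr emeasure_eq_measure ennreal_mult[symmetric] Int_absorb2)
  qed (simp_all add: P1.sigma_finite_measure_axioms P2.sigma_finite_measure_axioms)
qed

text \<open>The identity of the sample space is regarded as a random element for the coarser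
  sigma-algebra \<open>G\<close>. Every \<open>G\<close>-measurable quantity is then a function of
  the first factor of a product measure, and Fubini applies.\<close>

lemma (in prob_space) integrate_out_independent:
  fixes H :: "'a \<times> 's \<Rightarrow> real"
  assumes G: "subalgebra M G" and Z[measurable]: "Z \<in> M \<rightarrow>\<^sub>M D"
    and indep: "\<And>A B. A \<in> sets G \<Longrightarrow> B \<in> sets D \<Longrightarrow>
      prob (A \<inter> (Z -` B \<inter> space M)) = prob A * prob (Z -` B \<inter> space M)"
    and H[measurable]: "H \<in> borel_measurable (G \<Otimes>\<^sub>M D)"
    and int: "integrable M (\<lambda>\<omega>. H (\<omega>, Z \<omega>))"
  shows "(\<integral>\<omega>. H (\<omega>, Z \<omega>) \<partial>M) = (\<integral>\<omega>. (\<integral>d. H (\<omega>, d) \<partial>distr M D Z) \<partial>M)"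
proof -
  have id[measurable]: "(\<lambda>\<omega>. \<omega>) \<in> M \<rightarrow>\<^sub>M G" using G by (auto simp: subalgebra_def measurable_def)
  have eq: "distr M G (\<lambda>\<omega>. \<omega>) \<Otimes>\<^sub>M distr M D Z = distr M (G \<Otimes>\<^sub>M D) (\<lambda>\<omega>. (\<omega>, Z \<omega>))"
    by (rule independent_product_law[OF G Z indep])
  interpret P1: prob_space "distr M G (\<lambda>\<omega>. \<omega>)" by (rule prob_space_distr) measurable
  interpret P2: prob_space "distr M D Z" by (rule prob_space_distr) measurable
  interpret pair_sigma_finite "distr M G (\<lambda>\<omega>. \<omega>)" "distr M D Z" ..
  have "integrable (distr M (G \<Otimes>\<^sub>M D) (\<lambda>\<omega>. (\<omega>, Z \<omega>))) H"
    using int by (subst integrable_distr_eq) auto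
  then have int': "integrable (distr M G (\<lambda>\<omega>. \<omega>) \<Otimes>\<^sub>M distr M D Z) H" by (simp add: eq)
  have "(\<integral>\<omega>. H (\<omega>, Z \<omega>) \<partial>M) = (\<integral>p. H p \<partial>distr M (G \<Otimes>\<^sub>M D) (\<lambda>\<omega>. (\<omega>, Z \<omega>)))"
    by (subst integral_distr) auto
  also have "\<dots> = (\<integral>\<omega>. (\<integral>d. H (\<omega>, d) \<partial>distr M D Z) \<partial>distr M G (\<lambda>\<omega>. \<omega>))"
    using integral_fst'[OF int'] by (simp add: eq)
  also have "\<dots> = (\<integral>\<omega>. (\<integral>d. H (\<omega>, d) \<partial>distr M D Z) \<partial>M)"
    by (subst integral_distr) measurable
  finally show ?thesis .
qed

text \<open>If \<open>Z\<close> is independent of \<open>G\<close>, then \<open>K (\<phi>, Z)\<close>, once centred given \<open>\<phi>\<close>, is orthogonal to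
  everything that is measurable with respect to \<open>G\<close>, not only to functions of \<open>\<phi>\<close>.\<close>

lemma (in prob_space) centred_orthogonal:
  fixes K :: "'b \<times> 's \<Rightarrow> real"
  assumes G: "subalgebra M G" and Z[measurable]: "Z \<in> M \<rightarrow>\<^sub>M D"
    and indep: "\<And>A B. A \<in> sets G \<Longrightarrow> B \<in> sets D \<Longrightarrow>
      prob (A \<inter> (Z -` B \<inter> space M)) = prob A * prob (Z -` B \<inter> space M)"
    and K[measurable]: "K \<in> borel_measurable (B \<Otimes>\<^sub>M D)"
    and \<phi>[measurable]: "\<phi> \<in> G \<rightarrow>\<^sub>M B"
    and centred: "\<And>u. u \<in> borel_measurable B \<Longrightarrow> (\<And>z. \<bar>u z\<bar> \<le> 1) \<Longrightarrow> (\<integral>\<omega>. u (\<phi> \<omega>) * K (\<phi> \<omega>, Z \<omega>) \<partial>M) = 0"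
    and s[measurable]: "s \<in> borel_measurable G"
    and int: "integrable M (\<lambda>\<omega>. K (\<phi> \<omega>, Z \<omega>))" "integrable M (\<lambda>\<omega>. s \<omega> * K (\<phi> \<omega>, Z \<omega>))"
  shows "(\<integral>\<omega>. s \<omega> * K (\<phi> \<omega>, Z \<omega>) \<partial>M) = 0"
proof -
  have id[measurable]: "(\<lambda>\<omega>. \<omega>) \<in> M \<rightarrow>\<^sub>M G" using G by (auto simp: subalgebra_def measurable_def)
  have s_M[measurable]: "s \<in> borel_measurable M" using measurable_compose[OF id s] .
  have \<phi>_M[measurable]: "\<phi> \<in> M \<rightarrow>\<^sub>M B" using measurable_compose[OF id \<phi>] .
  interpret P2: prob_space "distr M D Z" by (rule prob_space_distr) measurable
  define m where "m z = (\<integral>d. K (z, d) \<partial>distr M D Z)" for z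
  have m[measurable]: "m \<in> borel_measurable B"
    unfolding m_def by measurable
  have out: "(\<integral>\<omega>. u \<omega> * K (\<phi> \<omega>, Z \<omega>) \<partial>M) = (\<integral>\<omega>. u \<omega> * m (\<phi> \<omega>) \<partial>M)"
    if [measurable]: "u \<in> borel_measurable G" and "integrable M (\<lambda>\<omega>. u \<omega> * K (\<phi> \<omega>, Z \<omega>))" for u
  proof -
    have "(\<integral>\<omega>. (\<lambda>p. u (fst p) * K (\<phi> (fst p), snd p)) (\<omega>, Z \<omega>) \<partial>M) =
        (\<integral>\<omega>. (\<integral>d. (\<lambda>p. u (fst p) * K (\<phi> (fst p), snd p)) (\<omega>, d) \<partial>distr M D Z) \<partial>M)"
    proof (rule integrate_out_independent[OF G Z indep])
      show "(\<lambda>p. u (fst p) * K (\<phi> (fst p), snd p)) \<in> borel_measurable (G \<Otimes>\<^sub>M D)"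
        by measurable
      show "integrable M (\<lambda>\<omega>. (\<lambda>p. u (fst p) * K (\<phi> (fst p), snd p)) (\<omega>, Z \<omega>))"
        using that(2) by simp
    qed
    then show ?thesis by (simp add: m_def)
  qed
  have int_K: "integrable M (\<lambda>\<omega>. sgn (m (\<phi> \<omega>)) * K (\<phi> \<omega>, Z \<omega>))"
    by (rule Bochner_Integration.integrable_bound[OF int(1)])
      (auto intro!: AE_I2 simp: abs_mult sgn_real_def)
  \<comment> \<open>Testing the centring hypothesis with the sign of \<open>m\<close>, a bounded
    function of \<phi>, gives E |m \<phi>| = 0. Hence m \<phi> vanishes almost everywhere and any
    factor \<open>s\<close> may be put in front of it.\<close>
  have "(\<integral>\<omega>. \<bar>m (\<phi> \<omega>)\<bar> \<partial>M) = (\<integral>\<omega>. sgn (m (\<phi> \<omega>)) * m (\<phi> \<omega>) \<partial>M)"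
    by (simp add: abs_sgn mult.commute)
  also have "\<dots> = (\<integral>\<omega>. sgn (m (\<phi> \<omega>)) * K (\<phi> \<omega>, Z \<omega>) \<partial>M)"
    by (rule out[symmetric, OF _ int_K]) measurable
  also have "\<dots> = 0" by (rule centred[of "\<lambda>z. sgn (m z)"]) (auto simp: sgn_real_def)
  finally have "(\<integral>\<omega>. \<bar>m (\<phi> \<omega>)\<bar> \<partial>M) = 0" .
  moreover have "integrable M (\<lambda>\<omega>. \<bar>m (\<phi> \<omega>)\<bar>)"
  proof -
    have [measurable]: "(\<lambda>p. K (\<phi> (fst p), snd p)) \<in> borel_measurable (G \<Otimes>\<^sub>M D)" by measurable
    interpret P1: prob_space "distr M G (\<lambda>\<omega>. \<omega>)" by (rule prob_space_distr) measurable
    interpret pair_sigma_finite "distr M G (\<lambda>\<omega>. \<omega>)" "distr M D Z" ..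
    have "integrable (distr M (G \<Otimes>\<^sub>M D) (\<lambda>\<omega>. (\<omega>, Z \<omega>))) (\<lambda>p. K (\<phi> (fst p), snd p))"
      using int(1) by (subst integrable_distr_eq) auto
    then have "integrable (distr M G (\<lambda>\<omega>. \<omega>) \<Otimes>\<^sub>M distr M D Z) (\<lambda>p. K (\<phi> (fst p), snd p))"
      by (simp add: independent_product_law[OF G Z indep])
    from integrable_fst'[OF this] have "integrable (distr M G (\<lambda>\<omega>. \<omega>)) (\<lambda>\<omega>. m (\<phi> \<omega>))"
      by (simp add: m_def)
    then have "integrable M (\<lambda>\<omega>. m (\<phi> \<omega>))"
      by (subst (asm) integrable_distr_eq) auto
    then show ?thesis by simp
  qed
  ultimately have "AE \<omega> in M. \<bar>m (\<phi> \<omega>)\<bar> = 0"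
    by (subst (asm) integral_nonneg_eq_0_iff_AE) auto
  then have "(\<integral>\<omega>. s \<omega> * m (\<phi> \<omega>) \<partial>M) = (\<integral>\<omega>. 0 \<partial>M)"
    by (intro integral_cong_AE) auto
  then show ?thesis using out[OF s int(2)] by simp
qed

section \<open>LED as a random process: path structure, measurability, independence\<close>

locale led_process = network N nbr W lam + prob_space M
  for N nbr W lam and M :: "'w measure" +
  fixes \<tau> :: nat and \<alpha> L \<sigma> :: real and D :: "nat \<Rightarrow> 's measure"
    and F :: "nat \<Rightarrow> 'a::euclidean_space \<Rightarrow> 's \<Rightarrow> real" and f :: "nat \<Rightarrow> 'a \<Rightarrow> real"
    and \<xi> :: "nat \<Rightarrow> nat \<Rightarrow> nat \<Rightarrow> 'w \<Rightarrow> 's" and x0 :: "nat \<Rightarrow> 'a"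
    and x y :: "nat \<Rightarrow> nat \<Rightarrow> 'w \<Rightarrow> 'a" and \<phi> :: "nat \<Rightarrow> nat \<Rightarrow> nat \<Rightarrow> 'w \<Rightarrow> 'a"
  assumes tau_pos: "1 \<le> \<tau>" and alpha_pos: "0 < \<alpha>"
    and alpha_small: "\<alpha> * real \<tau> * L \<le> (1 - lam)\<^sup>2 / 200"
    and costs: "stochastic_costs N D F f" and smooth: "smoothness_assumption N L f"
    and consensual: "i < N \<Longrightarrow> j < N \<Longrightarrow> x0 i = x0 j"
    and run: "LED_run N nbr W \<tau> \<alpha> (1 / real \<tau>) (space M) F \<xi> x0 x y \<phi>"
    and noise_ass: "noise_assumption M N \<tau> D F f \<xi> \<phi> \<sigma>"
begin

abbreviation h :: "nat \<Rightarrow> 'a \<Rightarrow> 'a" where "h \<equiv> \<lambda>i. grad (f i)"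

definition g :: "nat \<Rightarrow> nat \<Rightarrow> nat \<Rightarrow> 'w \<Rightarrow> 'a" where
  "g i r t \<omega> = grad (\<lambda>z. F i z (\<xi> i r t \<omega>)) (\<phi> i r t \<omega>)"

definition err :: "nat \<Rightarrow> nat \<Rightarrow> nat \<Rightarrow> 'w \<Rightarrow> 'a" where
  "err i r t \<omega> = g i r t \<omega> - h i (\<phi> i r t \<omega>)"

lemma L_pos: "0 < L" using smooth by (simp add: smoothness_assumption_def)

lemma h_lip: "i < N \<Longrightarrow> norm (h i a - h i b) \<le> L * norm (a - b)"
  using smooth by (simp add: smoothness_assumption_def)

lemma GDERIV_f: "i < N \<Longrightarrow> GDERIV (f i) z :> h i z"
  using smooth by (intro differentiable_imp_GDERIV_grad) (simp add: smoothness_assumption_def)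

lemma GDERIV_mean: "GDERIV (mean_cost N f) z :> mean_grad N h z"
  by (intro GDERIV_mean_cost GDERIV_f)

lemma x_0: "i < N \<Longrightarrow> \<omega> \<in> space M \<Longrightarrow> x i 0 \<omega> = x0 i"
  using run by (simp add: LED_run_def)

text \<open>Since the rows of \<open>W\<close> sum to 1, mixing fixes consensual initial points, and
  the two admissible initialisations of the dual variable coincide.\<close>

lemma y_0:
  assumes "i < N" "\<omega> \<in> space M"
  shows "y i 0 \<omega> = 0"
proof -
  have "(\<Sum>j\<in>nbr i. W $$ (i, j) *\<^sub>R x0 j) = (\<Sum>j<N. W $$ (i, j) *\<^sub>R x0 i)"
    unfolding sum_nbr[OF assms(1)] by (intro sum.cong refl) (metis consensual assms(1) lessThan_iff)
  also have "\<dots> = x0 i" by (simp add: scaleR_sum_left[symmetric] W_row_sum assms(1))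
  finally show ?thesis using run assms unfolding LED_run_def by auto
qed

lemma run_steps:
  assumes "i < N" "\<omega> \<in> space M"
  shows "\<phi> i r 0 \<omega> = x i r \<omega>"
    and "t < \<tau> \<Longrightarrow> \<phi> i r (Suc t) \<omega> = \<phi> i r t \<omega> - \<alpha> *\<^sub>R g i r t \<omega> - (1 / real \<tau>) *\<^sub>R y i r \<omega>"
    and "x i (Suc r) \<omega> = (\<Sum>j<N. W $$ (i, j) *\<^sub>R \<phi> j r \<tau> \<omega>)"
    and "y i (Suc r) \<omega> = y i r \<omega> + \<phi> i r \<tau> \<omega> - x i (Suc r) \<omega>"
proof -
  have *: "\<phi> i r 0 \<omega> = x i r \<omega> \<and>
        (\<forall>t<\<tau>. \<phi> i r (Suc t) \<omega> =
           \<phi> i r t \<omega> - \<alpha> *\<^sub>R grad (\<lambda>z. F i z (\<xi> i r t \<omega>)) (\<phi> i r t \<omega>) - (1 / real \<tau>) *\<^sub>R y i r \<omega>) \<and>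
        x i (Suc r) \<omega> = (\<Sum>j\<in>nbr i. W $$ (i, j) *\<^sub>R \<phi> j r \<tau> \<omega>) \<and>
        y i (Suc r) \<omega> = y i r \<omega> + \<phi> i r \<tau> \<omega> - x i (Suc r) \<omega>"
    using run assms unfolding LED_run_def by blast
  show "\<phi> i r 0 \<omega> = x i r \<omega>"
    and "t < \<tau> \<Longrightarrow> \<phi> i r (Suc t) \<omega> = \<phi> i r t \<omega> - \<alpha> *\<^sub>R g i r t \<omega> - (1 / real \<tau>) *\<^sub>R y i r \<omega>"
    and "x i (Suc r) \<omega> = (\<Sum>j<N. W $$ (i, j) *\<^sub>R \<phi> j r \<tau> \<omega>)"
    and "y i (Suc r) \<omega> = y i r \<omega> + \<phi> i r \<tau> \<omega> - x i (Suc r) \<omega>"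
    using * unfolding g_def sum_nbr[OF assms(1), symmetric] by simp_all
qed

lemma step_small: "\<alpha> * real \<tau> * L \<le> 1 / 4"
proof -
  have "(1 - lam)\<^sup>2 \<le> 1" using lam_nonneg lam_less_1 by (simp add: power_le_one)
  then show ?thesis using alpha_small by simp
qed

text \<open>The zero mean of the dual variable is an assumption about a round and a conclusion about
  the next one. The round is therefore entered conditionally first, and \<open>avg_y_zero\<close>
  discharges the condition by induction.\<close>

lemma round_if_avg_y:
  assumes "\<omega> \<in> space M" "avg N (\<lambda>i. y i r \<omega>) = 0"
  shows "led_round N nbr W lam \<tau> \<alpha> L h (\<lambda>i. x i r \<omega>) (\<lambda>i. y i r \<omega>)
    (\<lambda>i. x i (Suc r) \<omega>) (\<lambda>i. y i (Suc r) \<omega>) (\<lambda>i t. \<phi> i r t \<omega>) (\<lambda>i t. g i r t \<omega>)"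
  by unfold_locales
    (use assms tau_pos alpha_pos L_pos h_lip run_steps step_small in auto)

lemma avg_y_zero: "\<omega> \<in> space M \<Longrightarrow> avg N (\<lambda>i. y i r \<omega>) = 0"
proof (induction r)
  case 0
  then have "avg N (\<lambda>i. y i 0 \<omega>) = avg N (\<lambda>i. 0)" by (intro avg_cong y_0)
  then show ?case by (simp add: avg_def)
next
  case (Suc r)
  then interpret led_round N nbr W lam \<tau> \<alpha> L h "\<lambda>i. x i r \<omega>" "\<lambda>i. y i r \<omega>"
    "\<lambda>i. x i (Suc r) \<omega>" "\<lambda>i. y i (Suc r) \<omega>" "\<lambda>i t. \<phi> i r t \<omega>" "\<lambda>i t. g i r t \<omega>"
    by (intro round_if_avg_y)
  show ?case by (rule avg_y')
qed

lemma round_locale: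
  assumes "\<omega> \<in> space M"
  shows "led_round N nbr W lam \<tau> \<alpha> L h (\<lambda>i. x i r \<omega>) (\<lambda>i. y i r \<omega>)
    (\<lambda>i. x i (Suc r) \<omega>) (\<lambda>i. y i (Suc r) \<omega>) (\<lambda>i t. \<phi> i r t \<omega>) (\<lambda>i t. g i r t \<omega>)"
  by (intro round_if_avg_y assms avg_y_zero)

lemma h_measurable: "i < N \<Longrightarrow> h i \<in> borel_measurable borel"
proof -
  assume i: "i < N"
  have "continuous_on UNIV (h i)"
  proof (rule continuous_onI)
    fix z :: 'a and \<epsilon> :: real assume "\<epsilon> > 0"
    then have "dist (h i w) (h i z) \<le> \<epsilon>" if "dist w z < \<epsilon> / L" for w
      using h_lip[OF i, of w z] that L_pos by (simp add: dist_norm field_simps)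
    then show "\<exists>d>0. \<forall>w\<in>UNIV. dist w z < d \<longrightarrow> dist (h i w) (h i z) \<le> \<epsilon>"
      using L_pos \<open>\<epsilon> > 0\<close> by (intro exI[of _ "\<epsilon> / L"]) auto
  qed
  then show ?thesis by (rule borel_measurable_continuous_onI)
qed

lemma grad_F_measurable: "i < N \<Longrightarrow> (\<lambda>(z, s). grad (\<lambda>z. F i z s) z) \<in> borel \<Otimes>\<^sub>M D i \<rightarrow>\<^sub>M borel"
  using costs by (simp add: stochastic_costs_def)

lemma g_measurable:
  assumes i: "i < N" and "\<phi> i r t \<in> borel_measurable H" "\<xi> i r t \<in> H \<rightarrow>\<^sub>M D i"
  shows "g i r t \<in> borel_measurable H" "err i r t \<in> borel_measurable H"
proof -
  note [measurable] = assms(2,3) grad_F_measurable[OF i] h_measurable[OF i]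
  have "(\<lambda>\<omega>. (\<lambda>(z, s). grad (\<lambda>z. F i z s) z) (\<phi> i r t \<omega>, \<xi> i r t \<omega>)) \<in> borel_measurable H"
    by measurable
  then have [measurable]: "g i r t \<in> borel_measurable H"
    by (simp add: g_def[abs_def])
  then show "g i r t \<in> borel_measurable H" .
  show "err i r t \<in> borel_measurable H" unfolding err_def[abs_def] by measurable
qed

text \<open>The sigma-algebra \<open>H\<close> is left open because it is instantiated twice: by
  \<open>M\<close> itself, and by the one generated by all data except a single one.\<close>

lemma local_steps_measurable:
  assumes H: "space H = space M"
    and x: "\<And>i. i < N \<Longrightarrow> x i r \<in> borel_measurable H" and y: "\<And>i. i < N \<Longrightarrow> y i r \<in> borel_measurable H"
    and xi: "\<And>i s. i < N \<Longrightarrow> s < t \<Longrightarrow> \<xi> i r s \<in> H \<rightarrow>\<^sub>M D i" and t: "t \<le> \<tau>" and i: "i < N"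
  shows "\<phi> i r t \<in> borel_measurable H"
  using xi t
proof (induction t)
  case 0
  have "\<phi> i r 0 \<in> borel_measurable H \<longleftrightarrow> x i r \<in> borel_measurable H"
    by (intro measurable_cong) (simp add: H run_steps i)
  then show ?case using x i by simp
next
  case (Suc t)
  then have p[measurable]: "\<phi> i r t \<in> borel_measurable H" by simp
  have [measurable]: "g i r t \<in> borel_measurable H" using Suc.prems i p by (intro g_measurable) auto
  note [measurable] = y[OF i]
  have "\<phi> i r (Suc t) \<in> borel_measurable H \<longleftrightarrow>
      (\<lambda>\<omega>. \<phi> i r t \<omega> - \<alpha> *\<^sub>R g i r t \<omega> - (1 / real \<tau>) *\<^sub>R y i r \<omega>) \<in> borel_measurable H"
    using Suc.prems(2) by (intro measurable_cong) (simp add: H run_steps i)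
  then show ?case by simp
qed

lemma rounds_measurable:
  assumes H: "space H = space M"
    and xi: "\<And>i q s. i < N \<Longrightarrow> q < r \<Longrightarrow> s < \<tau> \<Longrightarrow> \<xi> i q s \<in> H \<rightarrow>\<^sub>M D i"
  shows "i < N \<Longrightarrow> x i r \<in> borel_measurable H" "i < N \<Longrightarrow> y i r \<in> borel_measurable H"
proof -
  have "\<forall>i<N. x i r \<in> borel_measurable H \<and> y i r \<in> borel_measurable H"
    using xi
  proof (induction r)
    case 0
    have "x i 0 \<in> borel_measurable H \<and> y i 0 \<in> borel_measurable H" if i: "i < N" for i
    proof -
      have "x i 0 \<in> borel_measurable H \<longleftrightarrow> (\<lambda>\<omega>. x0 i) \<in> borel_measurable H"
        "y i 0 \<in> borel_measurable H \<longleftrightarrow> (\<lambda>\<omega>. 0 :: 'a) \<in> borel_measurable H"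
        by (rule measurable_cong, simp add: H x_0 y_0 i)+
      then show ?thesis by simp
    qed
    then show ?case by blast
  next
    case (Suc r)
    then have IH: "\<forall>i<N. x i r \<in> borel_measurable H \<and> y i r \<in> borel_measurable H" by simp
    have p: "\<phi> i r \<tau> \<in> borel_measurable H" if "i < N" for i
      using IH Suc.prems that by (intro local_steps_measurable[OF H]) auto
    have x': "x i (Suc r) \<in> borel_measurable H" if i: "i < N" for i
    proof -
      have "x i (Suc r) \<in> borel_measurable H \<longleftrightarrow> (\<lambda>\<omega>. \<Sum>j<N. W $$ (i, j) *\<^sub>R \<phi> j r \<tau> \<omega>) \<in> borel_measurable H"
        by (intro measurable_cong) (simp add: H run_steps i)
      moreover have "(\<lambda>\<omega>. \<Sum>j<N. W $$ (i, j) *\<^sub>R \<phi> j r \<tau> \<omega>) \<in> borel_measurable H"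
        by (intro borel_measurable_sum borel_measurable_scaleR p) auto
      ultimately show ?thesis by simp
    qed
    have "y i (Suc r) \<in> borel_measurable H" if i: "i < N" for i
    proof -
      have "y i (Suc r) \<in> borel_measurable H \<longleftrightarrow> (\<lambda>\<omega>. y i r \<omega> + \<phi> i r \<tau> \<omega> - x i (Suc r) \<omega>) \<in> borel_measurable H"
        by (intro measurable_cong) (simp add: H run_steps i)
      moreover note [measurable] = p[OF i] x'[OF i]
      have [measurable]: "y i r \<in> borel_measurable H" using IH i by blast
      have "(\<lambda>\<omega>. y i r \<omega> + \<phi> i r \<tau> \<omega> - x i (Suc r) \<omega>) \<in> borel_measurable H" by measurable
      ultimately show ?thesis by simp
    qed
    with x' show ?case by blast
  qed
  then show "i < N \<Longrightarrow> x i r \<in> borel_measurable H" "i < N \<Longrightarrow> y i r \<in> borel_measurable H" by auto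
qed

lemma iterate_measurable:
  assumes H: "space H = space M"
    and xi: "\<And>j q s. j < N \<Longrightarrow> s < \<tau> \<Longrightarrow> q < r \<or> q = r \<and> s < t \<Longrightarrow> \<xi> j q s \<in> H \<rightarrow>\<^sub>M D j"
    and "t \<le> \<tau>" "i < N"
  shows "\<phi> i r t \<in> borel_measurable H"
  using assms by (intro local_steps_measurable[OF H] rounds_measurable[OF H]) auto

abbreviation Idx :: "(nat \<times> nat \<times> nat) set" where "Idx \<equiv> {..<N} \<times> UNIV \<times> {..<\<tau>}"

abbreviation data :: "nat \<times> nat \<times> nat \<Rightarrow> 'w \<Rightarrow> 's" where "data \<equiv> \<lambda>(i, r, t). \<xi> i r t"

abbreviation law :: "nat \<times> nat \<times> nat \<Rightarrow> 's measure" where "law \<equiv> \<lambda>(i, r, t). D i"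

lemma data_indep: "indep_vars law data Idx"
  using noise_ass by (simp add: noise_assumption_def)

lemma xi_measurable: "i < N \<Longrightarrow> t < \<tau> \<Longrightarrow> \<xi> i r t \<in> M \<rightarrow>\<^sub>M D i"
  using data_indep unfolding indep_vars_def by fastforce

text \<open>The noise at index \<open>k\<close> is orthogonal to everything that depends on the other data only. This covers
  at once the past iterates, the earlier noise, and the noise of the other nodes in the same step.\<close>

definition others :: "nat \<times> nat \<times> nat \<Rightarrow> 'w measure" where
  "others k = vimage_algebra (space M) (\<lambda>\<omega>. \<lambda>j\<in>Idx - {k}. data j \<omega>) (PiM (Idx - {k}) law)"

lemma space_others [simp]: "space (others k) = space M"
  by (simp add: others_def)

lemma data_restrict_measurable: "(\<lambda>\<omega>. \<lambda>j\<in>Idx - {k}. data j \<omega>) \<in> M \<rightarrow>\<^sub>M PiM (Idx - {k}) law"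
  by (intro measurable_restrict) (auto intro: xi_measurable)

lemma sets_others:
  "sets (others k) = {(\<lambda>\<omega>. \<lambda>j\<in>Idx - {k}. data j \<omega>) -` A \<inter> space M | A. A \<in> sets (PiM (Idx - {k}) law)}"
  unfolding others_def using measurable_space[OF data_restrict_measurable[of k]]
  by (intro sets_vimage_algebra2) auto

lemma others_subalgebra: "subalgebra M (others k)"
  unfolding subalgebra_def sets_others using measurable_sets[OF data_restrict_measurable[of k]] by auto

lemma xi_others:
  assumes "i < N" "t < \<tau>" "(i, r, t) \<noteq> k"
  shows "\<xi> i r t \<in> others k \<rightarrow>\<^sub>M D i"
proof -
  have R: "(\<lambda>\<omega>. \<lambda>j\<in>Idx - {k}. data j \<omega>) \<in> others k \<rightarrow>\<^sub>M PiM (Idx - {k}) law"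
    unfolding others_def using measurable_space[OF data_restrict_measurable[of k]]
    by (intro measurable_vimage_algebra1) auto
  have "(\<lambda>\<omega>. (\<lambda>j\<in>Idx - {k}. data j \<omega>) (i, r, t)) \<in> others k \<rightarrow>\<^sub>M law (i, r, t)"
    by (rule measurable_compose[OF R measurable_component_singleton]) (use assms in auto)
  then show ?thesis using assms by simp
qed

text \<open>The jointly independent family is split into the blocks \<open>Idx - {k}\<close> and
  \<open>{k}\<close>; events of the two restrictions are then pulled back to events of the sample
  space.\<close>

lemma others_indep:
  assumes "i < N" "t < \<tau>" and U: "U \<in> sets (others (i, r, t))" and V: "V \<in> sets (D i)"
  shows "prob (U \<inter> (\<xi> i r t -` V \<inter> space M)) = prob U * prob (\<xi> i r t -` V \<inter> space M)"
proof -
  let ?k = "(i, r, t)"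
  have k: "?k \<in> Idx" using assms by simp
  have ind: "indep_var (PiM (Idx - {?k}) law) (\<lambda>\<omega>. \<lambda>j\<in>Idx - {?k}. data j \<omega>) (PiM {?k} law) (\<lambda>\<omega>. \<lambda>j\<in>{?k}. data j \<omega>)"
    by (rule indep_var_restrict[OF data_indep]) (use k in auto)
  obtain U' where U': "U' \<in> sets (PiM (Idx - {?k}) law)"
    "U = (\<lambda>\<omega>. \<lambda>j\<in>Idx - {?k}. data j \<omega>) -` U' \<inter> space M"
    using U by (auto simp: sets_others)
  let ?V = "(\<lambda>v. v ?k) -` V \<inter> space (PiM {?k} law)"
  have V': "?V \<in> sets (PiM {?k} law)"
    by (rule measurable_sets[OF measurable_component_singleton]) (use V in auto)
  have R2: "(\<lambda>\<omega>. \<lambda>j\<in>{?k}. data j \<omega>) \<in> M \<rightarrow>\<^sub>M PiM {?k} law"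
    by (intro measurable_restrict) (use assms in \<open>auto intro: xi_measurable\<close>)
  have eq: "(\<lambda>\<omega>. \<lambda>j\<in>{?k}. data j \<omega>) -` ?V \<inter> space M = \<xi> i r t -` V \<inter> space M"
    using measurable_space[OF R2] by auto
  have "prob ((\<lambda>\<omega>. (\<lambda>j\<in>Idx - {?k}. data j \<omega>, \<lambda>j\<in>{?k}. data j \<omega>)) -` (U' \<times> ?V) \<inter> space M) =
    prob ((\<lambda>\<omega>. \<lambda>j\<in>Idx - {?k}. data j \<omega>) -` U' \<inter> space M) * prob ((\<lambda>\<omega>. \<lambda>j\<in>{?k}. data j \<omega>) -` ?V \<inter> space M)"
    by (rule indep_varD[OF ind U'(1) V'])
  moreover have "(\<lambda>\<omega>. (\<lambda>j\<in>Idx - {?k}. data j \<omega>, \<lambda>j\<in>{?k}. data j \<omega>)) -` (U' \<times> ?V) \<inter> space M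
      = U \<inter> (\<xi> i r t -` V \<inter> space M)"
    unfolding eq[symmetric] U'(2) by auto
  ultimately show ?thesis unfolding eq U'(2)[symmetric] by simp
qed

lemma iterate_others:
  assumes "i < N" "t < \<tau>" "j < N" "q < r \<and> s \<le> \<tau> \<or> q = r \<and> s \<le> t"
  shows "\<phi> j q s \<in> borel_measurable (others (i, r, t))"
  using assms by (intro iterate_measurable) (auto intro!: xi_others)

lemma state_others:
  assumes "i < N" "t < \<tau>" "j < N"
  shows "x j r \<in> borel_measurable (others (i, r, t))" "y j r \<in> borel_measurable (others (i, r, t))"
  using assms by (auto intro!: rounds_measurable xi_others)

lemma err_others:
  assumes "i < N" "t < \<tau>" "j < N" "s < t \<or> s = t \<and> j \<noteq> i"
  shows "err j r s \<in> borel_measurable (others (i, r, t))"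
  using assms by (intro g_measurable iterate_others xi_others) auto

lemma iterate_M: "i < N \<Longrightarrow> t \<le> \<tau> \<Longrightarrow> \<phi> i r t \<in> borel_measurable M"
  by (intro iterate_measurable xi_measurable) auto

lemma err_M: "i < N \<Longrightarrow> t < \<tau> \<Longrightarrow> err i r t \<in> borel_measurable M" "i < N \<Longrightarrow> t < \<tau> \<Longrightarrow> g i r t \<in> borel_measurable M"
  by (intro g_measurable iterate_M xi_measurable; simp)+

lemma past_generators:
  "{\<phi> j q s -` A \<inter> space M | j q s A. j < N \<and> (q < r \<and> s \<le> \<tau> \<or> q = r \<and> s \<le> t) \<and> A \<in> sets borel} \<subseteq> Pow (space M)"
  by auto

lemma past_subalgebra:
  assumes "t < \<tau>"
  shows "subalgebra M (past M N \<tau> \<phi> r t)"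
proof -
  have "\<phi> j q s -` A \<inter> space M \<in> sets M"
    if "j < N" "q < r \<and> s \<le> \<tau> \<or> q = r \<and> s \<le> t" "A \<in> sets borel" for j q s and A :: "'a set"
    using that assms by (intro measurable_sets[OF iterate_M]) auto
  then show ?thesis
    unfolding subalgebra_def past_def space_measure_of[OF past_generators] sets_measure_of[OF past_generators]
    by (auto intro!: sets.sigma_sets_subset)
qed

lemma current_past:
  assumes "t < \<tau>" "i < N"
  shows "\<phi> i r t \<in> borel_measurable (past M N \<tau> \<phi> r t)"
proof (rule measurableI)
  fix A :: "'a set" assume "A \<in> sets borel"
  then show "\<phi> i r t -` A \<inter> space (past M N \<tau> \<phi> r t) \<in> sets (past M N \<tau> \<phi> r t)"
    unfolding past_def space_measure_of[OF past_generators] sets_measure_of[OF past_generators]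
    using assms by (intro sigma_sets.Basic) auto
qed simp

text \<open>The conditional bound is integrated against the constant 1. Working in the extended
  nonnegative reals makes integrability a conclusion.\<close>

lemma err_second_moment:
  assumes i: "i < N" and t: "t < \<tau>"
  shows "sq_integrable M (err i r t)" "expectation (\<lambda>\<omega>. (norm (err i r t \<omega>))\<^sup>2) \<le> \<sigma>\<^sup>2"
proof -
  interpret fin: finite_measure_subalgebra M "past M N \<tau> \<phi> r t"
    by unfold_locales (rule past_subalgebra[OF t])
  have [measurable]: "err i r t \<in> borel_measurable M" by (rule err_M[OF i t])
  have AE: "AE \<omega> in M. nn_cond_exp M (past M N \<tau> \<phi> r t) (\<lambda>\<omega>. ennreal ((norm (err i r t \<omega>))\<^sup>2)) \<omega> \<le> ennreal (\<sigma>\<^sup>2)"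
    using noise_ass i t by (simp add: noise_assumption_def err_def g_def)
  have "(\<integral>\<^sup>+\<omega>. ennreal ((norm (err i r t \<omega>))\<^sup>2) \<partial>M) =
      (\<integral>\<^sup>+\<omega>. nn_cond_exp M (past M N \<tau> \<phi> r t) (\<lambda>\<omega>. ennreal ((norm (err i r t \<omega>))\<^sup>2)) \<omega> \<partial>M)"
    using fin.nn_cond_exp_intg[of "\<lambda>_. 1" "\<lambda>\<omega>. ennreal ((norm (err i r t \<omega>))\<^sup>2)"] by simp
  also have "\<dots> \<le> (\<integral>\<^sup>+\<omega>. ennreal (\<sigma>\<^sup>2) \<partial>M)" by (rule nn_integral_mono_AE[OF AE])
  also have "\<dots> = ennreal (\<sigma>\<^sup>2)" by (simp add: emeasure_space_1)
  finally have le: "(\<integral>\<^sup>+\<omega>. ennreal ((norm (err i r t \<omega>))\<^sup>2) \<partial>M) \<le> ennreal (\<sigma>\<^sup>2)" .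
  then have int: "integrable M (\<lambda>\<omega>. (norm (err i r t \<omega>))\<^sup>2)"
    by (intro integrableI_nonneg) (auto simp: le_less_trans[OF _ ennreal_less_top])
  then show "sq_integrable M (err i r t)" by (simp add: sq_integrable_def)
  show "expectation (\<lambda>\<omega>. (norm (err i r t \<omega>))\<^sup>2) \<le> \<sigma>\<^sup>2"
    using le by (subst (asm) nn_integral_eq_integral[OF int]) auto
qed

text \<open>Second moments are controlled for the gradient error, so a sampled gradient is split
  into that error and the exact gradient, which grows at most affinely. The induction over local
  steps is nested in the one over rounds.\<close>

lemma state_sq_integrable:
  shows "i < N \<Longrightarrow> sq_integrable M (x i r)" "i < N \<Longrightarrow> sq_integrable M (y i r)"
    "i < N \<Longrightarrow> t \<le> \<tau> \<Longrightarrow> sq_integrable M (\<phi> i r t)"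
proof -
  have local: "\<forall>i<N. sq_integrable M (\<phi> i r t)"
    if st: "\<forall>i<N. sq_integrable M (x i r) \<and> sq_integrable M (y i r)" and t: "t \<le> \<tau>" for r t
    using t
  proof (induction t)
    case 0
    have "sq_integrable M (\<phi> i r 0) \<longleftrightarrow> sq_integrable M (x i r)" if "i < N" for i
      by (intro sq_integrable_cong) (simp add: run_steps that)
    then show ?case using st by blast
  next
    case (Suc t)
    have "sq_integrable M (\<phi> i r (Suc t))" if i: "i < N" for i
    proof -
      have p: "sq_integrable M (\<phi> i r t)" using Suc i by simp
      have "sq_integrable M (\<lambda>\<omega>. h i (\<phi> i r t \<omega>))"
        using p h_lip[OF i] h_measurable[OF i] by (rule sq_integrable_lipschitz)
      then have "sq_integrable M (\<lambda>\<omega>. \<phi> i r t \<omega> - \<alpha> *\<^sub>R (err i r t \<omega> + h i (\<phi> i r t \<omega>)) - (1 / real \<tau>) *\<^sub>R y i r \<omega>)"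
        using p st i Suc.prems
        by (intro sq_integrable_diff sq_integrable_scale sq_integrable_add err_second_moment) auto
      moreover have "sq_integrable M (\<phi> i r (Suc t)) \<longleftrightarrow>
          sq_integrable M (\<lambda>\<omega>. \<phi> i r t \<omega> - \<alpha> *\<^sub>R (err i r t \<omega> + h i (\<phi> i r t \<omega>)) - (1 / real \<tau>) *\<^sub>R y i r \<omega>)"
        using Suc.prems by (intro sq_integrable_cong) (simp add: run_steps i err_def)
      ultimately show ?thesis by simp
    qed
    then show ?case by blast
  qed
  have st: "\<forall>i<N. sq_integrable M (x i r) \<and> sq_integrable M (y i r)" for r
  proof (induction r)
    case 0
    have "sq_integrable M (x i 0) \<longleftrightarrow> sq_integrable M (\<lambda>\<omega>. x0 i)"
      "sq_integrable M (y i 0) \<longleftrightarrow> sq_integrable M (\<lambda>\<omega>. 0 :: 'a)" if "i < N" for i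
      by (intro sq_integrable_cong; simp add: x_0 y_0 that)+
    then show ?case using sq_integrable_const by blast
  next
    case (Suc r)
    have p: "\<forall>i<N. sq_integrable M (\<phi> i r \<tau>)" using local[OF Suc] by simp
    have x': "sq_integrable M (x i (Suc r))" if i: "i < N" for i
    proof -
      have "sq_integrable M (\<lambda>\<omega>. \<Sum>j<N. W $$ (i, j) *\<^sub>R \<phi> j r \<tau> \<omega>)"
        using p by (intro sq_integrable_sum sq_integrable_scale) auto
      moreover have "sq_integrable M (x i (Suc r)) \<longleftrightarrow> sq_integrable M (\<lambda>\<omega>. \<Sum>j<N. W $$ (i, j) *\<^sub>R \<phi> j r \<tau> \<omega>)"
        by (intro sq_integrable_cong) (simp add: run_steps i)
      ultimately show ?thesis by simp
    qed
    have "sq_integrable M (y i (Suc r))" if i: "i < N" for i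
    proof -
      have "sq_integrable M (\<lambda>\<omega>. y i r \<omega> + \<phi> i r \<tau> \<omega> - x i (Suc r) \<omega>)"
        using Suc p x' i by (intro sq_integrable_diff sq_integrable_add) auto
      moreover have "sq_integrable M (y i (Suc r)) \<longleftrightarrow> sq_integrable M (\<lambda>\<omega>. y i r \<omega> + \<phi> i r \<tau> \<omega> - x i (Suc r) \<omega>)"
        by (intro sq_integrable_cong) (simp add: run_steps i)
      ultimately show ?thesis by simp
    qed
    with x' show ?case by blast
  qed
  show "i < N \<Longrightarrow> sq_integrable M (x i r)" "i < N \<Longrightarrow> sq_integrable M (y i r)"
    "i < N \<Longrightarrow> t \<le> \<tau> \<Longrightarrow> sq_integrable M (\<phi> i r t)"
    using st local[OF st] by auto
qed

lemma grad_sq_integrable: "i < N \<Longrightarrow> t \<le> \<tau> \<Longrightarrow> sq_integrable M (\<lambda>\<omega>. h i (\<phi> i r t \<omega>))"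
  by (rule sq_integrable_lipschitz[OF state_sq_integrable(3) h_lip h_measurable])

text \<open>The conditional mean is tested only with bounded functions of the current iterate, which
  are measurable for the past. \<open>centred_orthogonal\<close> then upgrades this to every
  \<open>s\<close> built from the other data, including noise of other nodes in the same
  step.\<close>

lemma err_orthogonal:
  assumes i: "i < N" and t: "t < \<tau>"
    and s_meas: "s \<in> borel_measurable (others (i, r, t))" and s: "sq_integrable M s"
  shows "expectation (\<lambda>\<omega>. s \<omega> \<bullet> err i r t \<omega>) = 0"
proof -
  let ?P = "past M N \<tau> \<phi> r t"
  interpret fin: finite_measure_subalgebra M ?P
    by unfold_locales (rule past_subalgebra[OF t])
  have e2: "sq_integrable M (err i r t)" by (rule err_second_moment[OF i t])
  have comp: "expectation (\<lambda>\<omega>. (s \<omega> \<bullet> b) * (err i r t \<omega> \<bullet> b)) = 0"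
    and comp_int: "integrable M (\<lambda>\<omega>. (s \<omega> \<bullet> b) * (err i r t \<omega> \<bullet> b))" if b: "b \<in> Basis" for b
  proof -
    define K where "K = (\<lambda>(z, d). grad (\<lambda>z. F i z d) z \<bullet> b - h i z \<bullet> b)"
    have K: "K \<in> borel_measurable (borel \<Otimes>\<^sub>M D i)"
    proof -
      note [measurable] = grad_F_measurable[OF i] h_measurable[OF i]
      have "(\<lambda>p. (\<lambda>(z, s). grad (\<lambda>z. F i z s) z) p \<bullet> b - h i (fst p) \<bullet> b) \<in> borel_measurable (borel \<Otimes>\<^sub>M D i)"
        by measurable
      then show ?thesis by (simp add: K_def case_prod_beta')
    qed
    have K_eq: "K (\<phi> i r t \<omega>, \<xi> i r t \<omega>) = err i r t \<omega> \<bullet> b" for \<omega>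
      by (simp add: K_def err_def g_def inner_diff_left)
    have sb: "sq_integrable M (\<lambda>\<omega>. s \<omega> \<bullet> b)"
    proof (rule sq_integrable_bound[OF _ sq_integrable_norm2[OF s]])
      show "(\<lambda>\<omega>. s \<omega> \<bullet> b) \<in> borel_measurable M" using sq_integrable_measurable[OF s] by measurable
      show "(norm (s \<omega> \<bullet> b))\<^sup>2 \<le> (norm (s \<omega>))\<^sup>2" for \<omega>
        using Basis_le_norm[OF b, of "s \<omega>"] by (intro power_mono) auto
    qed
    have eb: "sq_integrable M (\<lambda>\<omega>. err i r t \<omega> \<bullet> b)"
    proof (rule sq_integrable_bound[OF _ sq_integrable_norm2[OF e2]])
      show "(\<lambda>\<omega>. err i r t \<omega> \<bullet> b) \<in> borel_measurable M" using sq_integrable_measurable[OF e2] by measurable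
      show "(norm (err i r t \<omega> \<bullet> b))\<^sup>2 \<le> (norm (err i r t \<omega>))\<^sup>2" for \<omega>
        using Basis_le_norm[OF b, of "err i r t \<omega>"] by (intro power_mono) auto
    qed
    show int: "integrable M (\<lambda>\<omega>. (s \<omega> \<bullet> b) * (err i r t \<omega> \<bullet> b))"
      using sq_integrable_inner[OF sb eb] by simp
    have int_e: "integrable M (\<lambda>\<omega>. err i r t \<omega> \<bullet> b)" by (rule sq_integrable_imp_integrable[OF e2])
    have "expectation (\<lambda>\<omega>. (s \<omega> \<bullet> b) * K (\<phi> i r t \<omega>, \<xi> i r t \<omega>)) = 0"
    proof (rule centred_orthogonal[OF others_subalgebra xi_measurable[OF i t] others_indep[OF i t] K])
      show "\<phi> i r t \<in> borel_measurable (others (i, r, t))" using i t by (intro iterate_others) auto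
      show "(\<lambda>\<omega>. s \<omega> \<bullet> b) \<in> borel_measurable (others (i, r, t))" using s_meas by measurable
      show "integrable M (\<lambda>\<omega>. K (\<phi> i r t \<omega>, \<xi> i r t \<omega>))" unfolding K_eq by (rule int_e)
      show "integrable M (\<lambda>\<omega>. (s \<omega> \<bullet> b) * K (\<phi> i r t \<omega>, \<xi> i r t \<omega>))" unfolding K_eq by (rule int)
      fix u :: "'a \<Rightarrow> real" assume u[measurable]: "u \<in> borel_measurable borel" and bound: "\<And>z. \<bar>u z\<bar> \<le> 1"
      have h_int: "integrable M (\<lambda>\<omega>. h i (\<phi> i r t \<omega>) \<bullet> b)"
        using i t by (intro sq_integrable_imp_integrable grad_sq_integrable) auto
      \<comment> \<open>Conditional expectation can be exchanged with the test function only for an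
        integrable gradient; this is where the decomposition into error and exact gradient is
        needed.\<close>
      have g_int: "integrable M (\<lambda>\<omega>. g i r t \<omega> \<bullet> b)"
        using Bochner_Integration.integrable_add[OF int_e h_int] by (simp add: err_def inner_diff_left)
      have up[measurable]: "(\<lambda>\<omega>. u (\<phi> i r t \<omega>)) \<in> borel_measurable ?P"
        by (rule measurable_compose[OF current_past[OF t i] u])
      have upM[measurable]: "(\<lambda>\<omega>. u (\<phi> i r t \<omega>)) \<in> borel_measurable M"
        using i t by (intro measurable_compose[OF iterate_M u]) auto
      have bdd: "integrable M (\<lambda>\<omega>. u (\<phi> i r t \<omega>) * v \<omega>)" if v: "integrable M v" for v
      proof (rule Bochner_Integration.integrable_bound[OF v])
        show "(\<lambda>\<omega>. u (\<phi> i r t \<omega>) * v \<omega>) \<in> borel_measurable M" using v upM by measurable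
        show "AE \<omega> in M. norm (u (\<phi> i r t \<omega>) * v \<omega>) \<le> norm (v \<omega>)"
          using bound by (intro AE_I2) (simp add: abs_mult mult_left_le_one_le)
      qed
      have "expectation (\<lambda>\<omega>. u (\<phi> i r t \<omega>) * (g i r t \<omega> \<bullet> b)) =
          expectation (\<lambda>\<omega>. u (\<phi> i r t \<omega>) * real_cond_exp M ?P (\<lambda>\<omega>. g i r t \<omega> \<bullet> b) \<omega>)"
        using g_int by (intro fin.real_cond_exp_intg(2)[symmetric] bdd up) auto
      also have "\<dots> = expectation (\<lambda>\<omega>. u (\<phi> i r t \<omega>) * (h i (\<phi> i r t \<omega>) \<bullet> b))"
      proof (rule integral_cong_AE)
        have "AE \<omega> in M. real_cond_exp M ?P (\<lambda>\<omega>. g i r t \<omega> \<bullet> b) \<omega> = h i (\<phi> i r t \<omega>) \<bullet> b"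
          using noise_ass i t b unfolding noise_assumption_def g_def by blast
        then show "AE \<omega> in M. u (\<phi> i r t \<omega>) * real_cond_exp M ?P (\<lambda>\<omega>. g i r t \<omega> \<bullet> b) \<omega> =
            u (\<phi> i r t \<omega>) * (h i (\<phi> i r t \<omega>) \<bullet> b)"
          by eventually_elim simp
        show "(\<lambda>\<omega>. u (\<phi> i r t \<omega>) * (h i (\<phi> i r t \<omega>) \<bullet> b)) \<in> borel_measurable M"
          using bdd[OF h_int] by auto
      qed (use upM in measurable)
      finally show "expectation (\<lambda>\<omega>. u (\<phi> i r t \<omega>) * K (\<phi> i r t \<omega>, \<xi> i r t \<omega>)) = 0"
        using bdd[OF g_int] bdd[OF h_int]
        by (simp add: K_eq err_def inner_diff_left right_diff_distrib)
    qed
    then show "expectation (\<lambda>\<omega>. (s \<omega> \<bullet> b) * (err i r t \<omega> \<bullet> b)) = 0" by (simp only: K_eq)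
  qed
  have "expectation (\<lambda>\<omega>. s \<omega> \<bullet> err i r t \<omega>) = expectation (\<lambda>\<omega>. \<Sum>b\<in>Basis. (s \<omega> \<bullet> b) * (err i r t \<omega> \<bullet> b))"
    by (intro Bochner_Integration.integral_cong refl euclidean_inner)
  also have "\<dots> = (\<Sum>b\<in>Basis. expectation (\<lambda>\<omega>. (s \<omega> \<bullet> b) * (err i r t \<omega> \<bullet> b)))"
    by (intro Bochner_Integration.integral_sum comp_int)
  finally show ?thesis by (simp add: comp)
qed

end

section \<open>Expected recursions\<close>

text \<open>Each new term is orthogonal to the sum so far, so second moments add up. The index is a
  local step in some uses and a node in another.\<close>

lemma (in prob_space) second_moment_sum_le:
  fixes w :: "nat \<Rightarrow> 'a \<Rightarrow> 'b::euclidean_space"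
  assumes "\<And>t. t < n \<Longrightarrow> sq_integrable M (w t)"
    and "\<And>t. t < n \<Longrightarrow> expectation (\<lambda>\<omega>. (\<Sum>s<t. w s \<omega>) \<bullet> w t \<omega>) = 0"
    and "\<And>t. t < n \<Longrightarrow> expectation (\<lambda>\<omega>. (norm (w t \<omega>))\<^sup>2) \<le> c"
  shows "expectation (\<lambda>\<omega>. (norm (\<Sum>s<n. w s \<omega>))\<^sup>2) \<le> real n * c"
  using assms
proof (induction n)
  case (Suc n)
  have sq: "sq_integrable M (\<lambda>\<omega>. \<Sum>s<n. w s \<omega>)" "sq_integrable M (w n)"
    using Suc.prems(1) by (auto intro!: sq_integrable_sum)
  note [simp] = sq_integrable_norm2[OF sq(1)] sq_integrable_norm2[OF sq(2)] sq_integrable_inner[OF sq]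
  have "(norm (\<Sum>s<Suc n. w s \<omega>))\<^sup>2 =
      (norm (\<Sum>s<n. w s \<omega>))\<^sup>2 + 2 * ((\<Sum>s<n. w s \<omega>) \<bullet> w n \<omega>) + (norm (w n \<omega>))\<^sup>2" for \<omega>
    by (simp add: power2_norm_eq_inner inner_add_left inner_add_right inner_commute)
  then have "expectation (\<lambda>\<omega>. (norm (\<Sum>s<Suc n. w s \<omega>))\<^sup>2) =
      expectation (\<lambda>\<omega>. (norm (\<Sum>s<n. w s \<omega>))\<^sup>2) + 2 * expectation (\<lambda>\<omega>. (\<Sum>s<n. w s \<omega>) \<bullet> w n \<omega>)
      + expectation (\<lambda>\<omega>. (norm (w n \<omega>))\<^sup>2)"
    by simp
  moreover have "expectation (\<lambda>\<omega>. (norm (\<Sum>s<n. w s \<omega>))\<^sup>2) \<le> real n * c"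
    using Suc by simp
  ultimately show ?case using Suc.prems(2,3)[of n] by (simp add: algebra_simps)
qed (simp add: prob_space)

section \<open>Integrability of the quadratic quantities\<close>

lemma integrable_ip:
  assumes "\<And>i. i < N \<Longrightarrow> sq_integrable M (\<lambda>\<omega>. u \<omega> i)" "\<And>i. i < N \<Longrightarrow> sq_integrable M (\<lambda>\<omega>. v \<omega> i)"
  shows "integrable M (\<lambda>\<omega>. ip N (u \<omega>) (v \<omega>))"
  unfolding ip_def by (intro Bochner_Integration.integrable_sum sq_integrable_inner assms) auto

lemma sq_integrable_dev:
  assumes "\<And>i. i < N \<Longrightarrow> sq_integrable M (\<lambda>\<omega>. u \<omega> i)" "i < N"
  shows "sq_integrable M (\<lambda>\<omega>. dev N (u \<omega>) i)"
  unfolding dev_def by (intro sq_integrable_diff sq_integrable_avg assms)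

context network
begin

lemma sq_integrable_T:
  assumes "\<And>i. i < N \<Longrightarrow> sq_integrable M (\<lambda>\<omega>. u \<omega> i)"
  shows "sq_integrable M (\<lambda>\<omega>. T (u \<omega>) i)"
  unfolding T_def by (intro sq_integrable_sum sq_integrable_scale assms) simp

lemma sq_integrable_S:
  assumes "\<And>i. i < N \<Longrightarrow> sq_integrable M (\<lambda>\<omega>. u \<omega> i)"
  shows "sq_integrable M (\<lambda>\<omega>. S (u \<omega>) i)"
  unfolding S_def by (intro sq_integrable_sum sq_integrable_scale assms) simp

lemma integrable_energy:
  assumes "\<And>i. i < N \<Longrightarrow> sq_integrable M (\<lambda>\<omega>. u \<omega> i)" "\<And>i. i < N \<Longrightarrow> sq_integrable M (\<lambda>\<omega>. v \<omega> i)"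
  shows "integrable M (\<lambda>\<omega>. energy (u \<omega>) (v \<omega>))"
  unfolding energy_def
  by (intro Bochner_Integration.integrable_add Bochner_Integration.integrable_diff integrable_ip
      sq_integrable_T assms)

end

section \<open>Random versions of the round inequalities and moments of the noise\<close>

context led_process
begin

definition xbar :: "nat \<Rightarrow> 'w \<Rightarrow> 'a" where "xbar r \<omega> = avg N (\<lambda>i. x i r \<omega>)"
definition X :: "nat \<Rightarrow> 'w \<Rightarrow> nat \<Rightarrow> 'a" where "X r \<omega> = dev N (\<lambda>i. x i r \<omega>)"
definition Z :: "nat \<Rightarrow> 'w \<Rightarrow> nat \<Rightarrow> 'a" where
  "Z r \<omega> = dual N h (\<alpha> * real \<tau>) (\<lambda>i. x i r \<omega>) (\<lambda>i. y i r \<omega>)"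
definition err_sum :: "nat \<Rightarrow> 'w \<Rightarrow> nat \<Rightarrow> 'a" where "err_sum r \<omega> i = (\<Sum>t<\<tau>. err i r t \<omega>)"
definition gbar :: "nat \<Rightarrow> nat \<Rightarrow> 'w \<Rightarrow> 'a" where "gbar r t \<omega> = avg N (\<lambda>i. h i (\<phi> i r t \<omega>))"
definition Drift :: "nat \<Rightarrow> 'w \<Rightarrow> real" where "Drift r \<omega> = drift N \<tau> (\<lambda>i. x i r \<omega>) (\<lambda>i t. \<phi> i r t \<omega>)"
definition Lyap :: "nat \<Rightarrow> 'w \<Rightarrow> real" where "Lyap r \<omega> = energy (X r \<omega>) (S (Z r \<omega>))"
definition move2 :: "nat \<Rightarrow> 'w \<Rightarrow> real" where "move2 r \<omega> = (norm (xbar (Suc r) \<omega> - xbar r \<omega>))\<^sup>2"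

lemma noise_eq: "noise h (\<lambda>i t. \<phi> i r t \<omega>) (\<lambda>i t. g i r t \<omega>) i t = err i r t \<omega>"
  by (simp add: noise_def err_def)

lemma pointwise_round:
  assumes "\<omega> \<in> space M"
  shows "Lyap (Suc r) \<omega> \<le>
    (1 + (1 - lam) / 2) * (lam * Lyap r \<omega> - 2 * \<alpha> * ip N (X r \<omega>) (T (err_sum r \<omega>)) + \<alpha>\<^sup>2 * ip N (err_sum r \<omega>) (err_sum r \<omega>)) +
    3 / (1 - lam) * (2 * \<alpha>\<^sup>2 * (real \<tau> * L\<^sup>2 * Drift r \<omega>) +
      2 * (\<alpha> * real \<tau>)\<^sup>2 * (real N * L\<^sup>2 * move2 r \<omega>) / (1 - lam))"
    and "ip N (Z (Suc r) \<omega>) (Z (Suc r) \<omega>) \<le>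
    8 * Lyap r \<omega> + 8 * \<alpha>\<^sup>2 * (real \<tau> * L\<^sup>2 * Drift r \<omega>) + 8 * \<alpha>\<^sup>2 * ip N (err_sum r \<omega>) (err_sum r \<omega>) +
    4 * (\<alpha> * real \<tau>)\<^sup>2 * (real N * L\<^sup>2 * move2 r \<omega>)"
    and "Drift r \<omega> \<le> 10 * real \<tau> * (ip N (X r \<omega>) (X r \<omega>) + ip N (Z r \<omega>) (Z r \<omega>)
      + (\<alpha> * real \<tau>)\<^sup>2 * (real N * (norm (mean_grad N h (xbar r \<omega>)))\<^sup>2))
    + 10 * \<alpha>\<^sup>2 * (\<Sum>t<\<tau>. \<Sum>i<N. (norm (\<Sum>s<t. err i r s \<omega>))\<^sup>2)"
    and "move2 r \<omega> \<le> 2 * \<alpha>\<^sup>2 * (real \<tau> * (\<Sum>t<\<tau>. (norm (gbar r t \<omega>))\<^sup>2) + (norm (avg N (err_sum r \<omega>)))\<^sup>2)"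
    and "mean_cost N f (xbar (Suc r) \<omega>) \<le> mean_cost N f (xbar r \<omega>)
      - \<alpha> * real \<tau> / 2 * (norm (mean_grad N h (xbar r \<omega>)))\<^sup>2 - \<alpha> / 4 * (\<Sum>t<\<tau>. (norm (gbar r t \<omega>))\<^sup>2)
    + \<alpha> * L\<^sup>2 / (2 * real N) * Drift r \<omega> + L * \<alpha>\<^sup>2 * (norm (avg N (err_sum r \<omega>)))\<^sup>2
    - \<alpha> * (mean_grad N h (xbar r \<omega>) \<bullet> avg N (err_sum r \<omega>))"
proof -
  interpret R: led_round N nbr W lam \<tau> \<alpha> L h "\<lambda>i. x i r \<omega>" "\<lambda>i. y i r \<omega>"
    "\<lambda>i. x i (Suc r) \<omega>" "\<lambda>i. y i (Suc r) \<omega>" "\<lambda>i t. \<phi> i r t \<omega>" "\<lambda>i t. g i r t \<omega>"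
    by (rule round_locale[OF assms])
  have es: "(\<lambda>i. \<Sum>t<\<tau>. err i r t \<omega>) = err_sum r \<omega>" by (simp add: err_sum_def fun_eq_iff)
  note folds = es xbar_def[symmetric] X_def[symmetric] Z_def[symmetric] gbar_def[symmetric] Drift_def[symmetric]
    Lyap_def[symmetric] move2_def[symmetric]
  show "Lyap (Suc r) \<omega> \<le>
    (1 + (1 - lam) / 2) * (lam * Lyap r \<omega> - 2 * \<alpha> * ip N (X r \<omega>) (T (err_sum r \<omega>)) + \<alpha>\<^sup>2 * ip N (err_sum r \<omega>) (err_sum r \<omega>)) +
    3 / (1 - lam) * (2 * \<alpha>\<^sup>2 * (real \<tau> * L\<^sup>2 * Drift r \<omega>) +
      2 * (\<alpha> * real \<tau>)\<^sup>2 * (real N * L\<^sup>2 * move2 r \<omega>) / (1 - lam))"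
    using R.energy_round unfolding noise_eq folds .
  show "ip N (Z (Suc r) \<omega>) (Z (Suc r) \<omega>) \<le>
    8 * Lyap r \<omega> + 8 * \<alpha>\<^sup>2 * (real \<tau> * L\<^sup>2 * Drift r \<omega>) + 8 * \<alpha>\<^sup>2 * ip N (err_sum r \<omega>) (err_sum r \<omega>) +
    4 * (\<alpha> * real \<tau>)\<^sup>2 * (real N * L\<^sup>2 * move2 r \<omega>)"
    using R.dual_round unfolding noise_eq folds .
  show "Drift r \<omega> \<le> 10 * real \<tau> * (ip N (X r \<omega>) (X r \<omega>) + ip N (Z r \<omega>) (Z r \<omega>)
      + (\<alpha> * real \<tau>)\<^sup>2 * (real N * (norm (mean_grad N h (xbar r \<omega>)))\<^sup>2))
    + 10 * \<alpha>\<^sup>2 * (\<Sum>t<\<tau>. \<Sum>i<N. (norm (\<Sum>s<t. err i r s \<omega>))\<^sup>2)"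
    using R.drift_le unfolding noise_eq folds .
  show "move2 r \<omega> \<le> 2 * \<alpha>\<^sup>2 * (real \<tau> * (\<Sum>t<\<tau>. (norm (gbar r t \<omega>))\<^sup>2) + (norm (avg N (err_sum r \<omega>)))\<^sup>2)"
    using R.move_le unfolding noise_eq folds .
  show "mean_cost N f (xbar (Suc r) \<omega>) \<le> mean_cost N f (xbar r \<omega>)
      - \<alpha> * real \<tau> / 2 * (norm (mean_grad N h (xbar r \<omega>)))\<^sup>2 - \<alpha> / 4 * (\<Sum>t<\<tau>. (norm (gbar r t \<omega>))\<^sup>2)
    + \<alpha> * L\<^sup>2 / (2 * real N) * Drift r \<omega> + L * \<alpha>\<^sup>2 * (norm (avg N (err_sum r \<omega>)))\<^sup>2
    - \<alpha> * (mean_grad N h (xbar r \<omega>) \<bullet> avg N (err_sum r \<omega>))"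
    using R.descent_round[OF GDERIV_mean] unfolding noise_eq folds .
qed

lemma xbar_sq: "sq_integrable M (xbar r)"
  unfolding xbar_def[abs_def] by (intro sq_integrable_avg state_sq_integrable)

lemma X_sq: "i < N \<Longrightarrow> sq_integrable M (\<lambda>\<omega>. X r \<omega> i)"
  unfolding X_def by (intro sq_integrable_dev state_sq_integrable)

lemma h_xbar_sq: "i < N \<Longrightarrow> sq_integrable M (\<lambda>\<omega>. h i (xbar r \<omega>))"
  by (rule sq_integrable_lipschitz[OF xbar_sq h_lip h_measurable])

lemma mean_grad_sq: "sq_integrable M (\<lambda>\<omega>. mean_grad N h (xbar r \<omega>))"
  unfolding mean_grad_def by (intro sq_integrable_avg h_xbar_sq)

lemma Z_sq: "i < N \<Longrightarrow> sq_integrable M (\<lambda>\<omega>. Z r \<omega> i)"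
  unfolding Z_def dual_def hetero_def xbar_def[symmetric]
  by (intro sq_integrable_add sq_integrable_scale sq_integrable_dev h_xbar_sq state_sq_integrable)

lemma err_sq: "i < N \<Longrightarrow> t < \<tau> \<Longrightarrow> sq_integrable M (err i r t)"
  by (rule err_second_moment)

lemma err_sum_sq: "i < N \<Longrightarrow> sq_integrable M (\<lambda>\<omega>. err_sum r \<omega> i)"
  unfolding err_sum_def by (intro sq_integrable_sum err_sq) auto

lemma avg_err_sum_sq: "sq_integrable M (\<lambda>\<omega>. avg N (err_sum r \<omega>))"
  using sq_integrable_avg[of N M "\<lambda>i \<omega>. err_sum r \<omega> i"] err_sum_sq by simp

lemma gbar_sq: "t < \<tau> \<Longrightarrow> sq_integrable M (gbar r t)"
  unfolding gbar_def[abs_def] by (intro sq_integrable_avg grad_sq_integrable) auto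

lemma Lyap_integrable: "integrable M (Lyap r)"
  unfolding Lyap_def[abs_def] by (intro integrable_energy sq_integrable_S X_sq Z_sq)

lemma Drift_integrable: "integrable M (Drift r)"
  unfolding Drift_def[abs_def] drift_def xbar_def[symmetric]
  by (intro Bochner_Integration.integrable_sum sq_integrable_norm2 sq_integrable_diff state_sq_integrable xbar_sq) auto

lemma move2_integrable: "integrable M (move2 r)"
  unfolding move2_def[abs_def] by (intro sq_integrable_norm2 sq_integrable_diff xbar_sq)

lemma optimum_le: "opt_value N f \<le> mean_cost N f z"
  unfolding opt_value_def using smooth by (intro cINF_lower) (auto simp: smoothness_assumption_def)

lemma mean_grad_lip: "norm (mean_grad N h a - mean_grad N h b) \<le> L * norm (a - b)"
proof -
  have "norm (mean_grad N h a - mean_grad N h b) = (1 / real N) * norm (\<Sum>i<N. h i a - h i b)"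
    by (simp add: mean_grad_def avg_def scaleR_diff_right[symmetric] sum_subtractf)
  also have "\<dots> \<le> (1 / real N) * (\<Sum>i<N. L * norm (a - b))"
    by (intro mult_left_mono sum_norm_le h_lip) auto
  finally show ?thesis using N_pos by simp
qed

text \<open>The cost lies between its infimum and the quadratic model at 0 from the descent
  inequality, and both are integrable along the mean iterate.\<close>

lemma cost_integrable: "integrable M (\<lambda>\<omega>. mean_cost N f (xbar r \<omega>))"
proof (rule Bochner_Integration.integrable_bound)
  let ?u = "\<lambda>\<omega>. mean_cost N f 0 + mean_grad N h 0 \<bullet> xbar r \<omega> + L / 2 * (norm (xbar r \<omega>))\<^sup>2"
  show "integrable M (\<lambda>\<omega>. \<bar>?u \<omega>\<bar> + \<bar>opt_value N f\<bar>)"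
    using sq_integrable_norm2[OF xbar_sq] sq_integrable_inner[OF sq_integrable_const xbar_sq] by simp
  have "continuous_on UNIV (mean_cost N f)"
    using GDERIV_mean by (intro differentiable_imp_continuous_on)
      (auto simp: differentiable_on_def differentiable_def gderiv_def intro: has_derivative_at_withinI)
  then show "(\<lambda>\<omega>. mean_cost N f (xbar r \<omega>)) \<in> borel_measurable M"
    using borel_measurable_continuous_onI measurable_compose[OF sq_integrable_measurable[OF xbar_sq]] by blast
  show "AE \<omega> in M. norm (mean_cost N f (xbar r \<omega>)) \<le> norm (\<bar>?u \<omega>\<bar> + \<bar>opt_value N f\<bar>)"
  proof (rule AE_I2)
    fix \<omega>
    show "norm (mean_cost N f (xbar r \<omega>)) \<le> norm (\<bar>?u \<omega>\<bar> + \<bar>opt_value N f\<bar>)"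
      using optimum_le[of "xbar r \<omega>"] descent_lemma[OF GDERIV_mean mean_grad_lip, of 0 "xbar r \<omega>"] by simp
  qed
qed

lemma err_partial_sum_moment:
  assumes "i < N" "t \<le> \<tau>"
  shows "expectation (\<lambda>\<omega>. (norm (\<Sum>s<t. err i r s \<omega>))\<^sup>2) \<le> real t * \<sigma>\<^sup>2"
proof (rule second_moment_sum_le)
  fix s assume s: "s < t"
  show "sq_integrable M (err i r s)" "expectation (\<lambda>\<omega>. (norm (err i r s \<omega>))\<^sup>2) \<le> \<sigma>\<^sup>2"
    using assms s by (intro err_second_moment; simp)+
  show "expectation (\<lambda>\<omega>. (\<Sum>q<s. err i r q \<omega>) \<bullet> err i r s \<omega>) = 0"
    using assms s
    by (intro err_orthogonal borel_measurable_sum err_others sq_integrable_sum err_sq) auto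
qed

text \<open>Nodes are added one at a time, each orthogonal to those before it in the same step. N
  orthogonal terms divided by N^2 give the gain 1/N.\<close>

lemma avg_err_moment:
  assumes "t < \<tau>"
  shows "expectation (\<lambda>\<omega>. (norm (avg N (\<lambda>i. err i r t \<omega>)))\<^sup>2) \<le> \<sigma>\<^sup>2 / real N"
proof -
  have "expectation (\<lambda>\<omega>. (norm (\<Sum>i<N. err i r t \<omega>))\<^sup>2) \<le> real N * \<sigma>\<^sup>2"
  proof (rule second_moment_sum_le)
    fix i assume i: "i < N"
    show "sq_integrable M (err i r t)" "expectation (\<lambda>\<omega>. (norm (err i r t \<omega>))\<^sup>2) \<le> \<sigma>\<^sup>2"
      using assms i by (intro err_second_moment; simp)+
    show "expectation (\<lambda>\<omega>. (\<Sum>j<i. err j r t \<omega>) \<bullet> err i r t \<omega>) = 0"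
      using assms i
      by (intro err_orthogonal borel_measurable_sum err_others sq_integrable_sum err_sq) auto
  qed
  then show ?thesis using N_pos
    by (simp add: avg_def power_divide field_simps power2_eq_square)
qed

lemma avg_err_sum_moment: "expectation (\<lambda>\<omega>. (norm (avg N (err_sum r \<omega>)))\<^sup>2) \<le> real \<tau> * (\<sigma>\<^sup>2 / real N)"
proof -
  have "avg N (err_sum r \<omega>) = (\<Sum>t<\<tau>. avg N (\<lambda>i. err i r t \<omega>))" for \<omega>
    unfolding err_sum_def[abs_def] by (rule avg_sum)
  moreover have "expectation (\<lambda>\<omega>. (norm (\<Sum>t<\<tau>. avg N (\<lambda>i. err i r t \<omega>)))\<^sup>2) \<le> real \<tau> * (\<sigma>\<^sup>2 / real N)"
  proof (rule second_moment_sum_le)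
    fix t assume t: "t < \<tau>"
    show "sq_integrable M (\<lambda>\<omega>. avg N (\<lambda>i. err i r t \<omega>))"
      using t by (intro sq_integrable_avg err_sq)
    show "expectation (\<lambda>\<omega>. (norm (avg N (\<lambda>i. err i r t \<omega>)))\<^sup>2) \<le> \<sigma>\<^sup>2 / real N"
      by (rule avg_err_moment[OF t])
    let ?S = "\<lambda>\<omega>. \<Sum>s<t. avg N (\<lambda>i. err i r s \<omega>)"
    have S_sq: "sq_integrable M ?S" using t by (intro sq_integrable_sum sq_integrable_avg err_sq) auto
    have S_meas: "?S \<in> borel_measurable (others (i, r, t))" if "i < N" for i
      unfolding avg_def using that t
      by (intro borel_measurable_sum borel_measurable_scaleR borel_measurable_const err_others) auto
    have "expectation (\<lambda>\<omega>. ?S \<omega> \<bullet> avg N (\<lambda>i. err i r t \<omega>)) =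
        expectation (\<lambda>\<omega>. (1 / real N) * (\<Sum>i<N. ?S \<omega> \<bullet> err i r t \<omega>))"
      by (simp add: avg_def inner_sum_right)
    also have "\<dots> = (1 / real N) * (\<Sum>i<N. expectation (\<lambda>\<omega>. ?S \<omega> \<bullet> err i r t \<omega>))"
      using t by (subst integral_mult_right_zero, subst Bochner_Integration.integral_sum)
        (auto intro!: sq_integrable_inner S_sq err_sq)
    also have "\<dots> = 0" using t S_meas S_sq by (simp add: err_orthogonal)
    finally show "expectation (\<lambda>\<omega>. ?S \<omega> \<bullet> avg N (\<lambda>i. err i r t \<omega>)) = 0" .
  qed
  ultimately show ?thesis by simp
qed

lemma err_sum_moment: "expectation (\<lambda>\<omega>. ip N (err_sum r \<omega>) (err_sum r \<omega>)) \<le> real N * (real \<tau> * \<sigma>\<^sup>2)"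
proof -
  have "expectation (\<lambda>\<omega>. ip N (err_sum r \<omega>) (err_sum r \<omega>)) = (\<Sum>i<N. expectation (\<lambda>\<omega>. (norm (err_sum r \<omega> i))\<^sup>2))"
    unfolding ip_self by (intro Bochner_Integration.integral_sum sq_integrable_norm2 err_sum_sq) simp
  also have "\<dots> \<le> (\<Sum>i<N. real \<tau> * \<sigma>\<^sup>2)"
    unfolding err_sum_def by (intro sum_mono err_partial_sum_moment) auto
  finally show ?thesis by simp
qed

lemma err_sum_orthogonal:
  assumes "\<And>i j t. i < N \<Longrightarrow> j < N \<Longrightarrow> t < \<tau> \<Longrightarrow> (\<lambda>\<omega>. s \<omega> i) \<in> borel_measurable (others (j, r, t))"
    and "\<And>i. i < N \<Longrightarrow> sq_integrable M (\<lambda>\<omega>. s \<omega> i)"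
  shows "expectation (\<lambda>\<omega>. ip N (s \<omega>) (err_sum r \<omega>)) = 0"
proof -
  have "expectation (\<lambda>\<omega>. ip N (s \<omega>) (err_sum r \<omega>)) = expectation (\<lambda>\<omega>. \<Sum>i<N. \<Sum>t<\<tau>. s \<omega> i \<bullet> err i r t \<omega>)"
    by (simp add: ip_def err_sum_def inner_sum_right)
  also have "\<dots> = (\<Sum>i<N. \<Sum>t<\<tau>. expectation (\<lambda>\<omega>. s \<omega> i \<bullet> err i r t \<omega>))"
    by (subst Bochner_Integration.integral_sum, (intro Bochner_Integration.integrable_sum sq_integrable_inner assms err_sq; simp),
        intro sum.cong refl Bochner_Integration.integral_sum sq_integrable_inner assms err_sq) auto
  also have "\<dots> = 0"
    by (intro sum.neutral ballI err_orthogonal assms) auto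
  finally show ?thesis .
qed

lemma xbar_others: "i < N \<Longrightarrow> t < \<tau> \<Longrightarrow> xbar r \<in> borel_measurable (others (i, r, t))"
  unfolding xbar_def[abs_def] avg_def
  by (intro borel_measurable_sum borel_measurable_scaleR borel_measurable_const state_others) auto

lemma X_others: "i < N \<Longrightarrow> t < \<tau> \<Longrightarrow> j < N \<Longrightarrow> (\<lambda>\<omega>. X r \<omega> j) \<in> borel_measurable (others (i, r, t))"
  unfolding X_def dev_def xbar_def[symmetric]
  by (intro borel_measurable_diff state_others xbar_others)

text \<open>The state at the start of a round is a function of data from earlier rounds, hence
  measurable for \<open>others\<close> at each index of the current round.\<close>

lemma cross_X: "expectation (\<lambda>\<omega>. ip N (X r \<omega>) (T (err_sum r \<omega>))) = 0"
  unfolding T_selfadj[symmetric]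
proof (rule err_sum_orthogonal)
  show "(\<lambda>\<omega>. T (X r \<omega>) i) \<in> borel_measurable (others (j, r, t))" if "i < N" "j < N" "t < \<tau>" for i j t
    unfolding T_def using that
    by (intro borel_measurable_sum borel_measurable_scaleR borel_measurable_const X_others) auto
qed (intro sq_integrable_T X_sq)

lemma cross_grad: "expectation (\<lambda>\<omega>. mean_grad N h (xbar r \<omega>) \<bullet> avg N (err_sum r \<omega>)) = 0"
proof -
  have "real N * (mean_grad N h (xbar r \<omega>) \<bullet> avg N (err_sum r \<omega>)) =
      ip N (\<lambda>i. mean_grad N h (xbar r \<omega>)) (err_sum r \<omega>)" for \<omega>
    by (simp add: ip_const[OF N_pos])
  moreover have "expectation (\<lambda>\<omega>. ip N (\<lambda>i. mean_grad N h (xbar r \<omega>)) (err_sum r \<omega>)) = 0"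
  proof (rule err_sum_orthogonal)
    show "(\<lambda>\<omega>. mean_grad N h (xbar r \<omega>)) \<in> borel_measurable (others (j, r, t))" if "j < N" "t < \<tau>" for j t
      unfolding mean_grad_def avg_def using that
      by (intro borel_measurable_sum borel_measurable_scaleR borel_measurable_const
          measurable_compose[OF xbar_others h_measurable]) auto
  qed (rule mean_grad_sq)
  ultimately have "expectation (\<lambda>\<omega>. real N * (mean_grad N h (xbar r \<omega>) \<bullet> avg N (err_sum r \<omega>))) = 0" by simp
  then show ?thesis using N_pos by simp
qed

end

section \<open>Normalised expectations and their recursions\<close>

context led_process
begin

lemma ip_integrable:
  "integrable M (\<lambda>\<omega>. ip N (X r \<omega>) (X r \<omega>))" "integrable M (\<lambda>\<omega>. ip N (Z r \<omega>) (Z r \<omega>))"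
  "integrable M (\<lambda>\<omega>. ip N (err_sum r \<omega>) (err_sum r \<omega>))"
  "integrable M (\<lambda>\<omega>. ip N (X r \<omega>) (T (err_sum r \<omega>)))"
  by (intro integrable_ip sq_integrable_T X_sq Z_sq err_sum_sq; assumption)+

text \<open>Normalising per node, and the drift also per local step, leaves \<alpha> \<tau> and the
  noise levels as the only places where \<alpha>, \<tau> and N enter the recursions.\<close>

definition v_seq :: "nat \<Rightarrow> real" where "v_seq r = expectation (Lyap r) / real N"
definition z_seq :: "nat \<Rightarrow> real" where "z_seq r = expectation (\<lambda>\<omega>. ip N (Z r \<omega>) (Z r \<omega>)) / real N"
definition drift_seq :: "nat \<Rightarrow> real" where "drift_seq r = expectation (Drift r) / (real N * real \<tau>)"
definition move_seq :: "nat \<Rightarrow> real" where "move_seq r = L\<^sup>2 * expectation (move2 r)"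
definition grad_seq :: "nat \<Rightarrow> real" where
  "grad_seq r = expectation (\<lambda>\<omega>. (norm (mean_grad N h (xbar r \<omega>)))\<^sup>2)"
definition step_seq :: "nat \<Rightarrow> real" where
  "step_seq r = (1 / real \<tau>) * (\<Sum>t<\<tau>. expectation (\<lambda>\<omega>. (norm (gbar r t \<omega>))\<^sup>2))"
definition gap_seq :: "nat \<Rightarrow> real" where
  "gap_seq r = expectation (\<lambda>\<omega>. mean_cost N f (xbar r \<omega>)) - opt_value N f"

lemma seq_nonneg:
  "0 \<le> v_seq r" "0 \<le> z_seq r" "0 \<le> drift_seq r" "0 \<le> grad_seq r" "0 \<le> step_seq r" "0 \<le> move_seq r" "0 \<le> gap_seq r"
proof -
  show "0 \<le> v_seq r" unfolding v_seq_def by (simp add: Lyap_def energy_nonneg)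
  show "0 \<le> z_seq r" unfolding z_seq_def by simp
  show "0 \<le> drift_seq r" unfolding drift_seq_def
    by (intro divide_nonneg_nonneg Bochner_Integration.integral_nonneg) (auto simp: Drift_def drift_def sum_nonneg)
  show "0 \<le> grad_seq r" unfolding grad_seq_def by simp
  show "0 \<le> step_seq r" unfolding step_seq_def by (simp add: sum_nonneg)
  show "0 \<le> move_seq r" unfolding move_seq_def by (simp add: move2_def)
  have "expectation (\<lambda>\<omega>. opt_value N f) \<le> expectation (\<lambda>\<omega>. mean_cost N f (xbar r \<omega>))"
    by (intro integral_mono cost_integrable optimum_le) simp
  then show "0 \<le> gap_seq r" unfolding gap_seq_def by (simp add: prob_space)
qed

lemma v_step:
  "v_seq (Suc r) \<le> (1 - (1 - lam) / 2) * v_seq r + (3 / (1 - lam) * (2 * (\<alpha> * real \<tau>)\<^sup>2 * L\<^sup>2 * drift_seq r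
     + 2 * (\<alpha> * real \<tau>)\<^sup>2 * move_seq r / (1 - lam)) + 3 / 2 * (\<alpha>\<^sup>2 * real \<tau> * \<sigma>\<^sup>2))"
proof -
  note [simp] = ip_integrable Lyap_integrable Drift_integrable move2_integrable
  let ?n = "expectation (\<lambda>\<omega>. ip N (err_sum r \<omega>) (err_sum r \<omega>))"
  have "expectation (Lyap (Suc r)) \<le> expectation (\<lambda>\<omega>.
    (1 + (1 - lam) / 2) * (lam * Lyap r \<omega> - 2 * \<alpha> * ip N (X r \<omega>) (T (err_sum r \<omega>)) + \<alpha>\<^sup>2 * ip N (err_sum r \<omega>) (err_sum r \<omega>)) +
    3 / (1 - lam) * (2 * \<alpha>\<^sup>2 * (real \<tau> * L\<^sup>2 * Drift r \<omega>) +
      2 * (\<alpha> * real \<tau>)\<^sup>2 * (real N * L\<^sup>2 * move2 r \<omega>) / (1 - lam)))"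
    by (intro integral_mono pointwise_round(1)) simp_all
  also have "\<dots> = (1 + (1 - lam) / 2) * (lam * expectation (Lyap r) - 2 * \<alpha> * 0 + \<alpha>\<^sup>2 * ?n) +
    3 / (1 - lam) * (2 * \<alpha>\<^sup>2 * (real \<tau> * L\<^sup>2 * expectation (Drift r)) +
      2 * (\<alpha> * real \<tau>)\<^sup>2 * (real N * L\<^sup>2 * expectation (move2 r)) / (1 - lam))"
    \<comment> \<open>The literal 0 stands for the vanishing cross term; rewriting it backwards into
      that expectation turns the claim into linearity of the integral.\<close>
    unfolding cross_X[of r, symmetric] by simp
  finally have "v_seq (Suc r) \<le> ((1 + (1 - lam) / 2) * (lam * expectation (Lyap r) - 2 * \<alpha> * 0 + \<alpha>\<^sup>2 * ?n) +
    3 / (1 - lam) * (2 * \<alpha>\<^sup>2 * (real \<tau> * L\<^sup>2 * expectation (Drift r)) +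
      2 * (\<alpha> * real \<tau>)\<^sup>2 * (real N * L\<^sup>2 * expectation (move2 r)) / (1 - lam))) / real N"
    unfolding v_seq_def by (rule divide_right_mono) simp
  also have "\<dots> = (1 + (1 - lam) / 2) * lam * v_seq r + (1 + (1 - lam) / 2) * (\<alpha>\<^sup>2 * (?n / real N)) +
    3 / (1 - lam) * (2 * (\<alpha> * real \<tau>)\<^sup>2 * L\<^sup>2 * drift_seq r + 2 * (\<alpha> * real \<tau>)\<^sup>2 * move_seq r / (1 - lam))"
  proof -
    have "((1 + k / 2) * (lam * a - 2 * \<alpha> * 0 + \<alpha>\<^sup>2 * b) + 3 / k * (2 * \<alpha>\<^sup>2 * (real \<tau> * L\<^sup>2 * u) +
        2 * (\<alpha> * real \<tau>)\<^sup>2 * (real N * L\<^sup>2 * w) / k)) / real N =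
      (1 + k / 2) * lam * (a / real N) + (1 + k / 2) * (\<alpha>\<^sup>2 * (b / real N)) +
      3 / k * (2 * (\<alpha> * real \<tau>)\<^sup>2 * L\<^sup>2 * (u / (real N * real \<tau>)) + 2 * (\<alpha> * real \<tau>)\<^sup>2 * (L\<^sup>2 * w) / k)"
      if "0 < k" for k a b u w :: real
      using that N_pos tau_pos by (simp add: field_simps power2_eq_square)
    then show ?thesis using lam_less_1 unfolding v_seq_def drift_seq_def move_seq_def by simp
  qed
  \<comment> \<open>With e = 1 - lam one has (1 + e / 2) (1 - e) = 1 - e / 2 - e^2 / 2, so Young's
    inequality spends only half of the contraction.\<close>
  also have "(1 + (1 - lam) / 2) * lam * v_seq r \<le> (1 - (1 - lam) / 2) * v_seq r"
    using seq_nonneg(1)[of r] zero_le_power2[of "1 - lam"]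
    by (intro mult_right_mono) (simp_all add: field_simps power2_eq_square)
  also have "(1 + (1 - lam) / 2) * (\<alpha>\<^sup>2 * (?n / real N)) \<le> 3 / 2 * (\<alpha>\<^sup>2 * (real \<tau> * \<sigma>\<^sup>2))"
    using lam_nonneg lam_less_1 err_sum_moment[of r] N_pos
    by (intro mult_mono mult_left_mono) (auto simp: field_simps)
  finally show ?thesis by (simp add: algebra_simps)
qed

lemma z_step:
  "z_seq (Suc r) \<le> 8 * v_seq r + 8 * (\<alpha> * real \<tau>)\<^sup>2 * L\<^sup>2 * drift_seq r + 8 * (\<alpha>\<^sup>2 * real \<tau> * \<sigma>\<^sup>2)
     + 4 * (\<alpha> * real \<tau>)\<^sup>2 * move_seq r"
proof -
  note [simp] = ip_integrable Lyap_integrable Drift_integrable move2_integrable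
  let ?n = "expectation (\<lambda>\<omega>. ip N (err_sum r \<omega>) (err_sum r \<omega>))"
  have "expectation (\<lambda>\<omega>. ip N (Z (Suc r) \<omega>) (Z (Suc r) \<omega>)) \<le> expectation (\<lambda>\<omega>.
    8 * Lyap r \<omega> + 8 * \<alpha>\<^sup>2 * (real \<tau> * L\<^sup>2 * Drift r \<omega>) + 8 * \<alpha>\<^sup>2 * ip N (err_sum r \<omega>) (err_sum r \<omega>) +
    4 * (\<alpha> * real \<tau>)\<^sup>2 * (real N * L\<^sup>2 * move2 r \<omega>))"
    by (intro integral_mono pointwise_round(2)) simp_all
  also have "\<dots> = 8 * expectation (Lyap r) + 8 * \<alpha>\<^sup>2 * (real \<tau> * L\<^sup>2 * expectation (Drift r)) + 8 * \<alpha>\<^sup>2 * ?n +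
    4 * (\<alpha> * real \<tau>)\<^sup>2 * (real N * L\<^sup>2 * expectation (move2 r))"
    by simp
  finally have "z_seq (Suc r) \<le> (8 * expectation (Lyap r) + 8 * \<alpha>\<^sup>2 * (real \<tau> * L\<^sup>2 * expectation (Drift r)) + 8 * \<alpha>\<^sup>2 * ?n +
    4 * (\<alpha> * real \<tau>)\<^sup>2 * (real N * L\<^sup>2 * expectation (move2 r))) / real N"
    unfolding z_seq_def by (rule divide_right_mono) simp
  also have "\<dots> = 8 * v_seq r + 8 * (\<alpha> * real \<tau>)\<^sup>2 * L\<^sup>2 * drift_seq r + 8 * (\<alpha>\<^sup>2 * (?n / real N))
     + 4 * (\<alpha> * real \<tau>)\<^sup>2 * move_seq r"
    using N_pos tau_pos unfolding v_seq_def drift_seq_def move_seq_def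
    by (simp add: field_simps power2_eq_square)
  also have "\<alpha>\<^sup>2 * (?n / real N) \<le> \<alpha>\<^sup>2 * (real \<tau> * \<sigma>\<^sup>2)"
    using err_sum_moment[of r] N_pos by (intro mult_left_mono) (auto simp: field_simps)
  finally show ?thesis by (simp add: algebra_simps)
qed

lemma drift_bound:
  "drift_seq r \<le> 10 * (v_seq r + z_seq r + (\<alpha> * real \<tau>)\<^sup>2 * grad_seq r + \<alpha>\<^sup>2 * real \<tau> * \<sigma>\<^sup>2)"
proof -
  have sq: "integrable M (\<lambda>\<omega>. (norm (\<Sum>s<t. err i r s \<omega>))\<^sup>2)" if "i < N" "t < \<tau>" for i t
    using that by (intro sq_integrable_norm2 sq_integrable_sum err_sq) auto
  let ?E = "\<lambda>\<omega>. \<Sum>t<\<tau>. \<Sum>i<N. (norm (\<Sum>s<t. err i r s \<omega>))\<^sup>2"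
  have E_int: "integrable M ?E" by (intro Bochner_Integration.integrable_sum sq) auto
  note [simp] = ip_integrable Lyap_integrable Drift_integrable E_int sq_integrable_norm2[OF mean_grad_sq]
  have E_le: "expectation ?E \<le> real \<tau> * (real N * (real \<tau> * \<sigma>\<^sup>2))"
  proof -
    have "expectation ?E = (\<Sum>t<\<tau>. expectation (\<lambda>\<omega>. \<Sum>i<N. (norm (\<Sum>s<t. err i r s \<omega>))\<^sup>2))"
      by (intro Bochner_Integration.integral_sum Bochner_Integration.integrable_sum sq) auto
    also have "\<dots> = (\<Sum>t<\<tau>. \<Sum>i<N. expectation (\<lambda>\<omega>. (norm (\<Sum>s<t. err i r s \<omega>))\<^sup>2))"
      by (intro sum.cong refl Bochner_Integration.integral_sum sq) auto
    also have "\<dots> \<le> (\<Sum>t<\<tau>. \<Sum>i<N. real \<tau> * \<sigma>\<^sup>2)"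
    proof (intro sum_mono)
      fix t i assume "t \<in> {..<\<tau>}" "i \<in> {..<N}"
      then have "expectation (\<lambda>\<omega>. (norm (\<Sum>s<t. err i r s \<omega>))\<^sup>2) \<le> real t * \<sigma>\<^sup>2"
        by (intro err_partial_sum_moment) auto
      also have "\<dots> \<le> real \<tau> * \<sigma>\<^sup>2" using \<open>t \<in> {..<\<tau>}\<close> by (intro mult_right_mono) auto
      finally show "expectation (\<lambda>\<omega>. (norm (\<Sum>s<t. err i r s \<omega>))\<^sup>2) \<le> real \<tau> * \<sigma>\<^sup>2" .
    qed
    finally show ?thesis by simp
  qed
  have "Drift r \<omega> \<le> 10 * real \<tau> * (Lyap r \<omega> + ip N (Z r \<omega>) (Z r \<omega>)
      + (\<alpha> * real \<tau>)\<^sup>2 * (real N * (norm (mean_grad N h (xbar r \<omega>)))\<^sup>2)) + 10 * \<alpha>\<^sup>2 * ?E \<omega>" if "\<omega> \<in> space M" for \<omega>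
  proof -
    have "10 * real \<tau> * ip N (X r \<omega>) (X r \<omega>) \<le> 10 * real \<tau> * Lyap r \<omega>"
      unfolding Lyap_def by (intro mult_left_mono energy_ge) simp
    with pointwise_round(3)[OF that, of r] show ?thesis by (simp only: distrib_left)
  qed
  then have "expectation (Drift r) \<le> expectation (\<lambda>\<omega>. 10 * real \<tau> * (Lyap r \<omega> + ip N (Z r \<omega>) (Z r \<omega>)
      + (\<alpha> * real \<tau>)\<^sup>2 * (real N * (norm (mean_grad N h (xbar r \<omega>)))\<^sup>2)) + 10 * \<alpha>\<^sup>2 * ?E \<omega>)"
    by (intro integral_mono) simp_all
  also have "\<dots> = 10 * real \<tau> * (expectation (Lyap r) + expectation (\<lambda>\<omega>. ip N (Z r \<omega>) (Z r \<omega>))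
      + (\<alpha> * real \<tau>)\<^sup>2 * (real N * grad_seq r)) + 10 * \<alpha>\<^sup>2 * expectation ?E"
    unfolding grad_seq_def by simp
  also have "10 * \<alpha>\<^sup>2 * expectation ?E \<le> 10 * \<alpha>\<^sup>2 * (real \<tau> * (real N * (real \<tau> * \<sigma>\<^sup>2)))"
    by (intro mult_left_mono E_le) simp
  finally have "drift_seq r \<le> (10 * real \<tau> * (expectation (Lyap r) + expectation (\<lambda>\<omega>. ip N (Z r \<omega>) (Z r \<omega>))
      + (\<alpha> * real \<tau>)\<^sup>2 * (real N * grad_seq r)) + 10 * \<alpha>\<^sup>2 * (real \<tau> * (real N * (real \<tau> * \<sigma>\<^sup>2)))) / (real N * real \<tau>)"
    unfolding drift_seq_def by (intro divide_right_mono) auto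
  also have "\<dots> = 10 * (v_seq r + z_seq r + (\<alpha> * real \<tau>)\<^sup>2 * grad_seq r + \<alpha>\<^sup>2 * real \<tau> * \<sigma>\<^sup>2)"
    using N_pos tau_pos unfolding v_seq_def z_seq_def by (simp add: field_simps)
  finally show ?thesis .
qed

lemma move_bound:
  "move_seq r \<le> L\<^sup>2 * (2 * (\<alpha> * real \<tau>)\<^sup>2 * step_seq r + 2 * (\<alpha>\<^sup>2 * real \<tau> * \<sigma>\<^sup>2))"
proof -
  have G: "integrable M (\<lambda>\<omega>. (norm (gbar r t \<omega>))\<^sup>2)" if "t < \<tau>" for t
    using that by (intro sq_integrable_norm2 gbar_sq)
  have G_int: "integrable M (\<lambda>\<omega>. \<Sum>t<\<tau>. (norm (gbar r t \<omega>))\<^sup>2)"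
    by (intro Bochner_Integration.integrable_sum G) simp
  have G_eq: "expectation (\<lambda>\<omega>. \<Sum>t<\<tau>. (norm (gbar r t \<omega>))\<^sup>2) = real \<tau> * step_seq r"
    using tau_pos unfolding step_seq_def by (subst Bochner_Integration.integral_sum) (auto intro: G)
  note [simp] = G_int move2_integrable sq_integrable_norm2[OF avg_err_sum_sq]
  have "expectation (move2 r) \<le> expectation (\<lambda>\<omega>. 2 * \<alpha>\<^sup>2 * (real \<tau> * (\<Sum>t<\<tau>. (norm (gbar r t \<omega>))\<^sup>2) + (norm (avg N (err_sum r \<omega>)))\<^sup>2))"
    by (intro integral_mono pointwise_round(4)) simp_all
  also have "\<dots> = 2 * \<alpha>\<^sup>2 * (real \<tau> * (real \<tau> * step_seq r) + expectation (\<lambda>\<omega>. (norm (avg N (err_sum r \<omega>)))\<^sup>2))"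
    unfolding G_eq[symmetric] by (simp del: Bochner_Integration.integral_sum)
  also have "\<dots> \<le> 2 * \<alpha>\<^sup>2 * (real \<tau> * (real \<tau> * step_seq r) + real \<tau> * \<sigma>\<^sup>2)"
  proof (intro mult_left_mono add_left_mono order_trans[OF avg_err_sum_moment])
    \<comment> \<open>The gain 1/N is given up here: this movement feeds only the recursions for the
      energy and the dual variable, which carry noise of full size anyway.\<close>
    show "\<sigma>\<^sup>2 / real N \<le> \<sigma>\<^sup>2" using N_pos mult_left_mono[of 1 "real N" "\<sigma>\<^sup>2"] by (simp add: divide_le_eq)
  qed auto
  finally show ?thesis unfolding move_seq_def by (intro mult_left_mono) (simp_all add: power2_eq_square algebra_simps)
qed

text \<open>Here the averaged noise keeps its factor 1/N. After division by \<alpha> \<tau> this is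
  the origin of the term \<alpha> L \<sigma>^2 / N in the final bound.\<close>

lemma gap_step:
  "gap_seq (Suc r) \<le> gap_seq r - (\<alpha> * real \<tau>) / 2 * grad_seq r - (\<alpha> * real \<tau>) / 4 * step_seq r
    + (\<alpha> * real \<tau>) * L\<^sup>2 / 2 * drift_seq r + L * (\<alpha>\<^sup>2 * real \<tau> * \<sigma>\<^sup>2 / real N)"
proof -
  have G: "integrable M (\<lambda>\<omega>. (norm (gbar r t \<omega>))\<^sup>2)" if "t < \<tau>" for t
    using that by (intro sq_integrable_norm2 gbar_sq)
  have G_int: "integrable M (\<lambda>\<omega>. \<Sum>t<\<tau>. (norm (gbar r t \<omega>))\<^sup>2)"
    by (intro Bochner_Integration.integrable_sum G) simp
  have G_eq: "expectation (\<lambda>\<omega>. \<Sum>t<\<tau>. (norm (gbar r t \<omega>))\<^sup>2) = real \<tau> * step_seq r"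
    using tau_pos unfolding step_seq_def by (subst Bochner_Integration.integral_sum) (auto intro: G)
  note [simp] = G_int sq_integrable_norm2[OF avg_err_sum_sq] sq_integrable_norm2[OF mean_grad_sq]
    Drift_integrable cost_integrable sq_integrable_inner[OF mean_grad_sq avg_err_sum_sq]
  let ?n = "expectation (\<lambda>\<omega>. (norm (avg N (err_sum r \<omega>)))\<^sup>2)"
  have "expectation (\<lambda>\<omega>. mean_cost N f (xbar (Suc r) \<omega>)) \<le> expectation (\<lambda>\<omega>. mean_cost N f (xbar r \<omega>)
      - \<alpha> * real \<tau> / 2 * (norm (mean_grad N h (xbar r \<omega>)))\<^sup>2 - \<alpha> / 4 * (\<Sum>t<\<tau>. (norm (gbar r t \<omega>))\<^sup>2)
    + \<alpha> * L\<^sup>2 / (2 * real N) * Drift r \<omega> + L * \<alpha>\<^sup>2 * (norm (avg N (err_sum r \<omega>)))\<^sup>2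
    - \<alpha> * (mean_grad N h (xbar r \<omega>) \<bullet> avg N (err_sum r \<omega>)))"
    by (intro integral_mono pointwise_round(5)) simp_all
  also have "\<dots> = expectation (\<lambda>\<omega>. mean_cost N f (xbar r \<omega>)) - \<alpha> * real \<tau> / 2 * grad_seq r
      - \<alpha> / 4 * (real \<tau> * step_seq r) + \<alpha> * L\<^sup>2 / (2 * real N) * expectation (Drift r) + L * \<alpha>\<^sup>2 * ?n - \<alpha> * 0"
    unfolding G_eq[symmetric] cross_grad[of r, symmetric] grad_seq_def
    by (simp del: Bochner_Integration.integral_sum)
  also have "L * \<alpha>\<^sup>2 * ?n \<le> L * \<alpha>\<^sup>2 * (real \<tau> * (\<sigma>\<^sup>2 / real N))"
    using L_pos by (intro mult_left_mono avg_err_sum_moment) simp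
  also have "\<alpha> * L\<^sup>2 / (2 * real N) * expectation (Drift r) = (\<alpha> * real \<tau>) * L\<^sup>2 / 2 * drift_seq r"
    using tau_pos N_pos unfolding drift_seq_def by (simp add: field_simps)
  finally show ?thesis unfolding gap_seq_def by (simp add: algebra_simps)
qed

lemma xbar_0: "\<omega> \<in> space M \<Longrightarrow> xbar 0 \<omega> = avg N x0"
  unfolding xbar_def by (intro avg_cong x_0)

text \<open>The dual iterate starts at 0, so its recentred version is the recentring term alone, and
  that is the gradient heterogeneity at the initial point.\<close>

lemma z_0: "z_seq 0 = (\<alpha> * real \<tau>)\<^sup>2 * heterogeneity N f (avg N x0)"
proof -
  have "ip N (Z 0 \<omega>) (Z 0 \<omega>) = real N * ((\<alpha> * real \<tau>)\<^sup>2 * heterogeneity N f (avg N x0))" if w: "\<omega> \<in> space M" for \<omega>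
  proof -
    have "Z 0 \<omega> i = (\<alpha> * real \<tau>) *\<^sub>R (h i (avg N x0) - grad (mean_cost N f) (avg N x0))" if "i < N" for i
      using xbar_0[OF w] y_0[OF that w] grad_eqI[OF GDERIV_mean]
      by (simp add: Z_def dual_def hetero_def dev_def xbar_def mean_grad_def)
    then have "ip N (Z 0 \<omega>) (Z 0 \<omega>) = (\<Sum>i<N. (\<alpha> * real \<tau>)\<^sup>2 * (norm (h i (avg N x0) - grad (mean_cost N f) (avg N x0)))\<^sup>2)"
      unfolding ip_self by (intro sum.cong refl) (simp add: power_mult_distrib)
    then show ?thesis using N_pos by (simp add: heterogeneity_def sum_distrib_left[symmetric])
  qed
  then have "expectation (\<lambda>\<omega>. ip N (Z 0 \<omega>) (Z 0 \<omega>)) =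
      expectation (\<lambda>\<omega>. real N * ((\<alpha> * real \<tau>)\<^sup>2 * heterogeneity N f (avg N x0)))"
    by (intro Bochner_Integration.integral_cong refl)
  then show ?thesis using N_pos by (simp add: z_seq_def prob_space)
qed

text \<open>A consensual start has no primal deviation. The energy is then purely dual, and
  \<open>energy_dual_only\<close> charges a single factor 1 / (1 - lam).\<close>

lemma v_0: "v_seq 0 \<le> z_seq 0 / (1 - lam)"
proof -
  have "Lyap 0 \<omega> \<le> ip N (Z 0 \<omega>) (Z 0 \<omega>) / (1 - lam)" if w: "\<omega> \<in> space M" for \<omega>
  proof -
    have "X 0 \<omega> i = 0" if i: "i < N" for i
    proof -
      have "avg N x0 = avg N (\<lambda>j. x0 i)" by (intro avg_cong consensual i)
      then show ?thesis using xbar_0[OF w] x_0[OF i w]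
        by (simp add: X_def dev_def xbar_def avg_const[OF N_pos])
    qed
    then have "Lyap 0 \<omega> = energy (\<lambda>i. 0) (S (Z 0 \<omega>))" unfolding Lyap_def by (intro energy_cong) auto
    moreover have "(1 - lam) * energy (\<lambda>i. 0) (S (Z 0 \<omega>)) \<le> ip N (A (S (Z 0 \<omega>))) (A (S (Z 0 \<omega>)))"
      by (rule energy_dual_only)
    moreover have "ip N (A (S (Z 0 \<omega>))) (A (S (Z 0 \<omega>))) = ip N (Z 0 \<omega>) (Z 0 \<omega>)"
      by (intro ip_cong A_S)
    ultimately show ?thesis using lam_less_1 by (simp add: pos_le_divide_eq mult.commute)
  qed
  then have "expectation (Lyap 0) \<le> expectation (\<lambda>\<omega>. ip N (Z 0 \<omega>) (Z 0 \<omega>) / (1 - lam))"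
    by (intro integral_mono Lyap_integrable) (simp_all add: ip_integrable)
  then have "expectation (Lyap 0) / real N \<le> expectation (\<lambda>\<omega>. ip N (Z 0 \<omega>) (Z 0 \<omega>) / (1 - lam)) / real N"
    by (rule divide_right_mono) simp
  then show ?thesis by (simp add: v_seq_def z_seq_def mult.commute)
qed

lemma gap_0: "gap_seq 0 = mean_cost N f (avg N x0) - opt_value N f"
proof -
  have "expectation (\<lambda>\<omega>. mean_cost N f (xbar 0 \<omega>)) = expectation (\<lambda>\<omega>. mean_cost N f (avg N x0))"
    by (intro Bochner_Integration.integral_cong refl) (simp add: xbar_0)
  then show ?thesis by (simp add: gap_seq_def prob_space)
qed

lemma round_error_eq: "round_error M N \<tau> f x \<phi> r = grad_seq r + step_seq r"
  by (simp add: round_error_def grad_seq_def step_seq_def gbar_def xbar_def grad_eqI[OF GDERIV_mean])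

lemma average_error_le:
  assumes "1 \<le> R"
  shows "(1 / real R) * (\<Sum>r<R. round_error M N \<tau> f x \<phi> r)
      \<le> 1520 * ((mean_cost N f (avg N x0) - opt_value N f) / (\<alpha> * real \<tau> * real R)
               + \<alpha>\<^sup>2 * (real \<tau>)\<^sup>2 * L\<^sup>2 * heterogeneity N f (avg N x0) / ((1 - lam)\<^sup>2 * real R))
        + 3000 * (\<alpha> * L * \<sigma>\<^sup>2 / real N + \<alpha>\<^sup>2 * real \<tau> * L\<^sup>2 * \<sigma>\<^sup>2 / (1 - lam))"
proof -
  let ?s = "\<alpha>\<^sup>2 * real \<tau> * \<sigma>\<^sup>2"
  have sum_le: "(\<Sum>r<R. grad_seq r + step_seq r) \<le> 1520 * (gap_seq 0 / (\<alpha> * real \<tau>) + L\<^sup>2 * z_seq 0 / (1 - lam)\<^sup>2)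
      + 8 * (real R * (L * (?s / real N)) / (\<alpha> * real \<tau>)) + 3000 * (real R * L\<^sup>2 * ?s / (1 - lam))"
  proof (rule summed_bound[where v = v_seq and z = z_seq and x = drift_seq and d = move_seq and F = gap_seq])
    show "0 < \<alpha> * real \<tau>" using alpha_pos tau_pos by simp
  qed (use lam_less_1 lam_nonneg L_pos alpha_small seq_nonneg v_step z_step drift_bound move_bound gap_step v_0 in auto)
  have "(1 / real R) * (\<Sum>r<R. round_error M N \<tau> f x \<phi> r) \<le> (1 / real R) *
    (1520 * (gap_seq 0 / (\<alpha> * real \<tau>) + L\<^sup>2 * z_seq 0 / (1 - lam)\<^sup>2)
      + 8 * (real R * (L * (?s / real N)) / (\<alpha> * real \<tau>)) + 3000 * (real R * L\<^sup>2 * ?s / (1 - lam)))"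
    unfolding round_error_eq by (rule mult_left_mono[OF sum_le]) simp
  also have "\<dots> = 1520 * (gap_seq 0 / (\<alpha> * real \<tau> * real R) + L\<^sup>2 * z_seq 0 / ((1 - lam)\<^sup>2 * real R))
      + 8 * (\<alpha> * L * \<sigma>\<^sup>2 / real N) + 3000 * (\<alpha>\<^sup>2 * real \<tau> * L\<^sup>2 * \<sigma>\<^sup>2 / (1 - lam))"
  proof -
    have 1: "(1 / real R) * (real R * (L * (?s / real N)) / (\<alpha> * real \<tau>)) = \<alpha> * L * \<sigma>\<^sup>2 / real N"
      using assms alpha_pos tau_pos N_pos by (simp add: field_simps power2_eq_square)
    have 2: "(1 / real R) * (real R * L\<^sup>2 * ?s / (1 - lam)) = \<alpha>\<^sup>2 * real \<tau> * L\<^sup>2 * \<sigma>\<^sup>2 / (1 - lam)"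
      using assms by simp
    have 3: "(1 / real R) * (gap_seq 0 / (\<alpha> * real \<tau>) + L\<^sup>2 * z_seq 0 / (1 - lam)\<^sup>2) =
        gap_seq 0 / (\<alpha> * real \<tau> * real R) + L\<^sup>2 * z_seq 0 / ((1 - lam)\<^sup>2 * real R)"
      by (simp add: distrib_left mult.commute)
    have "(1 / real R) * (1520 * a + 8 * b + 3000 * c) = 1520 * ((1 / real R) * a) + 8 * ((1 / real R) * b) + 3000 * ((1 / real R) * c)"
      for a b c by (simp add: algebra_simps)
    then show ?thesis unfolding 1 2 3 by (simp only: 1 2 3)
  qed
  \<comment> \<open>The smaller constant 8 is enlarged so that both noise terms share one
    constant.\<close>
  also have "8 * (\<alpha> * L * \<sigma>\<^sup>2 / real N) \<le> 3000 * (\<alpha> * L * \<sigma>\<^sup>2 / real N)"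
    using alpha_pos L_pos by (intro mult_right_mono) auto
  finally show ?thesis unfolding z_0 gap_0 by (simp add: power_mult_distrib algebra_simps)
qed

end

theorem theorem1:
  shows "\<exists>C1>0. \<exists>C2>0. \<forall>(\<tau>::nat) (L::real) (lam::real).
    1 \<le> \<tau> \<and> 0 < L \<and> lam < 1 \<longrightarrow>
    (\<exists>\<alpha>0>0. \<forall>(\<alpha>::real) (N::nat) (nbr :: nat \<Rightarrow> nat set) (W :: real mat)
        (M :: 'w measure) (D :: nat \<Rightarrow> 's measure)
        (F :: nat \<Rightarrow> 'a::euclidean_space \<Rightarrow> 's \<Rightarrow> real) (f :: nat \<Rightarrow> 'a \<Rightarrow> real)
        (\<xi> :: nat \<Rightarrow> nat \<Rightarrow> nat \<Rightarrow> 'w \<Rightarrow> 's) (x0 :: nat \<Rightarrow> 'a)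
        (x :: nat \<Rightarrow> nat \<Rightarrow> 'w \<Rightarrow> 'a) (y :: nat \<Rightarrow> nat \<Rightarrow> 'w \<Rightarrow> 'a)
        (\<phi> :: nat \<Rightarrow> nat \<Rightarrow> nat \<Rightarrow> 'w \<Rightarrow> 'a) (\<sigma>::real) (R::nat).
      0 < \<alpha> \<and> \<alpha> \<le> \<alpha>0 \<and> 1 \<le> R \<and>
      prob_space M \<and>
      network_assumption N nbr W \<and> mixing_rate N W = lam \<and>
      stochastic_costs N D F f \<and>
      smoothness_assumption N L f \<and>
      (\<forall>i<N. \<forall>j<N. x0 i = x0 j) \<and>
      LED_run N nbr W \<tau> \<alpha> (1 / real \<tau>) (space M) F \<xi> x0 x y \<phi> \<and>
      noise_assumption M N \<tau> D F f \<xi> \<phi> \<sigma>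
      \<longrightarrow>
      (1 / real R) * (\<Sum>r<R. round_error M N \<tau> f x \<phi> r)
      \<le> C1 * ((mean_cost N f (avg N x0) - opt_value N f) / (\<alpha> * real \<tau> * real R)
               + \<alpha>\<^sup>2 * (real \<tau>)\<^sup>2 * L\<^sup>2 * heterogeneity N f (avg N x0) / ((1 - lam)\<^sup>2 * real R))
        + C2 * (\<alpha> * L * \<sigma>\<^sup>2 / real N
               + \<alpha>\<^sup>2 * real \<tau> * L\<^sup>2 * \<sigma>\<^sup>2 / (1 - lam)))"
proof (rule exI[of _ "1520 :: real"], rule conjI, simp, rule exI[of _ "3000 :: real"], rule conjI, simp,
    intro allI impI)
  fix \<tau> :: nat and L lam :: real
  assume par: "1 \<le> \<tau> \<and> 0 < L \<and> lam < 1"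
  \<comment> \<open>This is \<alpha> \<tau> L <= (1 - lam)^2 / 200 solved for \<alpha>. It depends
    on \<tau>, L and lam alone, so it can be fixed before the network, the costs and the
    data.\<close>
  let ?\<alpha>0 = "(1 - lam)\<^sup>2 / (200 * real \<tau> * L)"
  show "\<exists>\<alpha>0>0. \<forall>(\<alpha>::real) (N::nat) (nbr :: nat \<Rightarrow> nat set) (W :: real mat)
        (M :: 'w measure) (D :: nat \<Rightarrow> 's measure)
        (F :: nat \<Rightarrow> 'a::euclidean_space \<Rightarrow> 's \<Rightarrow> real) (f :: nat \<Rightarrow> 'a \<Rightarrow> real)
        (\<xi> :: nat \<Rightarrow> nat \<Rightarrow> nat \<Rightarrow> 'w \<Rightarrow> 's) (x0 :: nat \<Rightarrow> 'a)
        (x :: nat \<Rightarrow> nat \<Rightarrow> 'w \<Rightarrow> 'a) (y :: nat \<Rightarrow> nat \<Rightarrow> 'w \<Rightarrow> 'a)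
        (\<phi> :: nat \<Rightarrow> nat \<Rightarrow> nat \<Rightarrow> 'w \<Rightarrow> 'a) (\<sigma>::real) (R::nat).
      0 < \<alpha> \<and> \<alpha> \<le> \<alpha>0 \<and> 1 \<le> R \<and>
      prob_space M \<and>
      network_assumption N nbr W \<and> mixing_rate N W = lam \<and>
      stochastic_costs N D F f \<and>
      smoothness_assumption N L f \<and>
      (\<forall>i<N. \<forall>j<N. x0 i = x0 j) \<and>
      LED_run N nbr W \<tau> \<alpha> (1 / real \<tau>) (space M) F \<xi> x0 x y \<phi> \<and>
      noise_assumption M N \<tau> D F f \<xi> \<phi> \<sigma>
      \<longrightarrow>
      (1 / real R) * (\<Sum>r<R. round_error M N \<tau> f x \<phi> r)
      \<le> 1520 * ((mean_cost N f (avg N x0) - opt_value N f) / (\<alpha> * real \<tau> * real R)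
               + \<alpha>\<^sup>2 * (real \<tau>)\<^sup>2 * L\<^sup>2 * heterogeneity N f (avg N x0) / ((1 - lam)\<^sup>2 * real R))
        + 3000 * (\<alpha> * L * \<sigma>\<^sup>2 / real N
               + \<alpha>\<^sup>2 * real \<tau> * L\<^sup>2 * \<sigma>\<^sup>2 / (1 - lam))"
  proof (intro exI[of _ ?\<alpha>0] conjI allI impI, goal_cases)
    case 1
    show ?case using par by simp
  next
    case (2 \<alpha> N nbr W M D F f \<xi> x0 x y \<phi> \<sigma> R)
    then have hyps: "prob_space M" "network_assumption N nbr W" "mixing_rate N W = lam" "0 < \<alpha>" "1 \<le> \<tau>"
      "stochastic_costs N D F f" "smoothness_assumption N L f"
      "LED_run N nbr W \<tau> \<alpha> (1 / real \<tau>) (space M) F \<xi> x0 x y \<phi>"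
      "noise_assumption M N \<tau> D F f \<xi> \<phi> \<sigma>" and R: "1 \<le> R" and \<alpha>: "\<alpha> \<le> ?\<alpha>0"
      and consensual: "\<And>i j. i < N \<Longrightarrow> j < N \<Longrightarrow> x0 i = x0 j"
      using par by blast+
    have "\<alpha> * real \<tau> * L \<le> (1 - lam)\<^sup>2 / 200"
      using mult_right_mono[OF \<alpha>, of "real \<tau> * L"] par by (simp add: mult.assoc)
    then interpret led_process N nbr W lam M \<tau> \<alpha> L \<sigma> D F f \<xi> x0 x y \<phi>
      by (intro led_process.intro network.intro led_process_axioms.intro hyps consensual)
    show ?case by (rule average_error_le[OF R])
  qed
qed

end
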